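(* Let $W=(x_1,\dots,x_n,f(x_1,\dots,x_n))$ be a non-parallelizable local $(n+1)$-web of codimension 1 near the (suitably chosen) origin, let $\mathfrak g$ be its Lie algebra of infinitesimal isomorphisms, of dimension $m$, and let $M$ be the matrix of components of a basis of $\mathfrak g$. Then, after suitable changes of variables $x_i\mapsto g_i(x_i)$, one may assume that all coefficients of $M$ are polynomials of degree at most 2. Moreover, each column of $M$ which is not identically zero contains at least one coefficient equal to 1.
   Context: Everything is local near a point called the origin, and all functions and vector fields are real analytic. A $d$-web of codimension 1 is a family of $d$ foliations of codimension 1, any $n$ of which are transverse; it is denoted by its first integrals. Here $W=(x_1,\dots,x_n,f)$ with all $\partial f/\partial x_i$ non-vanishing. It is parallelizable if in some local coordinates all its foliations admit linear first integrals. An infinitesimal isomorphism of $W$ is a vector field whose flow preserves each of the $n+1$ foliations; such a field has the form $X=\sum_iX_i(x_i)\,\partial/\partial x_i$, the $i$-th component depending only on $x_i$. Given a basis $(X^1,\dots,X^m)$ of $\mathfrak g$, with $X^j=\sum_iX^j_i(x_i)\,\partial/\partial x_i$, the matrix $M$ is the $m\times n$ matrix of functions whose $i$-th column consists of $X_i^1(x_i),\dots,X_i^m(x_i)$. Choice of origin: for each of the $n+1$ foliations of the web, near the origin the orbits of $\mathfrak g$ are either all transverse to its leaves or all contained in its leaves. In particular, for each $i$, either all $X_i^j$ ($j=1,\dots,m$) vanish identically or some $X_i^j$ is non-zero at the origin.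
   Formalization: Polynomiality of degree at most 2 is stated for every basis of 𝔤, but the claim that each non-zero column contains a coefficient equal to 1 is stated, in the same variables, for a suitably chosen basis, since it fails for an arbitrary prescribed basis. *)

theory Defs
  imports "HOL-Analysis.Analysis" "HOL-Computational_Algebra.Polynomial"
begin

text \<open>
  The origin is \<open>0\<close>. Functions and vector fields are representatives of germs at \<open>0\<close>:
  they are total functions, but only their values near \<open>0\<close> matter in what follows.
\<close>

definition real_analytic_at :: "(real ^ 'n \<Rightarrow> real) \<Rightarrow> real ^ 'n \<Rightarrow> bool" where
  "real_analytic_at u p \<longleftrightarrow>
    (\<exists>r>0. \<exists>a :: ('n \<Rightarrow> nat) \<Rightarrow> real. \<forall>x \<in> ball p r.
      ((\<lambda>\<alpha>. a \<alpha> * (\<Prod>i\<in>UNIV. (x $ i - p $ i) ^ \<alpha> i)) has_sum u x) UNIV)"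

definition real_analytic1_at :: "(real \<Rightarrow> real) \<Rightarrow> real \<Rightarrow> bool" where
  "real_analytic1_at h p \<longleftrightarrow>
    (\<exists>r>0. \<exists>a :: nat \<Rightarrow> real. \<forall>x \<in> ball p r. (\<lambda>k. a k * (x - p) ^ k) sums h x)"

definition analytic_field :: "(real ^ 'n \<Rightarrow> real ^ 'n) \<Rightarrow> bool" where
  "analytic_field V \<longleftrightarrow> (\<forall>i. real_analytic_at (\<lambda>x. V x $ i) 0)"

definition deriv_along :: "(real ^ 'n \<Rightarrow> real ^ 'n) \<Rightarrow> (real ^ 'n \<Rightarrow> real) \<Rightarrow> real ^ 'n \<Rightarrow> real" where
  "deriv_along V u x = frechet_derivative u (at x) (V x)"

text \<open>The web \<open>(x\<^sub>1, \<dots>, x\<^sub>n, f)\<close> is represented by \<open>f\<close>.\<close>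

definition local_web :: "(real ^ 'n \<Rightarrow> real) \<Rightarrow> bool" where
  "local_web f \<longleftrightarrow> real_analytic_at f 0 \<and>
    (\<forall>\<^sub>F x in nhds 0. \<forall>i. frechet_derivative f (at x) (axis i 1) \<noteq> 0)"

definition first_integrals :: "(real ^ 'n \<Rightarrow> real) \<Rightarrow> (real ^ 'n \<Rightarrow> real) set" where
  "first_integrals f = insert f (range (\<lambda>i x. x $ i))"

definition same_foliation :: "(real ^ 'n \<Rightarrow> real) \<Rightarrow> (real ^ 'n \<Rightarrow> real) \<Rightarrow> bool" where
  "same_foliation u v \<longleftrightarrow>
    (\<exists>U. open U \<and> 0 \<in> U \<and> (\<forall>x\<in>U. \<forall>y\<in>U. u x = u y \<longleftrightarrow> v x = v y))"

definition local_coordinates :: "(real ^ 'n \<Rightarrow> real ^ 'n) \<Rightarrow> bool" where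
  "local_coordinates \<Psi> \<longleftrightarrow> analytic_field \<Psi> \<and> (\<exists>D. (\<Psi> has_derivative D) (at 0) \<and> bij D)"

definition parallelizable :: "(real ^ 'n \<Rightarrow> real) \<Rightarrow> bool" where
  "parallelizable f \<longleftrightarrow>
    (\<exists>\<Psi>. local_coordinates \<Psi> \<and>
      (\<forall>u \<in> first_integrals f. \<exists>c. c \<noteq> 0 \<and> same_foliation u (\<lambda>x. c \<bullet> \<Psi> x)))"

definition local_flow ::
  "(real ^ 'n \<Rightarrow> real ^ 'n) \<Rightarrow> real \<Rightarrow> (real ^ 'n) set \<Rightarrow> (real \<Rightarrow> real ^ 'n \<Rightarrow> real ^ 'n) \<Rightarrow> bool" where
  "local_flow V \<epsilon> U \<Phi> \<longleftrightarrow> 0 < \<epsilon> \<and> open U \<and> 0 \<in> U \<and>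
    (\<forall>x\<in>U. \<Phi> 0 x = x \<and>
      (\<forall>t. \<bar>t\<bar> < \<epsilon> \<longrightarrow> ((\<lambda>s. \<Phi> s x) has_vector_derivative V (\<Phi> t x)) (at t)))"

text \<open>The leaves are the level sets of the first integral \<open>u\<close>; each is mapped into a leaf.\<close>

definition preserves_foliation ::
  "real \<Rightarrow> (real ^ 'n) set \<Rightarrow> (real \<Rightarrow> real ^ 'n \<Rightarrow> real ^ 'n) \<Rightarrow> (real ^ 'n \<Rightarrow> real) \<Rightarrow> bool" where
  "preserves_foliation \<epsilon> U \<Phi> u \<longleftrightarrow>
    (\<forall>t. \<bar>t\<bar> < \<epsilon> \<longrightarrow> (\<forall>x\<in>U. \<forall>y\<in>U. u x = u y \<longrightarrow> u (\<Phi> t x) = u (\<Phi> t y)))"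

definition inf_isos :: "(real ^ 'n \<Rightarrow> real) \<Rightarrow> (real ^ 'n \<Rightarrow> real ^ 'n) set" where
  "inf_isos f = {V. analytic_field V \<and>
    (\<exists>\<epsilon> U \<Phi>. local_flow V \<epsilon> U \<Phi> \<and> (\<forall>u \<in> first_integrals f. preserves_foliation \<epsilon> U \<Phi> u))}"

text \<open>Linear combinations are compared as germs at \<open>0\<close>.\<close>

definition is_basis :: "(real ^ 'n \<Rightarrow> real) \<Rightarrow> nat \<Rightarrow> (nat \<Rightarrow> real ^ 'n \<Rightarrow> real ^ 'n) \<Rightarrow> bool" where
  "is_basis f m B \<longleftrightarrow>
    (\<forall>j<m. B j \<in> inf_isos f) \<and>
    (\<forall>c :: nat \<Rightarrow> real. (\<forall>\<^sub>F x in nhds 0. (\<Sum>j<m. c j *\<^sub>R B j x) = 0) \<longrightarrow> (\<forall>j<m. c j = 0)) \<and>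
    (\<forall>V \<in> inf_isos f. \<exists>c :: nat \<Rightarrow> real. \<forall>\<^sub>F x in nhds 0. V x = (\<Sum>j<m. c j *\<^sub>R B j x))"

definition has_dimension :: "(real ^ 'n \<Rightarrow> real) \<Rightarrow> nat \<Rightarrow> bool" where
  "has_dimension f m \<longleftrightarrow> (\<exists>B. is_basis f m B)"

text \<open>
  The tangent space at \<open>x\<close> of the orbit through \<open>x\<close> consists of the values at \<open>x\<close> of the
  infinitesimal isomorphisms. As leaves have codimension 1, the orbit is transverse to the leaf
  iff one of these values is not tangent to the leaf; if this holds for some field at \<open>0\<close>, it
  holds for the same field at all points near \<open>0\<close>. A field is quantified before the points,
  since the values of the members of \<open>inf_isos f\<close> have no meaning at a fixed point other than \<open>0\<close>.
\<close>

definition suitable_origin :: "(real ^ 'n \<Rightarrow> real) \<Rightarrow> bool" where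
  "suitable_origin f \<longleftrightarrow>
    (\<forall>u \<in> first_integrals f.
      (\<exists>V \<in> inf_isos f. \<forall>\<^sub>F x in nhds 0. deriv_along V u x \<noteq> 0) \<or>
      (\<forall>V \<in> inf_isos f. \<forall>\<^sub>F x in nhds 0. deriv_along V u x = 0))"

text \<open>
  The \<open>i\<close>-th component of an infinitesimal isomorphism depends on \<open>x\<^sub>i\<close> only, so the function
  \<open>X\<^sub>i\<close> of one variable can be read off on the \<open>i\<close>-th coordinate axis.
\<close>

definition comp_matrix ::
  "(nat \<Rightarrow> real ^ 'n \<Rightarrow> real ^ 'n) \<Rightarrow> nat \<Rightarrow> 'n \<Rightarrow> real \<Rightarrow> real" where
  "comp_matrix B j i = (\<lambda>s. B j (axis i s) $ i)"

definition change_of_variable :: "(real \<Rightarrow> real) \<Rightarrow> bool" where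
  "change_of_variable g \<longleftrightarrow> real_analytic1_at g 0 \<and> g 0 = 0 \<and> deriv g 0 \<noteq> 0"

text \<open>In the new variable \<open>y = g x\<close> the field \<open>X(x) \<partial>/\<partial>x\<close> becomes \<open>Y(y) \<partial>/\<partial>y\<close> near \<open>0\<close>.\<close>

definition becomes :: "(real \<Rightarrow> real) \<Rightarrow> (real \<Rightarrow> real) \<Rightarrow> (real \<Rightarrow> real) \<Rightarrow> bool" where
  "becomes g X Y \<longleftrightarrow> (\<forall>\<^sub>F s in nhds 0. Y (g s) = deriv g s * X s)"

definition zero_column :: "nat \<Rightarrow> (nat \<Rightarrow> 'n \<Rightarrow> real \<Rightarrow> real) \<Rightarrow> 'n \<Rightarrow> bool" where
  "zero_column m M i \<longleftrightarrow> (\<forall>j<m. \<forall>\<^sub>F s in nhds 0. M j i s = 0)"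

end

theory Submission
  imports Defs
begin

text \<open>
  An infinitesimal isomorphism is encoded by the Taylor series \<open>X\<^sub>i\<close> of its components. These tuples
  form a finite-dimensional Lie algebra: a product field \<open>X\<close> is an infinitesimal isomorphism iff \<open>X f\<close>
  is a function of \<open>f\<close>, a condition stable under linear combinations and brackets.

  By Lie, a finite-dimensional Lie algebra of fields on the line which is transitive at \<open>0\<close> contains
  no non-zero field vanishing to order 3, hence is, in a suitable variable, spanned by \<open>1\<close>, by
  \<open>1, x\<close> or by \<open>1, x, x\<^sup>2\<close>. Call a field \<open>W\<close> parabolic at \<open>i\<close> if \<open>W\<^sub>i\<close> does not vanish at \<open>0\<close>
  and \<open>ad(W\<^sub>i)\<^sup>3 = 0\<close> on the projection to the \<open>i\<close>-th axis; in the variable with \<open>W\<^sub>i = 1\<close> all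
  \<open>i\<close>-th components are then polynomials of degree at most 2. One field, a generic sum of brackets,
  is parabolic at all indices of the second kind; another one, built from the distinct simple
  quotients, at all indices of the third kind; and at indices of the first kind any field with
  non-zero component is parabolic. A basis containing the first two fields has the required entries.
\<close>

text \<open>One basis has to serve all columns at once, and there may be more columns than basis
  elements, so a field chosen for one index has to work at many others. Being non-zero at the origin
  is not enough: for W = (1 + x) d/dx in the span of d/dx and x d/dx, the variable y = log (1 + x)
  makes W constant but turns d/dx into exp (- y) d/dy. What counts is that ad W is nilpotent on the
  projection. In the two-dimensional case the nilpotent elements form a line, so sums of brackets
  are harmless. In the three-dimensional case they form only a cone in sl_2, and sums are harmless
  only after the simple quotients have been decoupled. This is why the two kinds of indices get
  separate fields.

  Stability under brackets has an analytic obstacle: in X f = h (f) the function h is arbitrary at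
  the outset, while the bracket involves its derivative. Moreover, isomorphisms are defined by
  flows, so passing to the condition on X f and back takes existence and uniqueness for ordinary
  differential equations.\<close>

unbundle no vec_syntax and fps_syntax

section \<open>Lie algebras of vector fields on the line\<close>

definition bracket :: "real fps \<Rightarrow> real fps \<Rightarrow> real fps" where
  "bracket X Y = X * fps_deriv Y - Y * fps_deriv X"

lemma bracket_add_left: "bracket (X + Y) Z = bracket X Z + bracket Y Z"
  and bracket_add_right: "bracket Z (X + Y) = bracket Z X + bracket Z Y"
  and bracket_diff_left: "bracket (X - Y) Z = bracket X Z - bracket Y Z"
  and bracket_diff_right: "bracket Z (X - Y) = bracket Z X - bracket Z Y"
  and bracket_minus_left: "bracket (- X) Z = - bracket X Z"
  and bracket_minus_right: "bracket Z (- X) = - bracket Z X"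
  by (simp_all add: bracket_def algebra_simps)

lemma bracket_scale_left: "bracket (fps_const c * X) Y = fps_const c * bracket X Y"
  and bracket_scale_right: "bracket Y (fps_const c * X) = fps_const c * bracket Y X"
  by (simp_all add: bracket_def algebra_simps)

lemma bracket_0_left [simp]: "bracket 0 Y = 0"
  and bracket_0_right [simp]: "bracket Y 0 = 0"
  and bracket_self [simp]: "bracket Y Y = 0"
  by (simp_all add: bracket_def)

lemma bracket_flip: "bracket Y X = - bracket X Y"
  by (simp add: bracket_def)

lemmas bracket_linear = bracket_add_left bracket_add_right bracket_diff_left bracket_diff_right
  bracket_minus_left bracket_minus_right bracket_scale_left bracket_scale_right

lemma bracket_jacobi: "bracket X (bracket Y Z) = bracket (bracket X Y) Z + bracket Y (bracket X Z)"
  by (simp add: bracket_def algebra_simps)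

text \<open>In the Cauchy product a term with index i can survive only if i \<ge> p and n - i + 1
  \<ge> q. For n + 1 = p + q this leaves i = p alone. The numbers p and q are lower bounds for the
  orders; the coefficients at p and q may vanish.\<close>

lemma mult_deriv_nth:
  fixes X Y :: "real fps"
  assumes "\<forall>k<p. X $ k = 0" "\<forall>k<q. Y $ k = 0"
  shows "Suc n < p + q \<Longrightarrow> (X * fps_deriv Y) $ n = 0"
    and "Suc n = p + q \<Longrightarrow> (X * fps_deriv Y) $ n = of_nat q * X $ p * Y $ q"
proof -
  have sm: "(X * fps_deriv Y) $ n = (\<Sum>i=0..n. X $ i * (of_nat (n - i + 1) * Y $ (n - i + 1)))"
    by (simp add: fps_mult_nth)
  have z: "X $ i * (of_nat (n - i + 1) * Y $ (n - i + 1)) = 0"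
    if "i \<le> n" "Suc n \<le> p + q" "i = p \<Longrightarrow> Suc n < p + q" for i
  proof (cases "i < p")
    case False
    then have "n - i + 1 < q" using that by linarith
    then show ?thesis using assms by simp
  qed (use assms in auto)
  show "(X * fps_deriv Y) $ n = 0" if "Suc n < p + q"
    unfolding sm by (rule sum.neutral) (use z that in auto)
  show "(X * fps_deriv Y) $ n = of_nat q * X $ p * Y $ q" if eq: "Suc n = p + q"
  proof (cases "p \<le> n")
    case True
    have "(\<Sum>i=0..n. X $ i * (of_nat (n - i + 1) * Y $ (n - i + 1)))
      = (\<Sum>i\<in>{p}. X $ i * (of_nat (n - i + 1) * Y $ (n - i + 1)))"
    proof (rule sum.mono_neutral_right)
      show "\<forall>i\<in>{0..n} - {p}. X $ i * (of_nat (n - i + 1) * Y $ (n - i + 1)) = 0"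
        using z eq by (metis DiffE atLeastAtMost_iff order_refl singletonI)
    qed (use True in auto)
    moreover have "n - p + 1 = q" using eq True by linarith
    ultimately show ?thesis unfolding sm by simp
  next
    case False
    then have "q = 0" using eq by linarith
    moreover have "(\<Sum>i=0..n. X $ i * (of_nat (n - i + 1) * Y $ (n - i + 1))) = 0"
      by (rule sum.neutral) (use False assms in auto)
    ultimately show ?thesis unfolding sm by simp
  qed
qed

text \<open>This is the grading of formal fields: x^p d/dx and x^q d/dx have the bracket (q - p)
  x^(p+q-1) d/dx.\<close>

lemma bracket_nth:
  assumes "\<forall>k<p. X $ k = 0" "\<forall>k<q. Y $ k = 0"
  shows bracket_nth_low: "Suc n < p + q \<Longrightarrow> bracket X Y $ n = 0"
    and bracket_nth_lead: "Suc n = p + q \<Longrightarrow> bracket X Y $ n = (of_nat q - of_nat p) * X $ p * Y $ q"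
  using mult_deriv_nth[OF assms, of n] mult_deriv_nth[OF assms(2,1), of n]
  by (simp_all add: bracket_def algebra_simps)

text \<open>Finite dimension enters only through \<open>bounded_order\<close>: only 0 vanishes to
  arbitrarily high order, with one bound for the whole algebra.\<close>

locale line_algebra =
  fixes S :: "real fps set"
  assumes add: "X \<in> S \<Longrightarrow> Y \<in> S \<Longrightarrow> X + Y \<in> S"
    and scale: "X \<in> S \<Longrightarrow> fps_const c * X \<in> S"
    and bracket_mem: "X \<in> S \<Longrightarrow> Y \<in> S \<Longrightarrow> bracket X Y \<in> S"
    and bounded_order: "\<exists>N. \<forall>X\<in>S. (\<forall>k<N. X $ k = 0) \<longrightarrow> X = 0"
    and transitive: "\<exists>E\<in>S. E $ 0 = 1"
begin

lemma diff: "X \<in> S \<Longrightarrow> Y \<in> S \<Longrightarrow> X - Y \<in> S"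
  using add[of X "fps_const (-1) * Y"] scale[of Y "-1"] by (simp flip: fps_const_neg)

text \<open>Bracketing an element of maximal order \<open>d\<close> with its bracket with a non-vanishing field
  gives order \<open>2 d - 2\<close>, which exceeds \<open>d\<close> if \<open>d > 2\<close>.\<close>

lemma order_le_2:
  assumes "F \<in> S" "F $ 0 = 0" "F $ 1 = 0" "F $ 2 = 0"
  shows "F = 0"
proof (rule ccontr)
  assume "F \<noteq> 0"
  obtain E where E: "E \<in> S" "E $ 0 = 1" using transitive by blast
  obtain N where N: "\<And>X. X \<in> S \<Longrightarrow> \<forall>k<N. X $ k = 0 \<Longrightarrow> X = 0" using bounded_order by blast
  have sub: "\<forall>X. X \<in> S \<and> X \<noteq> 0 \<longrightarrow> subdegree X < N"
  proof (intro allI impI)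
    fix X assume X: "X \<in> S \<and> X \<noteq> 0"
    show "subdegree X < N"
    proof (rule ccontr)
      assume "\<not> subdegree X < N"
      then have "\<forall>k<N. X $ k = 0" by (auto intro!: nth_less_subdegree_zero)
      then show False using N X by blast
    qed
  qed
  obtain G where G: "G \<in> S" "G \<noteq> 0" and mx: "\<And>X. X \<in> S \<Longrightarrow> X \<noteq> 0 \<Longrightarrow> subdegree X \<le> subdegree G"
    using ex_has_greatest_nat[of "\<lambda>X. X \<in> S \<and> X \<noteq> 0" F subdegree, OF _ sub] assms(1) \<open>F \<noteq> 0\<close>
    by auto
  define d where "d = subdegree G"
  have "3 \<le> subdegree F"
    by (rule subdegree_geI[OF \<open>F \<noteq> 0\<close>])
      (use assms in \<open>auto simp: numeral_3_eq_3 less_Suc_eq numeral_2_eq_2\<close>)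
  then have d: "d \<ge> 3" using mx[OF assms(1) \<open>F \<noteq> 0\<close>] by (simp add: d_def)
  have Gd: "\<forall>k<d. G $ k = 0" "G $ d \<noteq> 0" using G by (auto simp: d_def)
  define H where "H = bracket E G"
  have Hz: "\<forall>k<d-1. H $ k = 0" and Hl: "H $ (d - 1) = of_nat d * G $ d"
    using bracket_nth[of 0 E d G] Gd E d by (auto simp: H_def)
  have "\<forall>k<2*d-2. bracket G H $ k = 0"
    using bracket_nth_low[OF Gd(1) Hz] d by auto
  \<comment> \<open>The orders are d and d - 1, so the leading index is d + (d - 1) - 1 and the
    factor is (d - 1) - d = - 1.\<close>
  moreover have "bracket G H $ (2*d-2) = - (G $ d * (of_nat d * G $ d))"
    using bracket_nth_lead[OF Gd(1) Hz, of "2*d-2"] Hl d by (simp add: of_nat_diff algebra_simps)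
  then have nz: "bracket G H $ (2*d-2) \<noteq> 0" using Gd d by auto
  ultimately have "subdegree (bracket G H) = 2*d-2" by (intro subdegreeI) auto
  moreover have "bracket G H \<noteq> 0" using nz by auto
  moreover have "bracket G H \<in> S" using G E by (auto simp: H_def intro: bracket_mem)
  ultimately have "2*d-2 \<le> d" using mx[of "bracket G H"] d_def by simp
  then show False using d by linarith
qed

text \<open>The model is E = d/dx, H = x d/dx. Elements are determined by their 1-jets, and the
  bracket of \<open>E0\<close> and \<open>H\<close> has value 1 at 0, so it equals \<open>E0\<close>
  plus some c H. Since H commutes with itself, adding c H to \<open>E0\<close> yields an exact
  eigenvector.\<close>

lemma affine_basis:
  assumes no2: "\<And>X. X \<in> S \<Longrightarrow> X $ 0 = 0 \<Longrightarrow> X $ 1 = 0 \<Longrightarrow> X = 0"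
    and H0: "H0 \<in> S" "H0 $ 0 = 0" "H0 \<noteq> 0"
  obtains E H where "E \<in> S" "H \<in> S" "E $ 0 = 1" "bracket E H = E"
    "\<And>X. X \<in> S \<Longrightarrow> \<exists>a b. X = fps_const a * E + fps_const b * H"
proof -
  obtain E0 where E0: "E0 \<in> S" "E0 $ 0 = 1" using transitive by blast
  have "H0 $ 1 \<noteq> 0" using no2 H0 by blast
  define H where "H = fps_const (inverse (H0 $ 1)) * H0"
  have H: "H \<in> S" "H $ 0 = 0" "H $ 1 = 1"
    using H0 \<open>H0 $ 1 \<noteq> 0\<close> by (auto simp: H_def scale)
  have comb: "X = fps_const (X $ 0) * E0 + fps_const (X $ 1 - X $ 0 * E0 $ 1) * H" if "X \<in> S" for X
  proof -
    let ?Y = "X - (fps_const (X $ 0) * E0 + fps_const (X $ 1 - X $ 0 * E0 $ 1) * H)"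
    have "?Y = 0" by (rule no2) (use that E0 H in \<open>auto intro!: diff add scale\<close>)
    then show ?thesis by simp
  qed
  have "bracket E0 H $ 0 = 1"
    using H E0 by (simp add: bracket_def)
  then obtain c where c: "bracket E0 H = E0 + fps_const c * H"
    using comb[OF bracket_mem[OF E0(1) H(1)]] by (metis fps_const_1_eq_1 mult_1)
  define E where "E = E0 + fps_const c * H"
  show thesis
  proof
    show "E \<in> S" "H \<in> S" "E $ 0 = 1" using E0 H by (auto simp: E_def intro!: add scale)
    show "bracket E H = E" by (simp add: E_def bracket_linear c)
    show "\<exists>a b. X = fps_const a * E + fps_const b * H" if "X \<in> S" for X
    proof (intro exI)
      show "X = fps_const (X $ 0) * E + fps_const (X $ 1 - X $ 0 * E0 $ 1 - X $ 0 * c) * H"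
        by (subst comb[OF that])
          (simp add: E_def algebra_simps flip: fps_const_add fps_const_sub fps_const_mult)
    qed
  qed
qed

text \<open>The model is E = d/dx, H = x d/dx, F = x^2 d/dx. Elements are determined by their
  2-jets; \<open>H\<close> is defined so that the relation with \<open>F\<close> holds, and only the
  relation between E and H needs a correction of \<open>E0\<close>.\<close>

lemma projective_basis:
  assumes F0: "F0 \<in> S" "F0 $ 0 = 0" "F0 $ 1 = 0" "F0 \<noteq> 0"
  obtains E H F where "E \<in> S" "H \<in> S" "F \<in> S"
    "bracket E F = 2 * H" "bracket H F = F" "bracket E H = E"
    "\<And>X. X \<in> S \<Longrightarrow> \<exists>a b c. X = fps_const a * E + fps_const b * H + fps_const c * F"
proof -
  obtain E0 where E0: "E0 \<in> S" "E0 $ 0 = 1" using transitive by blast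
  have "F0 $ 2 \<noteq> 0" using order_le_2 F0 by blast
  define F where "F = fps_const (inverse (F0 $ 2)) * F0"
  have F: "F \<in> S" "F $ 0 = 0" "F $ 1 = 0" "F $ 2 = 1"
    using F0 \<open>F0 $ 2 \<noteq> 0\<close> by (auto simp: F_def scale)
  have F': "\<forall>k<2. F $ k = 0" using F by (auto simp: less_2_cases_iff)
  define H where "H = fps_const (1/2) * bracket E0 F"
  have E0F: "bracket E0 F = 2 * H"
    by (simp add: H_def numeral_fps_const flip: mult.assoc fps_const_mult)
  have H: "H \<in> S" "H $ 0 = 0" "H $ 1 = 1"
    using bracket_nth[of 0 E0 2 F 0] bracket_nth[of 0 E0 2 F 1] F F' E0
    by (auto simp: H_def scale bracket_mem)
  have zero: "X = 0" if "X \<in> S" "X $ 0 = 0" "X $ 1 = 0" "X $ 2 = 0" for X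
    using order_le_2 that by blast
  have comb: "\<exists>b c. X = fps_const (X $ 0) * E0 + fps_const b * H + fps_const c * F" if "X \<in> S" for X
  proof -
    define b where "b = X $ 1 - X $ 0 * E0 $ 1"
    define c where "c = X $ 2 - X $ 0 * E0 $ 2 - b * H $ 2"
    have "X - (fps_const (X $ 0) * E0 + fps_const b * H + fps_const c * F) = 0"
      by (rule zero) (use that E0 H F in \<open>auto simp: b_def c_def intro!: diff add scale\<close>)
    then show ?thesis by auto
  qed
  have HF: "bracket H F = F"
  proof -
    have H': "\<forall>k<1. H $ k = 0" using H by simp
    have "bracket H F - F = 0"
      by (rule zero) (use H F bracket_nth[OF H' F', of 0] bracket_nth[OF H' F', of 1]
          bracket_nth[OF H' F', of 2] in \<open>auto intro!: diff bracket_mem\<close>)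
    then show ?thesis by simp
  qed
  have "bracket E0 H $ 0 = 1"
    using H E0 by (simp add: bracket_def)
  then obtain c d where cd: "bracket E0 H = E0 + fps_const c * H + fps_const d * F"
    using comb[OF bracket_mem[OF E0(1) H(1)]] by (metis fps_const_1_eq_1 mult_1)
  \<comment> \<open>The left side is the bracket of \<open>E0\<close> and F, that is 2 H, while the
    right side is 2 H + c F; this forces c = 0.\<close>
  have "bracket E0 (bracket H F) = bracket (bracket E0 H) F + bracket H (bracket E0 F)"
    by (rule bracket_jacobi)
  then have "fps_const c * F = 0"
    unfolding HF cd E0F by (simp add: bracket_linear E0F HF numeral_fps_const)
  moreover have "F \<noteq> 0" using F by auto
  ultimately have c: "c = 0" by simp
  \<comment> \<open>As the bracket of F and H is - F, adding e F to \<open>E0\<close> turns the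
    bracket with H into \<open>E0\<close> + (d - e) F. This is the new field exactly when d - e = e.
    The bracket with F is unchanged.\<close>
  define e where "e = d / 2"
  define E where "E = E0 + fps_const e * F"
  have half: "fps_const d = fps_const e + fps_const e" by (simp add: e_def)
  show thesis
  proof
    show "E \<in> S" "H \<in> S" "F \<in> S" using E0 H F by (auto simp: E_def intro!: add scale)
    show "bracket E F = 2 * H" by (simp add: E_def bracket_linear E0F)
    show "bracket H F = F" by fact
    show "bracket E H = E"
      using bracket_flip[of F H] 
      by (simp add: E_def bracket_linear cd c HF half ring_distribs del: fps_const_add)
    show "\<exists>a b c. X = fps_const a * E + fps_const b * H + fps_const c * F" if X: "X \<in> S" for X
    proof -
      obtain b c where bc: "X = fps_const (X $ 0) * E0 + fps_const b * H + fps_const c * F"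
        using comb[OF X] by blast
      have "X = fps_const (X $ 0) * E + fps_const b * H + fps_const (c - X $ 0 * e) * F"
        by (subst bc) (simp add: E_def algebra_simps flip: fps_const_add fps_const_sub fps_const_mult)
      then show ?thesis by blast
    qed
  qed
qed

end


section \<open>Generic parameters avoiding finitely many zeros\<close>

lemma common_nonroot:
  fixes p :: "'k \<Rightarrow> real poly"
  assumes "finite K" "\<And>k. k \<in> K \<Longrightarrow> p k \<noteq> 0"
  obtains t where "\<And>k. k \<in> K \<Longrightarrow> poly (p k) t \<noteq> 0"
proof -
  have "finite (\<Union>k\<in>K. {x. poly (p k) x = 0})"
    using assms by (auto intro: poly_roots_finite)
  then obtain t where "t \<notin> (\<Union>k\<in>K. {x. poly (p k) x = 0})"
    using ex_new_if_finite infinite_UNIV_char_0 by blast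
  then show thesis by (intro that) auto
qed

text \<open>On the curve with coordinates t^(e j) each linear form becomes a polynomial in t.
  Distinct exponents keep it non-zero, so finitely many forms have a common parameter t at which
  none vanishes.\<close>

lemma common_nonzero_combination:
  fixes a :: "'k \<Rightarrow> 'j \<Rightarrow> real"
  assumes K: "finite K" and J: "finite J" and nz: "\<And>k. k \<in> K \<Longrightarrow> \<exists>j\<in>J. a k j \<noteq> 0"
  obtains s where "\<And>k. k \<in> K \<Longrightarrow> (\<Sum>j\<in>J. s j * a k j) \<noteq> 0"
proof -
  obtain e :: "'j \<Rightarrow> nat" where e: "inj_on e J" using finite_imp_inj_to_nat_seg[OF J] by blast
  define p where "p k = (\<Sum>j\<in>J. monom (a k j) (e j))" for k
  have "p k \<noteq> 0" if k: "k \<in> K" for k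
  proof -
    obtain j where j: "j \<in> J" "a k j \<noteq> 0" using nz k by blast
    have "coeff (p k) (e j) = (\<Sum>i\<in>J. if i = j then a k i else 0)"
      unfolding p_def coeff_sum by (intro sum.cong) (use e j in \<open>auto simp: inj_on_def\<close>)
    also have "\<dots> = a k j" using j J by simp
    finally show ?thesis using j by auto
  qed
  then obtain t where t: "\<And>k. k \<in> K \<Longrightarrow> poly (p k) t \<noteq> 0"
    using common_nonroot[OF K] by metis
  have "poly (p k) t = (\<Sum>j\<in>J. t ^ e j * a k j)" for k
    by (simp add: p_def poly_sum poly_monom mult.commute)
  then show thesis using t by (intro that[of "\<lambda>j. t ^ e j"]) auto
qed

section \<open>Lie algebras of product fields\<close>

text \<open>Elements are tuples of Taylor series \<open>X\<^sub>i\<close> of the components of a field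
  \<open>\<Sum>\<^sub>i X\<^sub>i(x\<^sub>i) \<partial>/\<partial>x\<^sub>i\<close>.\<close>

locale product_fields =
  fixes G :: "('n::finite \<Rightarrow> real fps) set"
  assumes zero: "(\<lambda>i. 0) \<in> G"
    and add: "X \<in> G \<Longrightarrow> Y \<in> G \<Longrightarrow> (\<lambda>i. X i + Y i) \<in> G"
    and scale: "X \<in> G \<Longrightarrow> (\<lambda>i. fps_const c * X i) \<in> G"
    and bracket_mem: "X \<in> G \<Longrightarrow> Y \<in> G \<Longrightarrow> (\<lambda>i. bracket (X i) (Y i)) \<in> G"
    and bounded_order: "\<exists>N. \<forall>X\<in>G. (\<forall>k<N. X i $ k = 0) \<longrightarrow> X i = 0"
    and transitive_or_zero: "(\<exists>X\<in>G. X i $ 0 \<noteq> 0) \<or> (\<forall>X\<in>G. X i = 0)"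
begin

text \<open>In a variable in which \<open>W\<^sub>i = 1\<close>, bracketing with \<open>W\<^sub>i\<close> is differentiation, so that all
  \<open>Y\<^sub>i\<close> have vanishing third derivative.\<close>

definition parabolic :: "('n \<Rightarrow> real fps) \<Rightarrow> 'n \<Rightarrow> bool" where
  "parabolic W i \<longleftrightarrow> W i $ 0 \<noteq> 0 \<and>
    (\<forall>Y\<in>G. bracket (W i) (bracket (W i) (bracket (W i) (Y i))) = 0)"

lemma diff: "X \<in> G \<Longrightarrow> Y \<in> G \<Longrightarrow> (\<lambda>i. X i - Y i) \<in> G"
  using add[of X "\<lambda>i. fps_const (-1) * Y i"] scale[of Y "-1"] by (simp flip: fps_const_neg)

lemma sum_mem:
  assumes "finite J" "\<And>j. j \<in> J \<Longrightarrow> b j \<in> G"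
  shows "(\<lambda>i. \<Sum>j\<in>J. b j i) \<in> G"
  using assms by (induction J rule: finite_induct) (auto intro: zero add)

lemma line_algebra_component:
  assumes "X \<in> G" "X i \<noteq> 0"
  shows "line_algebra ((\<lambda>X. X i) ` G)"
proof
  fix Y Z c assume "Y \<in> (\<lambda>X. X i) ` G" "Z \<in> (\<lambda>X. X i) ` G"
  then show "Y + Z \<in> (\<lambda>X. X i) ` G" "fps_const c * Y \<in> (\<lambda>X. X i) ` G"
    "bracket Y Z \<in> (\<lambda>X. X i) ` G"
    by (force dest: add, force dest: scale, force dest: bracket_mem)
next
  show "\<exists>N. \<forall>X\<in>(\<lambda>X. X i) ` G. (\<forall>k<N. X $ k = 0) \<longrightarrow> X = 0"
    using bounded_order[of i] by auto
  obtain Y where Y: "Y \<in> G" "Y i $ 0 \<noteq> 0" using transitive_or_zero assms by blast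
  have "fps_const (inverse (Y i $ 0)) * Y i \<in> (\<lambda>X. X i) ` G"
    using scale[OF Y(1)] by force
  then show "\<exists>E\<in>(\<lambda>X. X i) ` G. E $ 0 = 1"
    using Y by (intro bexI[of _ "fps_const (inverse (Y i $ 0)) * Y i"]) auto
qed

text \<open>Here every component at i is the multiple of \<open>W i\<close> with the same value at
  0, so already the first bracket vanishes.\<close>

lemma parabolic_if_line:
  assumes line: "\<And>X. X \<in> G \<Longrightarrow> X i $ 0 = 0 \<Longrightarrow> X i = 0" and W: "W \<in> G" "W i \<noteq> 0"
  shows "parabolic W i"
proof -
  have W0: "W i $ 0 \<noteq> 0" using line W by blast
  have "bracket (W i) (Y i) = 0" if Y: "Y \<in> G" for Y
  proof -
    define c where "c = Y i $ 0 / W i $ 0"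
    have "Y i - fps_const c * W i = 0"
      using line[OF diff[OF Y scale[OF W(1), of c]]] W0 by (simp add: c_def)
    then have "Y i = fps_const c * W i" by simp
    then show ?thesis by (simp add: bracket_linear)
  qed
  then show ?thesis using W0 by (simp add: parabolic_def)
qed

text \<open>The kinds of indices are told apart by the highest order of vanishing at 0 among
  non-zero components: 1 here, 2 for \<open>projective_index\<close>, and 0 for the other non-zero
  projections.\<close>

definition affine_index :: "'n \<Rightarrow> bool" where
  "affine_index i \<longleftrightarrow> (\<exists>X\<in>G. X i $ 0 = 0 \<and> X i \<noteq> 0) \<and>
    (\<forall>X\<in>G. X i $ 0 = 0 \<longrightarrow> X i $ 1 = 0 \<longrightarrow> X i = 0)"

definition projective_index :: "'n \<Rightarrow> bool" where
  "projective_index i \<longleftrightarrow> (\<exists>X\<in>G. X i $ 0 = 0 \<and> X i $ 1 = 0 \<and> X i \<noteq> 0)"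

lemma affine_index_basis:
  assumes "affine_index i"
  obtains E H where "E \<in> G" "H \<in> G" "E i $ 0 = 1" "bracket (E i) (H i) = E i"
    "\<And>X. X \<in> G \<Longrightarrow> \<exists>a b. X i = fps_const a * E i + fps_const b * H i"
proof -
  obtain X where X: "X \<in> G" "X i $ 0 = 0" "X i \<noteq> 0" using assms by (auto simp: affine_index_def)
  interpret line_algebra "(\<lambda>X. X i) ` G" by (rule line_algebra_component[OF X(1,3)])
  show thesis
  proof (rule affine_basis[of "X i"])
    fix E H assume "E \<in> (\<lambda>X. X i) ` G" "H \<in> (\<lambda>X. X i) ` G" "E $ 0 = 1" "bracket E H = E"
      and span: "\<And>X. X \<in> (\<lambda>X. X i) ` G \<Longrightarrow> \<exists>a b. X = fps_const a * E + fps_const b * H"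
    then obtain E' H' where "E' \<in> G" "H' \<in> G" "E = E' i" "H = H' i" by auto
    then show thesis using \<open>E $ 0 = 1\<close> \<open>bracket E H = E\<close> span by (intro that[of E' H']) auto
  qed (use X assms in \<open>auto simp: affine_index_def\<close>)
qed

lemma projective_index_basis:
  assumes "projective_index i"
  obtains E H F where "E \<in> G" "H \<in> G" "F \<in> G" "bracket (E i) (F i) = 2 * H i"
    "bracket (H i) (F i) = F i" "bracket (E i) (H i) = E i"
    "\<And>X. X \<in> G \<Longrightarrow> \<exists>a b c. X i = fps_const a * E i + fps_const b * H i + fps_const c * F i"
proof -
  obtain X where X: "X \<in> G" "X i $ 0 = 0" "X i $ 1 = 0" "X i \<noteq> 0"
    using assms by (auto simp: projective_index_def)
  interpret line_algebra "(\<lambda>X. X i) ` G" by (rule line_algebra_component[OF X(1,4)])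
  show thesis
  proof (rule projective_basis[of "X i"])
    fix E H F assume "E \<in> (\<lambda>X. X i) ` G" "H \<in> (\<lambda>X. X i) ` G" "F \<in> (\<lambda>X. X i) ` G"
      and br: "bracket E F = 2 * H" "bracket H F = F" "bracket E H = E"
      and span: "\<And>X. X \<in> (\<lambda>X. X i) ` G \<Longrightarrow>
        \<exists>a b c. X = fps_const a * E + fps_const b * H + fps_const c * F"
    then obtain E' H' F' where "E' \<in> G" "H' \<in> G" "F' \<in> G" "E = E' i" "H = H' i" "F = F' i"
      by auto
    then show thesis using br span by (intro that[of E' H' F']) auto
  qed (use X in auto)
qed

text \<open>The derived algebra of the projection to an affine index k is the line through
  \<open>E k k\<close>. Hence every bracket, also one formed for another index j, projects into this
  line, and so does every sum of brackets; only non-vanishing at 0 has to be arranged generically.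
  On the projection ad E kills E and sends H to E, so already its square is 0.\<close>

lemma parabolic_on_affine:
  obtains V where "V \<in> G" "\<And>i. affine_index i \<Longrightarrow> parabolic V i"
proof -
  let ?A = "{i. affine_index i}"
  have "\<forall>i. \<exists>E H. affine_index i \<longrightarrow> E \<in> G \<and> H \<in> G \<and> E i $ 0 = 1 \<and> bracket (E i) (H i) = E i \<and>
    (\<forall>X\<in>G. \<exists>a b. X i = fps_const a * E i + fps_const b * H i)"
    using affine_index_basis by metis
  then obtain E H where EH: "\<And>i. affine_index i \<Longrightarrow> E i \<in> G \<and> H i \<in> G \<and> E i i $ 0 = 1 \<and>
      bracket (E i i) (H i i) = E i i"
    and span: "\<And>i X. affine_index i \<Longrightarrow> X \<in> G \<Longrightarrow>
      \<exists>a b. X i = fps_const a * E i i + fps_const b * H i i"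
    by metis
  define D where "D j = (\<lambda>k. bracket (E j k) (H j k))" for j
  have D: "D j \<in> G" if "affine_index j" for j
    using EH[OF that] bracket_mem by (auto simp: D_def)
  obtain s where s: "\<And>k. k \<in> ?A \<Longrightarrow> (\<Sum>j\<in>?A. s j * D j k $ 0) \<noteq> 0"
  proof (rule common_nonzero_combination[of ?A ?A "\<lambda>k j. D j k $ 0"])
    show "\<exists>j\<in>?A. D j k $ 0 \<noteq> 0" if "k \<in> ?A" for k
      using that EH by (intro bexI[of _ k]) (auto simp: D_def)
  qed auto
  define V where "V = (\<lambda>k. \<Sum>j\<in>?A. fps_const (s j) * D j k)"
  show thesis
  proof
    show V: "V \<in> G" unfolding V_def by (intro sum_mem scale D) auto
    fix k assume k: "affine_index k"
    have V0: "V k $ 0 \<noteq> 0" using s[of k] k by (simp add: V_def fps_sum_nth)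
    have "\<exists>c. D j k = fps_const c * E k k" if j: "affine_index j" for j
    proof -
      obtain a b a' b' where "E j k = fps_const a * E k k + fps_const b * H k k"
        "H j k = fps_const a' * E k k + fps_const b' * H k k"
        using span[OF k] EH[OF j] by meson
      then have "D j k = fps_const (a * b' - b * a') * E k k"
        using EH[OF k] bracket_flip[of "H k k" "E k k"]
        by (simp add: D_def bracket_linear algebra_simps flip: fps_const_sub fps_const_mult)
      then show ?thesis by blast
    qed
    then obtain c where c: "\<And>j. affine_index j \<Longrightarrow> D j k = fps_const (c j) * E k k" by metis
    have "V k = (\<Sum>j\<in>?A. fps_const (s j) * (fps_const (c j) * E k k))"
      unfolding V_def by (intro sum.cong) (auto simp: c)
    also have "\<dots> = fps_const (\<Sum>j\<in>?A. s j * c j) * E k k"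
      by (rule fps_ext) (simp add: fps_sum_nth sum_distrib_right mult.assoc)
    finally obtain d where d: "V k = fps_const d * E k k" by blast
    have "bracket (E k k) (bracket (E k k) (Y k)) = 0" if Y: "Y \<in> G" for Y
    proof -
      obtain a b where "Y k = fps_const a * E k k + fps_const b * H k k" using span[OF k Y] by blast
      then show ?thesis using EH[OF k] by (simp add: bracket_linear)
    qed
    then show "parabolic V k" using V0 by (simp add: parabolic_def d bracket_linear)
  qed
qed

text \<open>The image of an ideal in the simple algebra spanned by \<open>1, x, x\<^sup>2\<close> is zero or everything.\<close>

lemma projective_ideal_basis:
  assumes i: "projective_index i" and X: "X \<in> G" "X i \<noteq> 0" "\<forall>k\<in>I. X k = 0"
  obtains E H F where "E \<in> G" "H \<in> G" "F \<in> G"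
    "\<forall>k\<in>I. E k = 0 \<and> H k = 0 \<and> F k = 0"
    "bracket (E i) (F i) = 2 * H i" "bracket (H i) (F i) = F i" "bracket (E i) (H i) = E i"
    "\<And>X. X \<in> G \<Longrightarrow> \<exists>a b c. X i = fps_const a * E i + fps_const b * H i + fps_const c * F i"
proof -
  obtain E H F where EHF: "E \<in> G" "H \<in> G" "F \<in> G" and br: "bracket (E i) (F i) = 2 * H i"
    "bracket (H i) (F i) = F i" "bracket (E i) (H i) = E i"
    and span: "\<And>X. X \<in> G \<Longrightarrow> \<exists>a b c. X i = fps_const a * E i + fps_const b * H i + fps_const c * F i"
    using projective_index_basis[OF i] by metis
  have br': "bracket (F i) (E i) = fps_const (- 2) * H i" "bracket (F i) (H i) = - F i"
    using br bracket_flip[of "F i" "E i"] bracket_flip[of "F i" "H i"]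
    by (simp_all add: numeral_fps_const flip: fps_const_neg)
  obtain a b c where abc: "X i = fps_const a * E i + fps_const b * H i + fps_const c * F i"
    using span[OF X(1)] by blast
  \<comment> \<open>Fields vanishing on \<open>I\<close> form an ideal, so brackets with F stay in
    it. At i, ad F sends E to - 2 H, H to - F and F to 0. Depending on the first non-zero
    coefficient among a, b, c it is applied twice, once or not at all, until only a non-zero
    multiple of F is left.\<close>
  have "\<exists>Y d. Y \<in> G \<and> (\<forall>k\<in>I. Y k = 0) \<and> d \<noteq> 0 \<and> Y i = fps_const d * F i"
  proof (cases "a = 0")
    case False
    let ?Y = "\<lambda>k. bracket (F k) (bracket (F k) (X k))"
    have "?Y i = fps_const (2 * a) * F i"
      by (rule fps_ext) (simp add: abc bracket_linear br')
    moreover have "?Y \<in> G" "\<forall>k\<in>I. ?Y k = 0"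
      using EHF X bracket_mem[OF EHF(3) bracket_mem[OF EHF(3) X(1)]] by auto
    ultimately show ?thesis using False by (intro exI[of _ ?Y] exI[of _ "2 * a"]) auto
  next
    case a: True
    show ?thesis
    proof (cases "b = 0")
      case False
      let ?Y = "\<lambda>k. bracket (F k) (X k)"
      have "?Y i = fps_const (- b) * F i"
        by (simp add: abc a bracket_linear br' flip: fps_const_neg)
      moreover have "?Y \<in> G" "\<forall>k\<in>I. ?Y k = 0" using EHF X bracket_mem[OF EHF(3) X(1)] by auto
      ultimately show ?thesis using False by (intro exI[of _ ?Y] exI[of _ "- b"]) auto
    next
      case True
      then show ?thesis using a abc X by (intro exI[of _ X] exI[of _ c]) auto
    qed
  qed
  then obtain Y d where Y: "Y \<in> G" "\<forall>k\<in>I. Y k = 0" "d \<noteq> 0" "Y i = fps_const d * F i" by blast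
  \<comment> \<open>The other two generators are rebuilt from \<open>F'\<close> by brackets, which
    keeps them in the ideal. By the relations at i they have the components of \<open>H\<close> and
    \<open>E\<close> there.\<close>
  define F' where "F' = (\<lambda>k. fps_const (inverse d) * Y k)"
  define H' where "H' = (\<lambda>k. fps_const (1/2) * bracket (E k) (F' k))"
  define E' where "E' = (\<lambda>k. bracket (E k) (H' k))"
  have F'i: "F' i = F i" using Y by (simp add: F'_def flip: mult.assoc fps_const_mult)
  have H'i: "H' i = H i"
    by (simp add: H'_def F'i br numeral_fps_const flip: mult.assoc fps_const_mult)
  have E'i: "E' i = E i" by (simp add: E'_def H'i br)
  show thesis
  proof (rule that[of E' H' F'])
    show "F' \<in> G" using Y by (simp add: F'_def scale)
    then show "H' \<in> G" using EHF by (auto simp: H'_def intro!: scale bracket_mem)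
    then show "E' \<in> G" using EHF by (auto simp: E'_def intro!: scale bracket_mem)
    show "\<forall>k\<in>I. E' k = 0 \<and> H' k = 0 \<and> F' k = 0" using Y by (auto simp: E'_def H'_def F'_def)
  qed (use br span in \<open>auto simp: E'i H'i F'i\<close>)
qed

text \<open>
  Choose \<open>J\<close> minimal such that fields vanishing at all indices of \<open>J\<close> vanish at all projective
  indices. By minimality, each component in \<open>J\<close> can be prescribed without affecting the other ones.
  Parabolicity at \<open>J\<close> extends to all projective indices, as triple brackets then vanish on \<open>J\<close>.
\<close>

lemma parabolic_on_projective:
  obtains V where "V \<in> G" "\<And>i. projective_index i \<Longrightarrow> parabolic V i"
proof -
  define T where "T = {i. projective_index i}"
  define P where "P J \<longleftrightarrow> J \<subseteq> T \<and> (\<forall>X\<in>G. (\<forall>j\<in>J. X j = 0) \<longrightarrow> (\<forall>i\<in>T. X i = 0))" for J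
  have "P T" by (simp add: P_def)
  then obtain J where J: "P J" and least: "\<And>J'. P J' \<Longrightarrow> card J \<le> card J'"
    using ex_has_least_nat[of P T card] by blast
  have "\<exists>E H F. j \<in> J \<longrightarrow> E \<in> G \<and> H \<in> G \<and> F \<in> G \<and>
    (\<forall>k\<in>J - {j}. E k = 0 \<and> H k = 0 \<and> F k = 0) \<and>
    bracket (E j) (F j) = 2 * H j \<and> bracket (H j) (F j) = F j \<and> bracket (E j) (H j) = E j \<and>
    (\<forall>X\<in>G. \<exists>a b c. X j = fps_const a * E j + fps_const b * H j + fps_const c * F j)" for j
  proof (cases "j \<in> J")
    case True
    have "card (J - {j}) < card J" using True by (intro psubset_card_mono) auto
    then have "\<not> P (J - {j})" using least by (metis leD)
    then obtain X where X: "X \<in> G" "\<forall>k\<in>J - {j}. X k = 0" "\<not> (\<forall>i\<in>T. X i = 0)"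
      using J by (auto simp: P_def)
    \<comment> \<open>Otherwise X would vanish on all of \<open>J\<close> and hence on
      \<open>T\<close>.\<close>
    then have Xj: "X j \<noteq> 0" using J by (auto simp: P_def)
    have "projective_index j" using True J by (auto simp: P_def T_def)
    then show ?thesis by (rule projective_ideal_basis[OF _ X(1) Xj X(2)]) blast
  qed auto
  then obtain E H F where G: "\<And>j. j \<in> J \<Longrightarrow> E j \<in> G \<and> H j \<in> G \<and> F j \<in> G"
    and off: "\<And>j k. j \<in> J \<Longrightarrow> k \<in> J - {j} \<Longrightarrow> E j k = 0 \<and> H j k = 0 \<and> F j k = 0"
    and br: "\<And>j. j \<in> J \<Longrightarrow> bracket (E j j) (F j j) = 2 * H j j \<and> bracket (H j j) (F j j) = F j j \<and>
      bracket (E j j) (H j j) = E j j"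
    and span: "\<And>j X. j \<in> J \<Longrightarrow> X \<in> G \<Longrightarrow>
      \<exists>a b c. X j = fps_const a * E j j + fps_const b * H j j + fps_const c * F j j"
    by metis
  \<comment> \<open>The value of \<open>p (k, j)\<close> at t will be the value at 0 of the
    component k of E + 2 t H + t^2 F. This curve lies on the cone of nilpotent elements, so a
    generic t may be chosen without leaving it. The polynomial is zero only if E, H and F all vanish
    at 0 in component k.\<close>
  define p where "p = (\<lambda>(k, j). [:E j k $ 0, 2 * H j k $ 0, F j k $ 0:])"
  \<comment> \<open>If all generators vanished at 0 in component k, any X could be matched on
    \<open>J\<close> by a combination of them. The difference vanishes on \<open>J\<close>, hence at
    k, so X would vanish at 0 there as well, contrary to transitivity.\<close>
  have ex_p: "\<exists>j\<in>J. p (k, j) \<noteq> 0" if k: "k \<in> T" for k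
  proof (rule ccontr)
    assume "\<not> ?thesis"
    then have z: "E j k $ 0 = 0 \<and> H j k $ 0 = 0 \<and> F j k $ 0 = 0" if "j \<in> J" for j
      using that by (auto simp: p_def)
    obtain X where X: "X \<in> G" "X k $ 0 \<noteq> 0"
      using k transitive_or_zero[of k] by (auto simp: T_def projective_index_def)
    obtain a b c where abc: "\<And>j. j \<in> J \<Longrightarrow>
      X j = fps_const (a j) * E j j + fps_const (b j) * H j j + fps_const (c j) * F j j"
      using span[OF _ X(1)] by metis
    define Y where "Y j = (\<lambda>i. fps_const (a j) * E j i + fps_const (b j) * H j i + fps_const (c j) * F j i)" for j
    define Z where "Z = (\<lambda>i. X i - (\<Sum>j\<in>J. Y j i))"
    have "Z \<in> G" unfolding Z_def Y_def using G X by (intro diff sum_mem add scale) auto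
    moreover have "Z i = 0" if "i \<in> J" for i
    proof -
      have "(\<Sum>j\<in>J. Y j i) = (\<Sum>j\<in>J. if j = i then X i else 0)"
        using that off abc by (intro sum.cong) (auto simp: Y_def)
      then show ?thesis using that by (simp add: Z_def)
    qed
    ultimately have "Z k = 0" using J k by (auto simp: P_def)
    then have "X k $ 0 = (\<Sum>j\<in>J. Y j k) $ 0" by (simp add: Z_def)
    also have "\<dots> = 0" using z by (simp add: fps_sum_nth Y_def)
    finally show False using X by simp
  qed
  obtain t where t: "\<And>kj. kj \<in> {kj. p kj \<noteq> 0} \<Longrightarrow> poly (p kj) t \<noteq> 0"
    by (rule common_nonroot[of "{kj. p kj \<noteq> 0}" p]) (simp, simp, blast)
  text \<open>In the coordinate \<open>x\<close> of a realization by \<open>1, x, x\<^sup>2\<close> this is \<open>(1 + t x)\<^sup>2\<close>.\<close>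
  define z where "z j = (\<lambda>i. E j i + fps_const (2 * t) * H j i + fps_const (t * t) * F j i)" for j
  have zG: "z j \<in> G" if "j \<in> J" for j
    unfolding z_def using G[OF that] by (intro add scale) auto
  have z0: "z j k $ 0 = poly (p (k, j)) t" for j k
    by (simp add: z_def p_def algebra_simps)
  obtain s where s: "\<And>k. k \<in> T \<Longrightarrow> (\<Sum>j\<in>J. s j * z j k $ 0) \<noteq> 0"
  proof (rule common_nonzero_combination[of T J "\<lambda>k j. z j k $ 0"])
    show "\<exists>j\<in>J. z j k $ 0 \<noteq> 0" if "k \<in> T" for k
      using ex_p[OF that] t by (auto simp: z0)
  qed auto
  define V where "V = (\<lambda>k. \<Sum>j\<in>J. fps_const (s j) * z j k)"
  have VG: "V \<in> G" unfolding V_def by (intro sum_mem scale zG) auto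
  \<comment> \<open>In the model (1 + t x)^2 d/dx has a double zero on the projective line, so it is
    a nilpotent element of sl_2 and the cube of its ad is 0. This is verified on E, H, F using only
    the relations. At j only the summand \<open>z j\<close> of \<open>V\<close> is left, by the
    decoupling.\<close>
  have nil: "bracket (V j) (bracket (V j) (bracket (V j) (Y j))) = 0" if j: "j \<in> J" and Y: "Y \<in> G" for j Y
  proof -
    have "V j = (\<Sum>i\<in>J. if i = j then fps_const (s j) * z j j else 0)"
      unfolding V_def using off j by (intro sum.cong) (auto simp: z_def)
    then have Vj: "V j = fps_const (s j) * z j j" using j by simp
    obtain a b c where Yj: "Y j = fps_const a * E j j + fps_const b * H j j + fps_const c * F j j"
      using span[OF j Y] by blast
    have zE: "bracket (z j j) (E j j) = - (fps_const (2 * t) * E j j + fps_const (2 * t * t) * H j j)"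
      and zH: "bracket (z j j) (H j j) = E j j - fps_const (t * t) * F j j"
      and zF: "bracket (z j j) (F j j) = 2 * H j j + fps_const (2 * t) * F j j"
      using br[OF j] bracket_flip[of "H j j" "E j j"] bracket_flip[of "F j j" "E j j"]
        bracket_flip[of "F j j" "H j j"]
      by (simp_all only: z_def bracket_linear) (auto intro!: fps_ext simp: algebra_simps)
    have two: "2 * H j j = fps_const 2 * H j j" by (simp add: numeral_fps_const)
    have "bracket (z j j) (bracket (z j j) (bracket (z j j) (Y j))) = 0"
      unfolding Yj
      by (simp only: bracket_linear zE zH zF two, rule fps_ext, simp only: fps_add_nth fps_sub_nth
          fps_neg_nth fps_mult_left_const_nth fps_zero_nth, simp add: algebra_simps)
    then show ?thesis by (simp add: Vj bracket_linear)
  qed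
  show thesis
  proof (rule that[OF VG])
    fix k assume "projective_index k"
    then have k: "k \<in> T" by (simp add: T_def)
    have "V k $ 0 \<noteq> 0" using s[OF k] by (simp add: V_def fps_sum_nth)
    moreover have "bracket (V k) (bracket (V k) (bracket (V k) (Y k))) = 0" if Y: "Y \<in> G" for Y
    proof -
      have "(\<lambda>k. bracket (V k) (bracket (V k) (bracket (V k) (Y k)))) \<in> G"
        using VG Y by (intro bracket_mem)
      then show ?thesis using J k nil[OF _ Y] by (fastforce simp: P_def)
    qed
    ultimately show "parabolic V k" by (simp add: parabolic_def)
  qed
qed

lemma parabolic_pair:
  obtains U V where "U \<in> G" "V \<in> G"
    "\<And>W i. W \<in> G \<Longrightarrow> W i \<noteq> 0 \<Longrightarrow> parabolic W i \<or> parabolic U i \<or> parabolic V i"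
proof -
  obtain U where U: "U \<in> G" "\<And>i. affine_index i \<Longrightarrow> parabolic U i" using parabolic_on_affine by blast
  obtain V where V: "V \<in> G" "\<And>i. projective_index i \<Longrightarrow> parabolic V i" using parabolic_on_projective by blast
  show thesis
  proof (rule that[OF U(1) V(1)])
    fix W i assume "W \<in> G" "W i \<noteq> 0"
    then show "parabolic W i \<or> parabolic U i \<or> parabolic V i"
      using U(2) V(2) parabolic_if_line[of i W]
      unfolding affine_index_def projective_index_def by meson
  qed
qed

end

section \<open>Straightening a parabolic field\<close>

text \<open>The constant coefficient is the value at 0, and differentiation brings each later
  coefficient closer to this position.\<close>

lemma has_fps_expansion_zero_imp_zero:
  fixes F :: "real fps"
  assumes "(\<lambda>_. 0) has_fps_expansion F"
  shows "F = 0"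
proof (rule fps_ext)
  fix n
  show "F $ n = 0 $ n" using assms
  proof (induction n arbitrary: F)
    case 0
    then have "eval_fps F 0 = 0"
      unfolding has_fps_expansion_def using eventually_nhds_x_imp_x by blast
    then show ?case by (simp add: eval_fps_at_0)
  next
    case (Suc n)
    have "(\<lambda>_. 0) has_fps_expansion fps_deriv F" using has_fps_expansion_deriv[OF Suc.prems] by simp
    from Suc.IH[OF this] show ?case by simp
  qed
qed

lemma has_fps_expansion_unique_real:
  fixes F G :: "real fps"
  assumes "u has_fps_expansion F" "u has_fps_expansion G"
  shows "F = G"
  using has_fps_expansion_zero_imp_zero[of "F - G"] has_fps_expansion_diff[OF assms] by simp

lemma fps_conv_radius_integral0_pos:
  fixes F :: "real fps"
  assumes "fps_conv_radius F > 0"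
  shows "fps_conv_radius (fps_integral0 F) > 0"
proof -
  obtain x :: real where x: "x > 0" "ereal x < fps_conv_radius F"
    using ereal_dense2[OF assms[unfolded zero_ereal_def]] by auto
  then have "summable (\<lambda>n. norm (F $ n * x ^ n))" by (intro norm_summable_fps) simp
  then have sm: "summable (\<lambda>n. x * norm (F $ n * x ^ n))" by (rule summable_mult)
  have "summable (\<lambda>n. fps_integral0 F $ Suc n * x ^ Suc n)"
  proof (rule summable_comparison_test'[OF sm, of 0])
    fix n
    have "\<bar>F $ n\<bar> / (1 + real n) \<le> \<bar>F $ n\<bar>" by (simp add: divide_le_eq mult_left_mono algebra_simps)
    then have "\<bar>F $ n\<bar> / (1 + real n) * (x * x ^ n) \<le> \<bar>F $ n\<bar> * (x * x ^ n)"
      using x by (intro mult_right_mono) auto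
    then show "norm (fps_integral0 F $ Suc n * x ^ Suc n) \<le> x * norm (F $ n * x ^ n)"
      using x by (simp add: fps_integral_def abs_mult divide_inverse mult_ac)
  qed
  then have "summable (\<lambda>n. fps_integral0 F $ n * x ^ n)" by (subst (asm) summable_Suc_iff)
  then have "ereal (norm x) \<le> fps_conv_radius (fps_integral0 F)"
    unfolding fps_conv_radius_def by (rule conv_radius_geI)
  moreover have "0 < ereal (norm x)" using x by simp
  ultimately show ?thesis by (rule less_le_trans[rotated])
qed

text \<open>In the variable y with dy = dx / E, the field Z has the coefficient Z / E, and the
  bracket with E is d/dy. The second inverse converts d/dy back into d/dx.\<close>

lemma deriv_quotient_bracket:
  fixes E Z :: "real fps"
  assumes "E $ 0 \<noteq> 0"
  shows "fps_deriv (Z * inverse E) = bracket E Z * inverse E * inverse E"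
proof -
  have E: "E * inverse E = 1" using assms inverse_mult_eq_1[of E] by (simp add: mult.commute)
  have "bracket E Z * inverse E * inverse E
    = (E * inverse E) * fps_deriv Z * inverse E - Z * fps_deriv E * (inverse E)\<^sup>2"
    by (simp add: bracket_def algebra_simps power2_eq_square)
  also have "\<dots> = fps_deriv (Z * inverse E)"
    by (simp add: E fps_inverse_deriv[OF assms] algebra_simps)
  finally show ?thesis by simp
qed

text \<open>The series \<gamma> is the variable in which E becomes 1. The triple bracket says that
  the third derivative of Y / E with respect to \<gamma> vanishes, and integrating three times gives
  the quadratic; the halves of c come from the integral of \<gamma> d\<gamma>.\<close>

lemma quotient_quadratic:
  fixes E Y :: "real fps"
  assumes E: "E $ 0 \<noteq> 0" and nil: "bracket E (bracket E (bracket E Y)) = 0"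
  defines "\<gamma> \<equiv> fps_integral0 (inverse E)"
  shows "\<exists>a b c. Y * inverse E = fps_const a + fps_const b * \<gamma> + fps_const c * (\<gamma> * \<gamma>)"
proof -
  have d\<gamma>: "fps_deriv \<gamma> = inverse E" by (simp add: \<gamma>_def fps_deriv_fps_integral)
  note dq = deriv_quotient_bracket[OF E]
  define Z1 where "Z1 = bracket E Y"
  define Z2 where "Z2 = bracket E Z1"
  have "fps_deriv (Z2 * inverse E) = fps_deriv 0" unfolding dq using nil by (simp add: Z1_def Z2_def)
  then obtain c where c: "Z2 * inverse E = fps_const c" unfolding fps_deriv_eq_iff_ex by auto
  have "fps_deriv (Z1 * inverse E) = fps_deriv (fps_const c * \<gamma>)"
    unfolding dq by (simp add: d\<gamma> c flip: Z2_def)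
  then obtain b where b: "Z1 * inverse E = fps_const b + fps_const c * \<gamma>"
    unfolding fps_deriv_eq_iff_ex by auto
  have "fps_deriv (Y * inverse E) = (fps_const b + fps_const c * \<gamma>) * inverse E"
    unfolding dq by (simp add: b flip: Z1_def)
  also have "fps_const c = fps_const (c / 2) + fps_const (c / 2)" by simp
  also have "(fps_const b + (fps_const (c / 2) + fps_const (c / 2)) * \<gamma>) * inverse E
    = fps_deriv (fps_const b * \<gamma> + fps_const (c / 2) * (\<gamma> * \<gamma>))"
    by (simp add: d\<gamma> algebra_simps del: fps_const_add)
  finally obtain a where "Y * inverse E = fps_const a + (fps_const b * \<gamma> + fps_const (c / 2) * (\<gamma> * \<gamma>))"
    unfolding fps_deriv_eq_iff_ex by blast
  then show ?thesis by (auto simp: add.assoc)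
qed

text \<open>With g = \<gamma> the new component is g' X = X / E, so expanding F / E in powers of
  \<gamma> already describes the transformed field.\<close>

lemma change_of_variable_integral:
  fixes E :: "real fps"
  assumes E: "E $ 0 \<noteq> 0" "fps_conv_radius E > 0"
  shows "change_of_variable (eval_fps (fps_integral0 (inverse E)))"
    and "\<And>X F a b c. X has_fps_expansion F \<Longrightarrow>
      F * inverse E = fps_const a + fps_const b * fps_integral0 (inverse E) +
        fps_const c * (fps_integral0 (inverse E) * fps_integral0 (inverse E)) \<Longrightarrow>
      becomes (eval_fps (fps_integral0 (inverse E))) X (poly [:a, b, c:])"
proof -
  define \<gamma> where "\<gamma> = fps_integral0 (inverse E)"
  have rad: "fps_conv_radius \<gamma> > 0"
    unfolding \<gamma>_def using E by (intro fps_conv_radius_integral0_pos fps_conv_radius_inverse_pos)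
  have d\<gamma>: "fps_deriv \<gamma> = inverse E" by (simp add: \<gamma>_def fps_deriv_fps_integral)
  have g: "eval_fps \<gamma> has_fps_expansion \<gamma>" using rad by (rule eval_fps_has_fps_expansion)
  have dg: "deriv (eval_fps \<gamma>) has_fps_expansion inverse E"
    using has_fps_expansion_deriv[OF g] by (simp add: d\<gamma>)
  obtain x :: real where x: "x > 0" "ereal x < fps_conv_radius \<gamma>"
    using ereal_dense2[OF rad[unfolded zero_ereal_def]] by auto
  have "\<forall>s\<in>ball 0 x. (\<lambda>k. \<gamma> $ k * (s - 0) ^ k) sums eval_fps \<gamma> s"
  proof
    fix s :: real assume "s \<in> ball 0 x"
    then have "ereal (norm s) < fps_conv_radius \<gamma>"
      using x(2) by (auto intro: le_less_trans[of _ "ereal x"])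
    then show "(\<lambda>k. \<gamma> $ k * (s - 0) ^ k) sums eval_fps \<gamma> s" using sums_eval_fps[of s \<gamma>] by simp
  qed
  then have "real_analytic1_at (eval_fps \<gamma>) 0" unfolding real_analytic1_at_def using x(1) by blast
  moreover have "\<forall>\<^sub>F s in nhds 0. eval_fps (inverse E) s = deriv (eval_fps \<gamma>) s"
    using dg by (simp add: has_fps_expansion_def)
  from eventually_nhds_x_imp_x[OF this] have "deriv (eval_fps \<gamma>) 0 = inverse E $ 0"
    by (simp add: eval_fps_at_0)
  then have "deriv (eval_fps \<gamma>) 0 \<noteq> 0" using E by simp
  ultimately show "change_of_variable (eval_fps (fps_integral0 (inverse E)))"
    unfolding change_of_variable_def \<gamma>_def[symmetric] by (simp add: eval_fps_at_0) (simp add: \<gamma>_def)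
  fix X F a b c assume X: "X has_fps_expansion F"
    and eq: "F * inverse E = fps_const a + fps_const b * fps_integral0 (inverse E) +
        fps_const c * (fps_integral0 (inverse E) * fps_integral0 (inverse E))"
  have "(\<lambda>s. a + b * eval_fps \<gamma> s + c * (eval_fps \<gamma> s * eval_fps \<gamma> s)) has_fps_expansion
    fps_const a + fps_const b * \<gamma> + fps_const c * (\<gamma> * \<gamma>)"
    by (intro has_fps_expansion_add has_fps_expansion_cmult_left has_fps_expansion_mult g has_fps_expansion_const)
  moreover have "(\<lambda>s. X s * deriv (eval_fps \<gamma>) s) has_fps_expansion F * inverse E"
    by (rule has_fps_expansion_mult[OF X dg])
  ultimately have "\<forall>\<^sub>F s in nhds 0. eval_fps (F * inverse E) s = X s * deriv (eval_fps \<gamma>) s"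
    "\<forall>\<^sub>F s in nhds 0. eval_fps (F * inverse E) s = a + b * eval_fps \<gamma> s + c * (eval_fps \<gamma> s * eval_fps \<gamma> s)"
    by (simp_all add: has_fps_expansion_def eq \<gamma>_def[symmetric])
  then have "\<forall>\<^sub>F s in nhds 0. poly [:a, b, c:] (eval_fps \<gamma> s) = deriv (eval_fps \<gamma>) s * X s"
    by eventually_elim (simp add: algebra_simps)
  then show "becomes (eval_fps (fps_integral0 (inverse E))) X (poly [:a, b, c:])"
    by (simp add: becomes_def \<gamma>_def)
qed

text \<open>Let N be a bound for the first m series. If it fails for m + 1, one offending
  combination \<open>c\<close> with a non-zero coefficient at n is enough: modulo it, every other
  combination is one of the first m series, so those vanishing to order N are multiples of it and
  are detected at n.\<close>

lemma span_bounded_order: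
  fixes b :: "nat \<Rightarrow> real fps"
  shows "\<exists>N. \<forall>c. (\<forall>k<N. (\<Sum>j<m. fps_const (c j) * b j) $ k = 0) \<longrightarrow> (\<Sum>j<m. fps_const (c j) * b j) = 0"
proof (induction m)
  case (Suc m)
  define C where "C c = (\<Sum>j<m. fps_const (c j) * b j)" for c
  obtain N where N: "\<And>c. \<forall>k<N. C c $ k = 0 \<Longrightarrow> C c = 0" using Suc unfolding C_def by blast
  have S: "(\<Sum>j<Suc m. fps_const (c j) * b j) = C c + fps_const (c m) * b m" for c
    by (simp add: C_def)
  show ?case
  proof (cases "\<exists>c. (\<forall>k<N. (C c + fps_const (c m) * b m) $ k = 0) \<and> C c + fps_const (c m) * b m \<noteq> 0")
    case False
    then show ?thesis unfolding S by blast
  next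
    case True
    then obtain c where c: "\<forall>k<N. (C c + fps_const (c m) * b m) $ k = 0" "C c + fps_const (c m) * b m \<noteq> 0"
      by blast
    then obtain n where n: "(C c + fps_const (c m) * b m) $ n \<noteq> 0" by (metis fps_nonzero_nth)
    have cm: "c m \<noteq> 0" using c N[of c] by force
    show ?thesis unfolding S
    proof (intro exI[of _ "max N (Suc n)"] allI impI)
      fix c' assume c': "\<forall>k<max N (Suc n). (C c' + fps_const (c' m) * b m) $ k = 0"
      \<comment> \<open>This multiple of the offending combination cancels the last series;
        \<open>c m\<close> is non-zero since otherwise N would already apply to
        \<open>c\<close>.\<close>
      define t where "t = c' m / c m"
      have lin: "C (\<lambda>j. c' j - t * c j) = C c' - fps_const t * C c"
        by (rule fps_ext) (simp add: C_def fps_sum_nth sum_subtractf sum_distrib_left algebra_simps)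
      also have "\<dots> = (C c' + fps_const (c' m) * b m) - fps_const t * (C c + fps_const (c m) * b m)"
        using cm by (intro fps_ext) (simp add: t_def algebra_simps)
      finally have e: "C (\<lambda>j. c' j - t * c j) =
        (C c' + fps_const (c' m) * b m) - fps_const t * (C c + fps_const (c m) * b m)" .
      have "C (\<lambda>j. c' j - t * c j) = 0"
        by (rule N) (use c c' in \<open>auto simp: e\<close>)
      then have eq: "C c' + fps_const (c' m) * b m = fps_const t * (C c + fps_const (c m) * b m)"
        using e by simp
      have "(C c' + fps_const (c' m) * b m) $ n = 0" using c' by simp
      then have "t = 0" using n unfolding eq by simp
      then show "C c' + fps_const (c' m) * b m = 0" using eq by simp
    qed
  qed
qed simp

unbundle no fps_syntax and vec_syntax

section \<open>Power series in several variables\<close>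

definition monomial :: "('n::finite \<Rightarrow> nat) \<Rightarrow> real ^ 'n \<Rightarrow> real" where
  "monomial \<alpha> x = (\<Prod>i\<in>UNIV. (x $ i) ^ \<alpha> i)"

definition total_degree :: "('n::finite \<Rightarrow> nat) \<Rightarrow> nat" where
  "total_degree \<alpha> = (\<Sum>i\<in>UNIV. \<alpha> i)"

text \<open>The i-th partial derivative of a monomial. The truncated subtraction is harmless, as for
  \<open>\<alpha> i = 0\<close> the numerical factor is 0.\<close>

definition dmonomial :: "'n \<Rightarrow> ('n::finite \<Rightarrow> nat) \<Rightarrow> real ^ 'n \<Rightarrow> real" where
  "dmonomial i \<alpha> x = real (\<alpha> i) * (x $ i) ^ (\<alpha> i - 1) * (\<Prod>j\<in>UNIV - {i}. (x $ j) ^ \<alpha> j)"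

definition diff_coeffs :: "'n \<Rightarrow> (('n \<Rightarrow> nat) \<Rightarrow> real) \<Rightarrow> ('n \<Rightarrow> nat) \<Rightarrow> real" where
  "diff_coeffs i a \<alpha> = real (\<alpha> i + 1) * a (\<alpha>(i := \<alpha> i + 1))"

text \<open>Mixed partial derivatives commute already on coefficients; the symmetry of second
  derivatives will be read off from this.\<close>

lemma diff_coeffs_commute: "diff_coeffs i (diff_coeffs j a) = diff_coeffs j (diff_coeffs i a)"
  by (cases "i = j") (auto simp: diff_coeffs_def fun_eq_iff fun_upd_twist)

lemma has_derivative_monomial:
  "(monomial \<alpha> has_derivative (\<lambda>h. \<Sum>i\<in>UNIV. h $ i * dmonomial i \<alpha> x)) (at x)"
proof -
  have "((\<lambda>x. \<Prod>i\<in>UNIV. (x $ i) ^ \<alpha> i) has_derivative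
    (\<lambda>h. \<Sum>i\<in>UNIV. (of_nat (\<alpha> i) * (h $ i) * (x $ i) ^ (\<alpha> i - 1)) * (\<Prod>j\<in>UNIV - {i}. (x $ j) ^ \<alpha> j))) (at x)"
    by (intro has_derivative_prod has_derivative_power bounded_linear_imp_has_derivative
        bounded_linear_vec_nth)
  then show ?thesis
    by (simp add: monomial_def[abs_def] dmonomial_def mult_ac)
qed

lemma abs_dmonomial_le:
  assumes "\<And>j. \<bar>x $ j\<bar> \<le> s"
  shows "\<bar>dmonomial i \<alpha> x\<bar> \<le> real (\<alpha> i) * s ^ (total_degree \<alpha> - 1)"
proof (cases "\<alpha> i = 0")
  case False
  have s: "0 \<le> s" using assms[of i] by linarith
  have tot: "total_degree \<alpha> - 1 = (\<alpha> i - 1) + (\<Sum>j\<in>UNIV - {i}. \<alpha> j)"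
    using False by (simp add: total_degree_def sum.remove[of UNIV i])
  have "\<bar>\<Prod>j\<in>UNIV - {i}. (x $ j) ^ \<alpha> j\<bar> \<le> (\<Prod>j\<in>UNIV - {i}. s ^ \<alpha> j)"
    unfolding abs_prod by (intro prod_mono) (auto simp: power_abs intro!: power_mono assms)
  moreover have "\<bar>(x $ i) ^ (\<alpha> i - 1)\<bar> \<le> s ^ (\<alpha> i - 1)"
    by (auto simp: power_abs intro!: power_mono assms)
  ultimately have "\<bar>(x $ i) ^ (\<alpha> i - 1)\<bar> * \<bar>\<Prod>j\<in>UNIV - {i}. (x $ j) ^ \<alpha> j\<bar>
    \<le> s ^ (\<alpha> i - 1) * (\<Prod>j\<in>UNIV - {i}. s ^ \<alpha> j)"
    using s by (intro mult_mono) auto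
  also have "\<dots> = s ^ (total_degree \<alpha> - 1)" unfolding tot by (simp add: power_add power_sum)
  finally show ?thesis by (simp add: dmonomial_def abs_mult mult.assoc mult_left_mono)
qed (simp add: dmonomial_def)

text \<open>At the diagonal point with all coordinates s, a monomial is s to the total degree. The
  choice of s puts this point into the ball, and unordered summability of reals is absolute.\<close>

lemma monomial_series_abs_summable:
  fixes a :: "('n::finite \<Rightarrow> nat) \<Rightarrow> real"
  assumes r: "r > 0" and sum: "\<And>x. x \<in> ball 0 r \<Longrightarrow> ((\<lambda>\<alpha>. a \<alpha> * monomial \<alpha> x) has_sum u x) UNIV"
  obtains s where "s > 0" "(\<lambda>\<alpha>. \<bar>a \<alpha>\<bar> * s ^ total_degree \<alpha>) summable_on UNIV"
proof -
  define s where "s = r / (2 * real CARD('n))"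
  have s: "s > 0" using r by (simp add: s_def)
  define x :: "real ^ 'n" where "x = (\<chi> i. s)"
  have "norm x \<le> (\<Sum>i\<in>UNIV. \<bar>x $ i\<bar>)" by (rule norm_le_l1_cart)
  also have "\<dots> = r / 2" using r by (simp add: x_def s_def)
  finally have "x \<in> ball 0 r" using r by simp
  then have "(\<lambda>\<alpha>. a \<alpha> * monomial \<alpha> x) summable_on UNIV" using sum by (auto simp: summable_on_def)
  then have "(\<lambda>\<alpha>. \<bar>a \<alpha> * monomial \<alpha> x\<bar>) summable_on UNIV"
    using summable_on_iff_abs_summable_on_real by force
  moreover have "monomial \<alpha> x = s ^ total_degree \<alpha>" for \<alpha>
    by (simp add: monomial_def x_def total_degree_def power_sum)
  ultimately show thesis using s by (intro that[of s]) (auto simp: abs_mult)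
qed

text \<open>Shrinking the polyradius from s to t gains the factor (t / s)^n, which outweighs the
  exponent produced by differentiation.\<close>

lemma diff_series_abs_summable:
  fixes a :: "('n::finite \<Rightarrow> nat) \<Rightarrow> real"
  assumes s: "0 < t" "t < s" and sum: "(\<lambda>\<alpha>. \<bar>a \<alpha>\<bar> * s ^ total_degree \<alpha>) summable_on UNIV"
  shows "(\<lambda>\<alpha>. \<bar>a \<alpha>\<bar> * (real (\<alpha> i) * t ^ (total_degree \<alpha> - 1))) summable_on UNIV"
proof -
  have "(\<lambda>n. real n * (t / s) ^ n) \<longlonglongrightarrow> 0"
    using powser_times_n_limit_0[of "t / s"] s by simp
  then have "Bseq (\<lambda>n. real n * (t / s) ^ n)" by (intro convergent_imp_Bseq) (auto simp: convergent_def)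
  then obtain C where C: "\<And>n. norm (real n * (t / s) ^ n) \<le> C" by (auto simp: Bseq_def)
  have bd: "real k * t ^ (n - 1) \<le> C / t * s ^ n" if "k \<le> n" for k n
  proof (cases "n = 0")
    case True
    then show ?thesis using that C[of 0] s by simp
  next
    case False
    have "real k * t ^ (n - 1) \<le> real n * t ^ (n - 1)" using that s by (intro mult_right_mono) auto
    also have "\<dots> = (real n * (t / s) ^ n) * s ^ n / t"
      using False s by (cases n) (auto simp: field_simps)
    also have "\<dots> \<le> C * s ^ n / t"
      using C[of n] s by (intro divide_right_mono mult_right_mono) (auto simp: abs_mult)
    finally show ?thesis by (simp add: field_simps)
  qed
  have "\<alpha> i \<le> total_degree \<alpha>" for \<alpha> :: "'n \<Rightarrow> nat" by (simp add: total_degree_def member_le_sum)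
  then have le: "\<bar>a \<alpha>\<bar> * (real (\<alpha> i) * t ^ (total_degree \<alpha> - 1)) \<le> C / t * (\<bar>a \<alpha>\<bar> * s ^ total_degree \<alpha>)" for \<alpha>
    using mult_left_mono[OF bd[of "\<alpha> i" "total_degree \<alpha>"], of "\<bar>a \<alpha>\<bar>"] by (simp add: mult_ac)
  show ?thesis
    by (rule summable_on_comparison_test[OF summable_on_cmult_right[OF sum, of "C / t"]])
      (use le s in auto)
qed

text \<open>Raising the i-th exponent by 1 is injective, and it misses only multi-indices with
  exponent 0 at i, where the derivative of the monomial vanishes.\<close>

lemma has_sum_diff_series:
  assumes "((\<lambda>\<alpha>. a \<alpha> * dmonomial i \<alpha> x) has_sum l) UNIV"
  shows "((\<lambda>\<alpha>. diff_coeffs i a \<alpha> * monomial \<alpha> x) has_sum l) UNIV"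
proof -
  define \<phi> :: "('a \<Rightarrow> nat) \<Rightarrow> 'a \<Rightarrow> nat" where "\<phi> \<alpha> = \<alpha>(i := \<alpha> i + 1)" for \<alpha>
  have inj: "inj \<phi>"
  proof (rule injI)
    fix \<alpha> \<beta> assume "\<phi> \<alpha> = \<phi> \<beta>"
    then show "\<alpha> = \<beta>" unfolding \<phi>_def fun_eq_iff by (metis Suc_eq_plus1 fun_upd_other fun_upd_same nat.inject)
  qed
  have ran: "\<alpha> \<in> range \<phi>" if "\<alpha> i \<noteq> 0" for \<alpha>
    by (rule image_eqI[of _ _ "\<alpha>(i := \<alpha> i - 1)"]) (use that in \<open>auto simp: \<phi>_def\<close>)
  have "((\<lambda>\<alpha>. a \<alpha> * dmonomial i \<alpha> x) has_sum l) (range \<phi>)"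
    using assms by (rule has_sum_cong_neutral[THEN iffD1, rotated -1])
      (use ran in \<open>auto simp: dmonomial_def\<close>)
  then have "((\<lambda>\<alpha>. a \<alpha> * dmonomial i \<alpha> x) \<circ> \<phi> has_sum l) UNIV"
    using has_sum_reindex[OF inj] by blast
  moreover have "a (\<phi> \<alpha>) * dmonomial i (\<phi> \<alpha>) x = diff_coeffs i a \<alpha> * monomial \<alpha> x" for \<alpha>
    by (simp add: \<phi>_def dmonomial_def diff_coeffs_def monomial_def prod.remove[of UNIV i] mult_ac)
  ultimately show ?thesis by (simp add: o_def)
qed

text \<open>Termwise differentiation with the Weierstrass test. The multi-indices are enumerated by
  \<open>e\<close>, since the theorem on differentiating a series is about sequences; absolute
  convergence makes the order irrelevant.\<close>

lemma monomial_series_has_derivative: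
  fixes a :: "('n::finite \<Rightarrow> nat) \<Rightarrow> real"
  assumes "r > 0" and sum: "\<And>x. x \<in> ball 0 r \<Longrightarrow> ((\<lambda>\<alpha>. a \<alpha> * monomial \<alpha> x) has_sum u x) UNIV"
  obtains t D where "t > 0"
    "\<And>x. x \<in> ball 0 t \<Longrightarrow> (u has_derivative (\<lambda>h. \<Sum>i\<in>UNIV. h $ i * D i x)) (at x)"
    "\<And>i x. x \<in> ball 0 t \<Longrightarrow> ((\<lambda>\<alpha>. diff_coeffs i a \<alpha> * monomial \<alpha> x) has_sum D i x) UNIV"
proof -
  obtain s where s: "s > 0" "(\<lambda>\<alpha>. \<bar>a \<alpha>\<bar> * s ^ total_degree \<alpha>) summable_on UNIV"
    using monomial_series_abs_summable[OF assms] by blast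
  define t where "t = min (s / 2) (r / 2)"
  have t: "0 < t" "t < s" "t \<le> r" using s assms by (auto simp: t_def)
  define M where "M i \<alpha> = \<bar>a \<alpha>\<bar> * (real (\<alpha> i) * t ^ (total_degree \<alpha> - 1))" for i \<alpha>
  have M: "M i summable_on UNIV" for i
    unfolding M_def[abs_def] by (rule diff_series_abs_summable[OF t(1,2) s(2)])
  have aM: "\<bar>a \<alpha> * dmonomial i \<alpha> x\<bar> \<le> M i \<alpha>" if "x \<in> ball 0 t" for i \<alpha> x
  proof -
    have "\<bar>x $ j\<bar> \<le> t" for j using component_le_norm_cart[of x j] that by simp
    from abs_dmonomial_le[OF this] show ?thesis by (simp add: abs_mult M_def mult_left_mono)
  qed
  define D where "D i x = (\<Sum>\<^sub>\<infinity>\<alpha>. a \<alpha> * dmonomial i \<alpha> x)" for i x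
  have D: "((\<lambda>\<alpha>. a \<alpha> * dmonomial i \<alpha> x) has_sum D i x) UNIV" if "x \<in> ball 0 t" for i x
  proof -
    have "(\<lambda>\<alpha>. norm (a \<alpha> * dmonomial i \<alpha> x)) summable_on UNIV"
      by (rule summable_on_comparison_test[OF M[of i]]) (use aM that in auto)
    then show ?thesis unfolding D_def by (simp add: abs_summable_summable)
  qed
  define e :: "nat \<Rightarrow> 'n \<Rightarrow> nat" where "e = from_nat_into UNIV"
  have "infinite (UNIV :: ('n \<Rightarrow> nat) set)"
    by (rule infinite_super[OF subset_UNIV range_inj_infinite[of "\<lambda>k _. k"]])
      (auto simp: inj_def fun_eq_iff)
  then have e: "bij e" unfolding e_def by (intro bij_betw_from_nat_into) auto
  have enum: "((\<lambda>n. g (e n)) has_sum l) UNIV" if "(g has_sum l) UNIV" for g :: "('n \<Rightarrow> nat) \<Rightarrow> real" and l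
    using that e has_sum_reindex_bij_betw[OF e] by blast
  have Msum: "summable (\<lambda>n. M i (e n))" for i
    using enum[OF has_sum_infsum[OF M[of i]]] by (blast dest: has_sum_imp_sums intro: sums_summable)
  have unif: "uniform_limit (ball 0 t) (\<lambda>n x. \<Sum>k<n. a (e k) * dmonomial i (e k) x) (D i) sequentially" for i
  proof -
    have "uniform_limit (ball 0 t) (\<lambda>n x. \<Sum>k<n. a (e k) * dmonomial i (e k) x)
      (\<lambda>x. \<Sum>k. a (e k) * dmonomial i (e k) x) sequentially"
      by (rule Weierstrass_m_test[OF _ Msum[of i]]) (use aM in auto)
    moreover have "(\<Sum>k. a (e k) * dmonomial i (e k) x) = D i x" if "x \<in> ball 0 t" for x
      using enum[OF D[OF that]] by (metis has_sum_imp_sums sums_unique)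
    ultimately show ?thesis by (auto simp: uniform_limit_iff)
  qed
  have "\<exists>g. \<forall>x\<in>ball 0 t. (\<lambda>n. a (e n) * monomial (e n) x) sums g x \<and>
    (g has_derivative (\<lambda>h. \<Sum>i\<in>UNIV. h $ i * D i x)) (at x within ball 0 t)"
  proof (rule has_derivative_series[where x = 0 and l = "u 0" and
        f' = "\<lambda>n x h. a (e n) * (\<Sum>i\<in>UNIV. h $ i * dmonomial i (e n) x)"])
    show "((\<lambda>x. a (e n) * monomial (e n) x) has_derivative
      (\<lambda>h. a (e n) * (\<Sum>i\<in>UNIV. h $ i * dmonomial i (e n) x))) (at x within ball 0 t)" for n x
      by (rule has_derivative_mult_right[OF has_derivative_at_withinI[OF has_derivative_monomial]])
    show "(0 :: real ^ 'n) \<in> ball 0 t" using t by simp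
    show "(\<lambda>n. a (e n) * monomial (e n) 0) sums u 0"
      using enum[OF sum[of 0]] assms(1) by (simp add: has_sum_imp_sums)
    fix \<epsilon> :: real assume "\<epsilon> > 0"
    \<comment> \<open>The errors of all partial derivatives add up, one for each coordinate.\<close>
    define \<delta> where "\<delta> = \<epsilon> / real CARD('n)"
    have "\<delta> > 0" using \<open>\<epsilon> > 0\<close> by (simp add: \<delta>_def)
    have "\<forall>\<^sub>F n in sequentially. \<forall>i. \<forall>x\<in>ball 0 t. dist (\<Sum>k<n. a (e k) * dmonomial i (e k) x) (D i x) < \<delta>"
      by (rule eventually_all_finite) (use unif \<open>\<delta> > 0\<close> in \<open>auto simp: uniform_limit_iff\<close>)
    then show "\<forall>\<^sub>F n in sequentially. \<forall>x\<in>ball 0 t. \<forall>h. norm ((\<Sum>k<n. a (e k) *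
        (\<Sum>i\<in>UNIV. h $ i * dmonomial i (e k) x)) - (\<Sum>i\<in>UNIV. h $ i * D i x)) \<le> \<epsilon> * norm h"
    proof eventually_elim
      case (elim n)
      show ?case
      proof (intro ballI allI)
        fix x :: "real ^ 'n" and h :: "real ^ 'n" assume x: "x \<in> ball 0 t"
        have "(\<Sum>k<n. a (e k) * (\<Sum>i\<in>UNIV. h $ i * dmonomial i (e k) x)) - (\<Sum>i\<in>UNIV. h $ i * D i x)
          = (\<Sum>i\<in>UNIV. h $ i * ((\<Sum>k<n. a (e k) * dmonomial i (e k) x) - D i x))"
          unfolding sum_distrib_left right_diff_distrib sum_subtractf
          by (subst sum.swap) (simp add: mult_ac)
        also have "norm \<dots> \<le> (\<Sum>i\<in>(UNIV :: 'n set). norm h * \<delta>)"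
          unfolding real_norm_def
        proof (rule order_trans[OF sum_abs sum_mono], unfold abs_mult, rule mult_mono)
          fix i
          show "\<bar>h $ i\<bar> \<le> norm h" by (rule component_le_norm_cart)
          show "\<bar>(\<Sum>k<n. a (e k) * dmonomial i (e k) x) - D i x\<bar> \<le> \<delta>"
            using elim x by (auto simp: dist_real_def less_imp_le)
        qed auto
        also have "\<dots> = \<epsilon> * norm h" by (simp add: \<delta>_def)
        finally show "norm ((\<Sum>k<n. a (e k) * (\<Sum>i\<in>UNIV. h $ i * dmonomial i (e k) x))
          - (\<Sum>i\<in>UNIV. h $ i * D i x)) \<le> \<epsilon> * norm h" .
      qed
    qed
  qed simp
  then obtain g where g: "\<And>x. x \<in> ball 0 t \<Longrightarrow> (\<lambda>n. a (e n) * monomial (e n) x) sums g x"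
    "\<And>x. x \<in> ball 0 t \<Longrightarrow> (g has_derivative (\<lambda>h. \<Sum>i\<in>UNIV. h $ i * D i x)) (at x within ball 0 t)"
    by blast
  have gu: "g x = u x" if "x \<in> ball 0 t" for x
  proof -
    have "x \<in> ball 0 r" using that t by simp
    then show ?thesis using enum[OF sum] g(1)[OF that] by (metis has_sum_imp_sums sums_unique2)
  qed
  show thesis
  proof (rule that[OF t(1)])
    fix x :: "real ^ 'n" assume x: "x \<in> ball 0 t"
    have "(g has_derivative (\<lambda>h. \<Sum>i\<in>UNIV. h $ i * D i x)) (at x)"
      using g(2)[OF x] x by (simp add: at_within_open[OF x open_ball])
    then show "(u has_derivative (\<lambda>h. \<Sum>i\<in>UNIV. h $ i * D i x)) (at x)"
      by (rule has_derivative_transform_within_open[OF _ open_ball x gu])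
    show "((\<lambda>\<alpha>. diff_coeffs i a \<alpha> * monomial \<alpha> x) has_sum D i x) UNIV" for i
      by (rule has_sum_diff_series[OF D[OF x]])
  qed
qed

section \<open>Gradients and second derivatives of analytic germs\<close>

definition has_gradient :: "(real ^ 'n \<Rightarrow> real) \<Rightarrow> ('n \<Rightarrow> real) \<Rightarrow> real ^ 'n \<Rightarrow> bool" where
  "has_gradient u g x \<longleftrightarrow> (u has_derivative (\<lambda>h. \<Sum>i\<in>UNIV. h $ i * g i)) (at x)"

definition has_monomial_series ::
  "(real ^ 'n \<Rightarrow> real) \<Rightarrow> real \<Rightarrow> (('n \<Rightarrow> nat) \<Rightarrow> real) \<Rightarrow> bool" where
  "has_monomial_series u r a \<longleftrightarrow>
    0 < r \<and> (\<forall>x\<in>ball 0 r. ((\<lambda>\<alpha>. a \<alpha> * monomial \<alpha> x) has_sum u x) UNIV)"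

lemma real_analytic_at_0_iff: "real_analytic_at u 0 \<longleftrightarrow> (\<exists>r a. has_monomial_series u r a)"
  by (auto simp: real_analytic_at_def monomial_def has_monomial_series_def)

lemma has_monomial_series_gradient:
  assumes "has_monomial_series u r a"
  shows "\<exists>t D. (\<forall>x\<in>ball 0 t. has_gradient u (\<lambda>i. D i x) x) \<and>
    (\<forall>i. has_monomial_series (D i) t (diff_coeffs i a))"
proof -
  have r: "r > 0" and s: "\<And>x. x \<in> ball 0 r \<Longrightarrow> ((\<lambda>\<alpha>. a \<alpha> * monomial \<alpha> x) has_sum u x) UNIV"
    using assms by (auto simp: has_monomial_series_def)
  show ?thesis
  proof (rule monomial_series_has_derivative[OF r s])
    fix t D assume "t > 0"
      "\<And>x. x \<in> ball 0 t \<Longrightarrow> (u has_derivative (\<lambda>h. \<Sum>i\<in>UNIV. h $ i * D i x)) (at x)"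
      "\<And>i x. x \<in> ball 0 t \<Longrightarrow> ((\<lambda>\<alpha>. diff_coeffs i a \<alpha> * monomial \<alpha> x) has_sum D i x) UNIV"
    then show ?thesis
      by (intro exI[of _ t] exI[of _ D]) (auto simp: has_gradient_def has_monomial_series_def)
  qed
qed

lemma has_gradient_imp_isCont: "has_gradient u g x \<Longrightarrow> isCont u x"
  unfolding has_gradient_def by (rule has_derivative_continuous)

text \<open>The series is differentiated three times; the third step only provides continuity of the
  second derivatives. Their symmetry holds because both orders of differentiation give the same
  coefficients.\<close>

lemma real_analytic_at_0_C2:
  fixes u :: "real ^ 'n \<Rightarrow> real"
  assumes "real_analytic_at u 0"
  obtains r P Q where "r > 0"
    "\<And>x. x \<in> ball 0 r \<Longrightarrow> has_gradient u (\<lambda>i. P i x) x"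
    "\<And>i x. x \<in> ball 0 r \<Longrightarrow> has_gradient (P i) (\<lambda>j. Q i j x) x"
    "\<And>i j x. x \<in> ball 0 r \<Longrightarrow> Q i j x = Q j i x"
    "\<And>i j x. x \<in> ball 0 r \<Longrightarrow> isCont (Q i j) x"
proof -
  obtain r a where a: "has_monomial_series u r a"
    using assms unfolding real_analytic_at_0_iff by blast
  obtain r1 P where r1: "\<And>x. x \<in> ball 0 r1 \<Longrightarrow> has_gradient u (\<lambda>i. P i x) x"
    "\<And>i. has_monomial_series (P i) r1 (diff_coeffs i a)"
    using has_monomial_series_gradient[OF a] by blast
  have "\<forall>i. \<exists>r2 Q. (\<forall>x\<in>ball 0 r2. has_gradient (P i) (\<lambda>j. Q j x) x) \<and>
    (\<forall>j. has_monomial_series (Q j) r2 (diff_coeffs j (diff_coeffs i a)))"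
    using has_monomial_series_gradient[OF r1(2)] by blast
  then obtain r2 Q where r2: "\<And>i x. x \<in> ball 0 (r2 i) \<Longrightarrow> has_gradient (P i) (\<lambda>j. Q i j x) x"
    "\<And>i j. has_monomial_series (Q i j) (r2 i) (diff_coeffs j (diff_coeffs i a))"
    unfolding choice_iff by blast
  have "\<forall>i j. \<exists>r3>0. \<forall>x\<in>ball 0 r3. isCont (Q i j) x"
  proof (intro allI)
    fix i j
    obtain r3 R where "\<And>x. x \<in> ball 0 r3 \<Longrightarrow> has_gradient (Q i j) (\<lambda>k. R k x) x"
      "\<And>k. has_monomial_series (R k) r3 (diff_coeffs k (diff_coeffs j (diff_coeffs i a)))"
      using has_monomial_series_gradient[OF r2(2)] by blast
    then have "r3 > 0" "\<forall>x\<in>ball 0 r3. isCont (Q i j) x"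
      unfolding has_monomial_series_def using has_gradient_imp_isCont by blast+
    then show "\<exists>r3>0. \<forall>x\<in>ball 0 r3. isCont (Q i j) x" by blast
  qed
  then obtain r3 where r3: "\<And>i j. r3 i j > 0" "\<And>i j x. x \<in> ball 0 (r3 i j) \<Longrightarrow> isCont (Q i j) x"
    by metis
  have pos: "r1 > 0" "r2 i > 0" for i using r1(2) r2(2) by (auto simp: has_monomial_series_def)
  define t where "t = Min (insert r1 (range r2 \<union> range (\<lambda>(i, j). r3 i j)))"
  have fin: "finite (insert r1 (range r2 \<union> range (\<lambda>(i, j). r3 i j)))" by simp
  have t: "t > 0" unfolding t_def using pos r3 by (subst Min_gr_iff[OF fin]) auto
  have le: "t \<le> r1" "t \<le> r2 i" "t \<le> r3 i j" for i j
    unfolding t_def by (rule Min_le[OF fin]; force)+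
  show thesis
  proof (rule that[OF t])
    fix x :: "real ^ 'n" and i j assume x: "x \<in> ball 0 t"
    have x': "x \<in> ball 0 r1" "x \<in> ball 0 (r2 i)" "x \<in> ball 0 (r2 j)" "x \<in> ball 0 (r3 i j)"
      using x le(1) le(2)[of i] le(2)[of j] le(3)[of i j] by auto
    show "has_gradient u (\<lambda>i. P i x) x" using r1 x' by blast
    show "has_gradient (P i) (\<lambda>j. Q i j x) x" using r2 x' by blast
    have "((\<lambda>\<alpha>. diff_coeffs j (diff_coeffs i a) \<alpha> * monomial \<alpha> x) has_sum Q i j x) UNIV"
      "((\<lambda>\<alpha>. diff_coeffs i (diff_coeffs j a) \<alpha> * monomial \<alpha> x) has_sum Q j i x) UNIV"
      using r2(2) x' unfolding has_monomial_series_def by blast+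
    then show "Q i j x = Q j i x"
      unfolding diff_coeffs_commute[of j i a] by (rule has_sum_unique)
    show "isCont (Q i j) x" using r3 x' by blast
  qed
qed

section \<open>Flows\<close>

text \<open>Gronwall's argument: the squared distance of the solutions, damped by exp (- 2 L s),
  cannot increase, and it starts at 0.\<close>

lemma ode_unique_forward:
  fixes h u v :: "real \<Rightarrow> real"
  assumes lip: "L-lipschitz_on S h" and e: "0 \<le> t" "t < e"
    and u: "\<And>s. 0 \<le> s \<Longrightarrow> s < e \<Longrightarrow> u s \<in> S \<and> (u has_real_derivative h (u s)) (at s)"
    and v: "\<And>s. 0 \<le> s \<Longrightarrow> s < e \<Longrightarrow> v s \<in> S \<and> (v has_real_derivative h (v s)) (at s)"
    and init: "u 0 = v 0"
  shows "u t = v t"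
proof -
  define w where "w s = (u s - v s)\<^sup>2 * exp (- (2 * L * s))" for s
  have "w t \<le> w 0"
  proof (rule DERIV_nonpos_imp_nonincreasing[OF e(1)])
    fix s assume "0 \<le> s" "s \<le> t"
    then have s: "0 \<le> s" "s < e" using e by auto
    note [derivative_intros] = u[OF s, THEN conjunct2] v[OF s, THEN conjunct2]
    have der: "(w has_real_derivative
      2 * (u s - v s) * (h (u s) - h (v s)) * exp (- (2 * L * s))
        - (u s - v s)\<^sup>2 * (2 * L * exp (- (2 * L * s)))) (at s)"
      unfolding w_def[abs_def] by (auto intro!: derivative_eq_intros simp: algebra_simps)
    have "\<bar>h (u s) - h (v s)\<bar> \<le> L * \<bar>u s - v s\<bar>"
      using lipschitz_onD[OF lip, of "u s" "v s"] u[OF s] v[OF s] by (simp add: dist_real_def)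
    then have "\<bar>u s - v s\<bar> * \<bar>h (u s) - h (v s)\<bar> \<le> \<bar>u s - v s\<bar> * (L * \<bar>u s - v s\<bar>)"
      by (intro mult_left_mono) auto
    moreover have "(u s - v s) * (h (u s) - h (v s)) \<le> \<bar>u s - v s\<bar> * \<bar>h (u s) - h (v s)\<bar>"
      by (metis abs_ge_self abs_mult)
    moreover have "\<bar>u s - v s\<bar> * (L * \<bar>u s - v s\<bar>) = L * (u s - v s)\<^sup>2"
      by (simp add: power2_eq_square flip: abs_mult)
    ultimately have "(u s - v s) * (h (u s) - h (v s)) - L * (u s - v s)\<^sup>2 \<le> 0" by linarith
    then have "2 * exp (- (2 * L * s)) * ((u s - v s) * (h (u s) - h (v s)) - L * (u s - v s)\<^sup>2) \<le> 0"
      by (simp add: mult_le_0_iff)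
    then have "2 * (u s - v s) * (h (u s) - h (v s)) * exp (- (2 * L * s))
        - (u s - v s)\<^sup>2 * (2 * L * exp (- (2 * L * s))) \<le> 0"
      by (simp add: algebra_simps)
    with der show "\<exists>y. (w has_real_derivative y) (at s) \<and> y \<le> 0" by blast
  qed
  then have "(u t - v t)\<^sup>2 * exp (- (2 * L * t)) \<le> 0" by (simp add: w_def init)
  then have "(u t - v t)\<^sup>2 \<le> 0" by (simp add: mult_le_0_iff)
  then show ?thesis by simp
qed

lemma ode_unique:
  fixes h u v :: "real \<Rightarrow> real"
  assumes lip: "L-lipschitz_on S h" and t: "\<bar>t\<bar> < e"
    and u: "\<And>s. \<bar>s\<bar> < e \<Longrightarrow> u s \<in> S \<and> (u has_real_derivative h (u s)) (at s)"
    and v: "\<And>s. \<bar>s\<bar> < e \<Longrightarrow> v s \<in> S \<and> (v has_real_derivative h (v s)) (at s)"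
    and init: "u 0 = v 0"
  shows "u t = v t"
proof (cases "t \<ge> 0")
  case True
  show ?thesis by (rule ode_unique_forward[OF lip, where u = u and v = v and e = e]) (use t u v True init in auto)
next
  case False
  have rev: "((\<lambda>s. g (- s)) has_real_derivative - d) (at s)"
    if "(g has_real_derivative d) (at (- s))" for g d s
    using DERIV_chain2[OF that DERIV_minus[OF DERIV_ident]] by simp
  have lip': "L-lipschitz_on S (\<lambda>y. - h y)"
    using lip by (simp add: lipschitz_on_def dist_norm norm_minus_commute)
  have "u (- (- t)) = v (- (- t))"
    by (rule ode_unique_forward[OF lip', where u = "\<lambda>s. u (- s)" and v = "\<lambda>s. v (- s)" and e = e])
      (use t False u v init rev in auto)
  then show ?thesis by simp
qed

text \<open>\<open>J t\<close> is the oriented integral from 0 to t. Writing it as a difference of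
  integrals from - e covers negative times too.\<close>

lemma picard_integral:
  fixes g :: "real \<Rightarrow> 'a::euclidean_space"
  assumes e: "0 < e" and g: "continuous_on {-e..e} g"
  defines "J \<equiv> \<lambda>t. integral {-e..t} g - integral {-e..0} g"
  shows "continuous_on {-e..e} J"
    and "\<And>t. \<bar>t\<bar> < e \<Longrightarrow> (J has_vector_derivative g t) (at t)"
    and "\<And>t B. \<bar>t\<bar> \<le> e \<Longrightarrow> (\<And>s. s \<in> {-e..e} \<Longrightarrow> norm (g s) \<le> B) \<Longrightarrow> norm (J t) \<le> B * e"
proof -
  have int: "g integrable_on {-e..e}" by (rule integrable_continuous_real[OF g])
  show "continuous_on {-e..e} J" unfolding J_def
    by (intro continuous_intros indefinite_integral_continuous_1 int)
  show "(J has_vector_derivative g t) (at t)" if "\<bar>t\<bar> < e" for t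
  proof -
    have "((\<lambda>t. integral {-e..t} g) has_vector_derivative g t) (at t within {-e..e})"
      by (rule integral_has_vector_derivative[OF g]) (use that in auto)
    then have "((\<lambda>t. integral {-e..t} g) has_vector_derivative g t) (at t)"
      using that by (subst (asm) at_within_interior) auto
    then show ?thesis unfolding J_def
      by (auto intro!: derivative_eq_intros)
  qed
  show "norm (J t) \<le> B * e" if t: "\<bar>t\<bar> \<le> e" and B: "\<And>s. s \<in> {-e..e} \<Longrightarrow> norm (g s) \<le> B" for t B
  proof -
    have B0: "0 \<le> B" using B[of 0] e by (auto intro: order_trans[OF norm_ge_zero])
    have bd: "norm (integral {a..b} g) \<le> B * e" if "-e \<le> a" "a \<le> b" "b \<le> e" "b - a \<le> e" for a b
    proof -
      have "norm (integral {a..b} g) \<le> B * (b - a)"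
        by (rule integral_bound) (use that B in \<open>auto intro!: continuous_on_subset[OF g]\<close>)
      also have "\<dots> \<le> B * e" using that B0 by (intro mult_left_mono) auto
      finally show ?thesis .
    qed
    show ?thesis
    proof (cases "t \<ge> 0")
      case True
      have "integral {-e..0} g + integral {0..t} g = integral {-e..t} g"
        by (rule Henstock_Kurzweil_Integration.integral_combine)
          (use True t e in \<open>auto intro!: integrable_on_subinterval[OF int]\<close>)
      then have "J t = integral {0..t} g" by (simp add: J_def algebra_simps)
      then show ?thesis using bd[of 0 t] True t by auto
    next
      case False
      have "integral {-e..t} g + integral {t..0} g = integral {-e..0} g"
        by (rule Henstock_Kurzweil_Integration.integral_combine)
          (use False t e in \<open>auto intro!: integrable_on_subinterval[OF int]\<close>)
      then have "J t = - integral {t..0} g" by (simp add: J_def algebra_simps)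
      then show ?thesis using bd[of t 0] False t by auto
    qed
  qed
qed

text \<open>Banach's fixed point theorem for the Picard operator on bounded continuous functions on
  the whole line. Freezing time outside [- e, e] by \<open>clamp\<close> makes the operator map this
  space into itself, and L e \<le> 1 / 2 makes it a contraction.\<close>

lemma picard_lindeloef_global:
  fixes F :: "'a::euclidean_space \<Rightarrow> 'a"
  assumes lip: "L-lipschitz_on UNIV F" and M: "\<And>y. norm (F y) \<le> M"
    and e: "0 < e" "L * e \<le> 1 / 2"
  shows "\<exists>\<phi>. \<phi> 0 = x \<and> (\<forall>t. \<bar>t\<bar> < e \<longrightarrow>
    norm (\<phi> t - x) \<le> M * e \<and> (\<phi> has_vector_derivative F (\<phi> t)) (at t))"
proof -
  have L: "0 \<le> L" using lip by (simp add: lipschitz_on_def)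
  have contF: "continuous_on UNIV F" using lip by (rule lipschitz_on_continuous_on)
  define clamp where "clamp t = max (-e) (min e t)" for t
  have clamp: "clamp t \<in> {-e..e}" "\<bar>clamp t\<bar> \<le> e" for t using e by (auto simp: clamp_def)
  have clamp_id: "clamp t = t" if "\<bar>t\<bar> \<le> e" for t using that by (auto simp: clamp_def)
  define J where "J g t = integral {-e..t} g - integral {-e..0} g" for g :: "real \<Rightarrow> 'a" and t
  note J = picard_integral[where 'a = 'a, OF e(1), folded J_def]
  have cont: "continuous_on A (\<lambda>t. F (apply_bcontfun \<phi> t))" for \<phi> :: "real \<Rightarrow>\<^sub>C 'a" and A
    by (rule continuous_on_compose2[OF contF]) auto
  define T where "T \<phi> = Bcontfun (\<lambda>t. x + J (\<lambda>s. F (apply_bcontfun \<phi> s)) (clamp t))" for \<phi>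
  have T: "apply_bcontfun (T \<phi>) t = x + J (\<lambda>s. F (apply_bcontfun \<phi> s)) (clamp t)" for \<phi> t
  proof -
    have "(\<lambda>t. x + J (\<lambda>s. F (apply_bcontfun \<phi> s)) (clamp t)) \<in> bcontfun"
    proof (rule bcontfun_normI)
      have "continuous_on UNIV clamp" unfolding clamp_def[abs_def] by (intro continuous_intros)
      then have "continuous_on UNIV (\<lambda>t. J (\<lambda>s. F (apply_bcontfun \<phi> s)) (clamp t))"
        by (rule continuous_on_compose2[OF J(1)[OF cont]]) (use clamp in auto)
      then show "continuous_on UNIV (\<lambda>t. x + J (\<lambda>s. F (apply_bcontfun \<phi> s)) (clamp t))"
        by (intro continuous_intros)
      fix t
      show "norm (x + J (\<lambda>s. F (apply_bcontfun \<phi> s)) (clamp t)) \<le> norm x + M * e"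
        by (rule norm_triangle_le) (use J(3)[OF cont clamp(2)] M in auto)
    qed
    then show ?thesis by (simp add: T_def Bcontfun_inverse)
  qed
  have contr: "dist (T \<phi>) (T \<psi>) \<le> 1 / 2 * dist \<phi> \<psi>" for \<phi> \<psi>
  proof (rule dist_bound)
    fix t
    have int: "(\<lambda>s. F (apply_bcontfun \<theta> s)) integrable_on {-e..r}" for r and \<theta>
      by (rule integrable_continuous_real[OF cont])
    have sub: "J (\<lambda>s. F (apply_bcontfun \<phi> s)) r - J (\<lambda>s. F (apply_bcontfun \<psi> s)) r
      = J (\<lambda>s. F (apply_bcontfun \<phi> s) - F (apply_bcontfun \<psi> s)) r" for r
      unfolding J_def using int by (simp add: Henstock_Kurzweil_Integration.integral_diff)
    have "dist (T \<phi> t) (T \<psi> t) = norm (J (\<lambda>s. F (apply_bcontfun \<phi> s) - F (apply_bcontfun \<psi> s)) (clamp t))"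
      by (simp add: T dist_norm sub)
    also have "\<dots> \<le> (L * dist \<phi> \<psi>) * e"
    proof (rule J(3)[OF _ clamp(2)])
      show "continuous_on {-e..e} (\<lambda>s. F (apply_bcontfun \<phi> s) - F (apply_bcontfun \<psi> s))"
        by (intro continuous_intros cont)
      fix s
      have "norm (F (apply_bcontfun \<phi> s) - F (apply_bcontfun \<psi> s)) \<le> L * dist (apply_bcontfun \<phi> s) (apply_bcontfun \<psi> s)"
        using lipschitz_onD[OF lip] by (simp add: dist_norm)
      also have "\<dots> \<le> L * dist \<phi> \<psi>" by (intro mult_left_mono dist_bounded L)
      finally show "norm (F (apply_bcontfun \<phi> s) - F (apply_bcontfun \<psi> s)) \<le> L * dist \<phi> \<psi>" .
    qed
    also have "\<dots> = (L * e) * dist \<phi> \<psi>" by simp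
    also have "\<dots> \<le> 1 / 2 * dist \<phi> \<psi>" using e by (intro mult_right_mono) auto
    finally show "dist (T \<phi> t) (T \<psi> t) \<le> 1 / 2 * dist \<phi> \<psi>" .
  qed
  obtain \<phi> where \<phi>: "T \<phi> = \<phi>"
    using banach_fix_type[of "1/2" T] contr by auto
  have eq: "apply_bcontfun \<phi> t = x + J (\<lambda>s. F (apply_bcontfun \<phi> s)) t" if "\<bar>t\<bar> \<le> e" for t
    using T[of \<phi> t] \<phi> clamp_id[OF that] by simp
  show ?thesis
  proof (intro exI[of _ "apply_bcontfun \<phi>"] conjI allI impI)
    show "apply_bcontfun \<phi> 0 = x" using eq[of 0] e by (simp add: J_def)
    fix t assume t: "\<bar>t\<bar> < e"
    show "norm (apply_bcontfun \<phi> t - x) \<le> M * e"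
      using J(3)[OF cont, of t \<phi> M] M eq[of t] t by simp
    have "((\<lambda>t. x + J (\<lambda>s. F (apply_bcontfun \<phi> s)) t) has_vector_derivative F (apply_bcontfun \<phi> t)) (at t)"
      using J(2)[OF cont t] by (auto intro!: derivative_eq_intros)
    then show "(apply_bcontfun \<phi> has_vector_derivative F (apply_bcontfun \<phi> t)) (at t)"
      by (rule has_vector_derivative_transform_within_open[of _ _ _ "{-e<..<e}"]) (use t eq in auto)
  qed
qed

text \<open>Composition with the closest-point map of the ball, which is 1-Lipschitz, extends V to a
  bounded Lipschitz field. Solutions starting in the half ball move by at most r / 2, so they stay
  where the extension agrees with V.\<close>

lemma picard_lindeloef:
  fixes V :: "'a::euclidean_space \<Rightarrow> 'a"
  assumes r: "0 < r" and lip: "L-lipschitz_on (cball 0 r) V"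
  obtains e \<Phi> where "0 < e"
    "\<And>x. x \<in> ball 0 (r / 2) \<Longrightarrow> \<Phi> 0 x = x"
    "\<And>x t. x \<in> ball 0 (r / 2) \<Longrightarrow> \<bar>t\<bar> < e \<Longrightarrow>
      \<Phi> t x \<in> cball 0 r \<and> ((\<lambda>s. \<Phi> s x) has_vector_derivative V (\<Phi> t x)) (at t)"
proof -
  have L: "0 \<le> L" using lip by (simp add: lipschitz_on_def)
  define F where "F y = V (closest_point (cball 0 r) y)" for y
  have in_ball: "closest_point (cball 0 r) y \<in> cball (0::'a) r" for y
    using r by (intro closest_point_in_set) auto
  define M where "M = norm (V 0) + L * r"
  have M: "norm (F y) \<le> M" for y
  proof -
    have "dist (F y) (V 0) \<le> L * dist (closest_point (cball 0 r) y) 0"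
      unfolding F_def using lipschitz_onD[OF lip in_ball, of 0 y] r by simp
    also have "\<dots> \<le> L * r" using in_ball[of y] L by (intro mult_left_mono) auto
    finally show ?thesis using norm_triangle_sub[of "F y" "V 0"] by (simp add: M_def dist_norm)
  qed
  have lipF: "L-lipschitz_on UNIV F"
  proof (rule lipschitz_onI[OF _ L])
    fix y z :: 'a
    have "dist (F y) (F z) \<le> L * dist (closest_point (cball 0 r) y) (closest_point (cball 0 r) z)"
      unfolding F_def by (rule lipschitz_onD[OF lip in_ball in_ball])
    also have "\<dots> \<le> L * dist y z"
      using r by (intro mult_left_mono L closest_point_lipschitz) auto
    finally show "dist (F y) (F z) \<le> L * dist y z" .
  qed
  have M0: "0 \<le> M" using M[of 0] norm_ge_zero order_trans by blast
  \<comment> \<open>The first bound makes L e \<le> 1 / 2, the second M e \<le> r / 2; adding 1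
    keeps the denominators positive.\<close>
  define e where "e = min (1 / (2 * (L + 1))) (r / (2 * (M + 1)))"
  have e: "0 < e" using r L M0 by (simp add: e_def)
  have "L * e \<le> L * (1 / (2 * (L + 1)))" using L by (intro mult_left_mono) (auto simp: e_def)
  also have "\<dots> \<le> 1 / 2" using L by (simp add: field_simps)
  finally have Le: "L * e \<le> 1 / 2" .
  have "M * e \<le> M * (r / (2 * (M + 1)))" using M0 by (intro mult_left_mono) (auto simp: e_def)
  also have "\<dots> \<le> r / 2" using M0 r by (simp add: field_simps)
  finally have Me: "M * e \<le> r / 2" .
  obtain \<Phi> where \<Phi>: "\<And>x. \<Phi> x 0 = x"
    "\<And>x t. \<bar>t\<bar> < e \<Longrightarrow> norm (\<Phi> x t - x) \<le> M * e \<and> (\<Phi> x has_vector_derivative F (\<Phi> x t)) (at t)"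
    using picard_lindeloef_global[OF lipF M e Le] by metis
  show thesis
  proof (rule that[of e "\<lambda>t x. \<Phi> x t"])
    fix x :: 'a and t :: real assume x: "x \<in> ball 0 (r / 2)" and t: "\<bar>t\<bar> < e"
    have "norm (\<Phi> x t) \<le> norm x + norm (\<Phi> x t - x)" using norm_triangle_sub by blast
    also have "\<dots> \<le> r" using \<Phi>(2)[OF t, of x] Me x by simp
    finally have in': "\<Phi> x t \<in> cball 0 r" by simp
    then have "F (\<Phi> x t) = V (\<Phi> x t)" by (simp add: F_def closest_point_self)
    then show "\<Phi> x t \<in> cball 0 r \<and> ((\<lambda>s. \<Phi> x s) has_vector_derivative V (\<Phi> x t)) (at t)"
      using \<Phi>(2)[OF t, of x] in' by simp
  qed (use e \<Phi> in auto)
qed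

section \<open>Gradients and restriction to the axes\<close>

lemma isCont_imp_eventually_nhds:
  assumes "isCont g a" "\<forall>\<^sub>F y in nhds (g a). A y"
  shows "\<forall>\<^sub>F x in nhds a. A (g x)"
proof -
  have "(g \<longlongrightarrow> g a) (nhds a)" using assms(1) by (simp only: isCont_def tendsto_at_iff_tendsto_nhds)
  then show ?thesis using assms(2) by (auto intro: eventually_compose_filterlim)
qed

lemma has_gradient_unique:
  assumes "has_gradient u g x" "has_gradient u g' x"
  shows "g i = g' i"
proof -
  have "(\<lambda>h. \<Sum>i\<in>UNIV. h $ i * g i) = (\<lambda>h. \<Sum>i\<in>UNIV. h $ i * g' i)"
    using assms unfolding has_gradient_def by (rule has_derivative_unique)
  then have "(\<Sum>j\<in>UNIV. axis i 1 $ j * g j) = (\<Sum>j\<in>UNIV. axis i 1 $ j * g' j)" by metis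
  then show ?thesis by (simp add: axis_def if_distrib[of "\<lambda>x. x * _"] cong: if_cong)
qed

lemma has_gradient_along:
  assumes "has_gradient u g (c t)" "(c has_vector_derivative v) (at t)"
  shows "((\<lambda>s. u (c s)) has_real_derivative (\<Sum>i\<in>UNIV. v $ i * g i)) (at t)"
proof -
  have "(u \<circ> c has_derivative (\<lambda>h. \<Sum>i\<in>UNIV. h $ i * g i) \<circ> (\<lambda>s. s *\<^sub>R v)) (at t)"
    using assms unfolding has_gradient_def has_vector_derivative_def by (intro diff_chain_at) auto
  moreover have "(\<lambda>h. \<Sum>i\<in>UNIV. h $ i * g i) \<circ> (\<lambda>s. s *\<^sub>R v) = (*) (\<Sum>i\<in>UNIV. v $ i * g i)"
    by (auto simp: fun_eq_iff sum_distrib_left mult_ac)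
  ultimately show ?thesis by (simp add: has_field_derivative_def o_def)
qed

lemma axis_eq_scaleR: "(axis i s :: real ^ 'n) = s *\<^sub>R axis i 1"
  by (auto simp: axis_def vec_eq_iff)

lemma norm_axis_real [simp]: "norm (axis i s :: real ^ 'n) = \<bar>s\<bar>"
  by (subst axis_eq_scaleR) simp

lemma has_vector_derivative_axis: "((\<lambda>s. axis i s :: real ^ 'n) has_vector_derivative axis i 1) (at t)"
  by (subst axis_eq_scaleR) (auto intro!: derivative_eq_intros)

lemma has_gradient_axis:
  assumes "has_gradient u g (axis i s)"
  shows "((\<lambda>s. u (axis i s)) has_real_derivative g i) (at s)"
  using has_gradient_along[OF assms has_vector_derivative_axis]
  by (simp add: axis_def if_distrib[of "\<lambda>x. x * _"] cong: if_cong)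

lemma C1_imp_lipschitz_on:
  fixes h :: "real \<Rightarrow> real"
  assumes der: "\<And>y. y \<in> cball c d \<Longrightarrow> (h has_real_derivative h' y) (at y)"
    and cont: "continuous_on (cball c d) h'"
  obtains L where "L-lipschitz_on (cball c d) h"
proof -
  have "bounded (h' ` cball c d)" using cont by (intro compact_imp_bounded compact_continuous_image) auto
  then obtain B where B: "B > 0" "\<And>y. y \<in> cball c d \<Longrightarrow> norm (h' y) \<le> B"
    by (auto simp: bounded_pos)
  have "B-lipschitz_on (cball c d) h"
  proof (rule lipschitz_onI)
    fix x y assume xy: "x \<in> cball c d" "y \<in> cball c d"
    show "dist (h x) (h y) \<le> B * dist x y"
      unfolding dist_norm
      by (rule field_differentiable_bound[OF convex_cball has_field_derivative_at_within[OF der] B(2) xy])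
  qed (use B in auto)
  then show thesis by (rule that)
qed

text \<open>A function constant on the level sets of \<open>f\<close> is a function of \<open>f\<close>, of class \<open>C\<^sup>1\<close>
  since \<open>f\<close> can be inverted on a coordinate axis.\<close>

lemma factor_through:
  fixes f W :: "real ^ 'n \<Rightarrow> real" and i :: 'n
  assumes r: "r > 0"
    and f: "\<And>x. x \<in> ball 0 r \<Longrightarrow> has_gradient f (\<lambda>i. P i x) x"
    and W: "\<And>x. x \<in> ball 0 r \<Longrightarrow> has_gradient W (\<lambda>i. R i x) x"
    and P: "\<And>x. x \<in> ball 0 r \<Longrightarrow> isCont (P i) x" "\<And>x. x \<in> ball 0 r \<Longrightarrow> P i x \<noteq> 0"
    and R: "\<And>x. x \<in> ball 0 r \<Longrightarrow> isCont (R i) x"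
    and U: "open U" "0 \<in> U" "\<And>x y. x \<in> U \<Longrightarrow> y \<in> U \<Longrightarrow> f x = f y \<Longrightarrow> W x = W y"
  obtains d h h' where "d > 0" "\<And>y. y \<in> ball (f 0) d \<Longrightarrow> (h has_real_derivative h' y) (at y)"
    "continuous_on (ball (f 0) d) h'" "\<forall>\<^sub>F x in nhds 0. W x = h (f x)"
proof -
  obtain r' where r': "r' > 0" "ball 0 r' \<subseteq> U" using U by (meson openE)
  define \<delta> where "\<delta> = min r r'"
  define I where "I = ball (0::real) \<delta>"
  have I: "open I" "0 \<in> I" using r r' by (auto simp: I_def \<delta>_def)
  have ax: "axis i s \<in> ball 0 r" "axis i s \<in> U" if "s \<in> I" for s
    using that r' by (auto simp: I_def \<delta>_def intro!: subsetD[OF r'(2)])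
  define \<phi> where "\<phi> s = f (axis i s)" for s
  have \<phi>: "(\<phi> has_real_derivative P i (axis i s)) (at s)" if "s \<in> I" for s
    unfolding \<phi>_def using has_gradient_axis[OF f] ax[OF that] by blast
  have \<phi>cont: "continuous_on I \<phi>"
    using \<phi> by (meson DERIV_continuous continuous_at_imp_continuous_on)
  have neq: "\<phi> a \<noteq> \<phi> b" if "a \<in> I" "b \<in> I" "a < b" for a b
  proof
    assume eq: "\<phi> a = \<phi> b"
    have sub: "x \<in> I" if "a \<le> x" "x \<le> b" for x
      using that \<open>a \<in> I\<close> \<open>b \<in> I\<close> by (auto simp: I_def)
    have "\<exists>z>a. z < b \<and> \<phi> b - \<phi> a = (b - a) * P i (axis i z)"
      by (rule MVT2[OF \<open>a < b\<close>]) (use \<phi> sub in auto)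
    then obtain z where z: "a < z" "z < b" "P i (axis i z) = 0" using eq \<open>a < b\<close> by auto
    then have "z \<in> I" by (intro sub) auto
    then show False using z P(2) ax by blast
  qed
  have inj: "inj_on \<phi> I"
    by (rule inj_onI) (metis neq linorder_less_linear)
  define g where "g = the_inv_into I \<phi>"
  have g: "g (\<phi> s) = s" if "s \<in> I" for s
    unfolding g_def using inj that by (rule the_inv_into_f_f)
  \<comment> \<open>As the derivative at 0 is non-zero, \<phi> is open there; hence the inverse
    \<open>g\<close> is defined on a whole neighbourhood of \<open>f 0\<close>.\<close>
  have "\<phi> 0 \<in> interior (\<phi> ` I)"
  proof (rule sussmann_open_mapping[OF I(1) \<phi>cont I(2)])
    show "(\<phi> has_derivative (*) (P i (axis i 0))) (at 0)"
      using \<phi>[OF I(2)] by (simp add: has_field_derivative_def)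
    show "bounded_linear ((*) (inverse (P i (axis i 0))))" by (rule bounded_linear_mult_right)
    show "(*) (P i (axis i 0)) \<circ> (*) (inverse (P i (axis i 0))) = id"
      using P(2)[OF ax(1)[OF I(2)]] by (auto simp: fun_eq_iff)
    show "0 \<in> interior I" using I by (simp add: interior_open)
  qed auto
  then obtain d where d: "d > 0" "ball (\<phi> 0) d \<subseteq> \<phi> ` I" by (auto simp: mem_interior)
  have \<phi>0: "\<phi> 0 = f 0" by (simp add: \<phi>_def axis_def vec_eq_iff zero_vec_def)
  have gI: "g y \<in> I" "\<phi> (g y) = y" if "y \<in> ball (f 0) d" for y
    using d that g \<phi>0 by auto
  have gder: "(g has_real_derivative inverse (P i (axis i (g y)))) (at y)" if "y \<in> ball (f 0) d" for y
  proof -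
    let ?c = "P i (axis i (g y))"
    have "?c \<noteq> 0" using P(2) ax gI that by blast
    have "(g has_derivative (*) (inverse ?c)) (at (\<phi> (g y)))"
    proof (rule has_derivative_inverse_strong[OF I(1) gI(1)[OF that] \<phi>cont g])
      show "(\<phi> has_derivative (*) ?c) (at (g y))"
        using \<phi>[OF gI(1)[OF that]] by (simp add: has_field_derivative_def)
      show "(*) ?c \<circ> (*) (inverse ?c) = id" using \<open>?c \<noteq> 0\<close> by (auto simp: fun_eq_iff)
    qed
    then show ?thesis using gI(2)[OF that] by (simp add: has_field_derivative_def)
  qed
  define h where "h y = W (axis i (g y))" for y
  define h' where "h' y = R i (axis i (g y)) * inverse (P i (axis i (g y)))" for y
  have "continuous_on (ball (f 0) d) (\<lambda>y. R i (axis i (g y)))"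
    and "continuous_on (ball (f 0) d) (\<lambda>y. P i (axis i (g y)))"
  proof -
    have gc: "isCont g y" if "y \<in> ball (f 0) d" for y using gder[OF that] by (rule DERIV_isCont)
    have ac: "isCont (axis i) (g y)" for y
      using has_vector_derivative_axis by (rule has_vector_derivative_continuous)
    have "isCont (\<lambda>y. K (axis i (g y))) y" if "\<And>x. x \<in> ball 0 r \<Longrightarrow> isCont K x" "y \<in> ball (f 0) d"
      for K :: "real ^ 'n \<Rightarrow> real" and y
    proof -
      have "isCont K (axis i (g y))" using that(1) ax(1) gI(1) that(2) by blast
      then show ?thesis by (rule isCont_o2[OF isCont_o2[OF gc[OF that(2)] ac]])
    qed
    then show "continuous_on (ball (f 0) d) (\<lambda>y. R i (axis i (g y)))"
      "continuous_on (ball (f 0) d) (\<lambda>y. P i (axis i (g y)))"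
      using R P(1) by (auto intro!: continuous_at_imp_continuous_on)
  qed
  then have "continuous_on (ball (f 0) d) h'"
    unfolding h'_def[abs_def] using P(2) ax gI by (intro continuous_intros) auto
  moreover have "(h has_real_derivative h' y) (at y)" if y: "y \<in> ball (f 0) d" for y
    unfolding h_def[abs_def] h'_def
    by (rule DERIV_chain2[where f = "\<lambda>s. W (axis i s)"])
      (use has_gradient_axis[OF W] ax gI y gder in blast)+
  moreover have "\<forall>\<^sub>F x in nhds 0. W x = h (f x)"
  proof -
    have "isCont f 0" using has_gradient_imp_isCont[OF f] r by simp
    then have "\<forall>\<^sub>F x in nhds 0. f x \<in> ball (f 0) d"
      by (rule isCont_imp_eventually_nhds[OF _ eventually_nhds_in_open]) (use d(1) in auto)
    moreover have "\<forall>\<^sub>F x in nhds 0. x \<in> U" using U by (simp add: eventually_nhds_in_open)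
    ultimately show ?thesis
    proof eventually_elim
      case (elim x)
      \<comment> \<open>The point x and this point of the axis lie on the same level set of f, so W
        takes the same value at both.\<close>
      then have "f (axis i (g (f x))) = f x" using gI(2) by (simp add: \<phi>_def)
      then show ?case using U(3)[of x "axis i (g (f x))"] elim ax gI by (simp add: h_def)
    qed
  qed
  ultimately show thesis using d(1) that by blast
qed

section \<open>Germs on a coordinate axis as power series in one variable\<close>

lemma real_analytic_axis:
  assumes "real_analytic_at u 0"
  obtains F where "(\<lambda>s. u (axis i s)) has_fps_expansion F"
proof -
  obtain r a where ra: "has_monomial_series u r a" using assms real_analytic_at_0_iff by blast
  then have r: "r > 0" by (simp add: has_monomial_series_def)
  define \<phi> :: "nat \<Rightarrow> 'a \<Rightarrow> nat" where "\<phi> k = (\<lambda>_. 0)(i := k)" for k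
  have inj: "inj \<phi>" by (rule injI) (metis \<phi>_def fun_upd_same)
  have mono: "monomial (\<phi> k) (axis i s) = s ^ k" for k s
    by (simp add: monomial_def \<phi>_def axis_def prod.remove[of UNIV i])
  have zero: "monomial \<alpha> (axis i s) = 0" if "\<alpha> \<notin> range \<phi>" for \<alpha> s
  proof -
    have "\<alpha> \<noteq> \<phi> (\<alpha> i)" using that by blast
    then obtain j where "j \<noteq> i" "\<alpha> j \<noteq> 0" by (auto simp: \<phi>_def fun_eq_iff split: if_splits)
    then show ?thesis unfolding monomial_def by (intro prod_zero) (auto simp: axis_def)
  qed
  define F where "F = Abs_fps (\<lambda>k. a (\<phi> k))"
  have sums: "(\<lambda>k. a (\<phi> k) * s ^ k) sums u (axis i s)" if "\<bar>s\<bar> < r" for s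
  proof -
    have "axis i s \<in> ball (0 :: real ^ 'a) r" using that by simp
    then have "((\<lambda>\<alpha>. a \<alpha> * monomial \<alpha> (axis i s)) has_sum u (axis i s)) UNIV"
      using ra unfolding has_monomial_series_def by blast
    then have "((\<lambda>\<alpha>. a \<alpha> * monomial \<alpha> (axis i s)) has_sum u (axis i s)) (range \<phi>)"
      by (rule has_sum_cong_neutral[THEN iffD1, rotated -1]) (auto simp: zero)
    then have "((\<lambda>k. a (\<phi> k) * s ^ k) has_sum u (axis i s)) UNIV"
      by (simp add: has_sum_reindex[OF inj] o_def mono)
    then show ?thesis by (rule has_sum_imp_sums)
  qed
  have "norm (r / 2) \<le> fps_conv_radius F" unfolding fps_conv_radius_def
    by (rule conv_radius_geI) (use sums[of "r / 2"] r in \<open>auto simp: F_def sums_iff\<close>)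
  then have "ereal (r / 2) \<le> fps_conv_radius F" using r by simp
  moreover have "0 < ereal (r / 2)" using r by simp
  ultimately have "fps_conv_radius F > 0" by (rule less_le_trans[rotated])
  moreover have "\<forall>\<^sub>F s in nhds 0. eval_fps F s = u (axis i s)"
  proof (rule eventually_mono[OF eventually_nhds_in_open[of "ball 0 r"]])
    show "eval_fps F s = u (axis i s)" if "s \<in> ball 0 r" for s
      using sums[of s] that by (simp add: eval_fps_def F_def sums_iff)
  qed (use r in auto)
  ultimately have "(\<lambda>s. u (axis i s)) has_fps_expansion F" by (simp add: has_fps_expansion_def)
  then show thesis by (rule that)
qed

lemma real_analytic_eval_fps:
  assumes F: "fps_conv_radius F > 0" and u: "\<forall>\<^sub>F x in nhds 0. u x = eval_fps F (x $ i)"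
  shows "real_analytic_at u 0"
proof -
  obtain r1 where r1: "r1 > 0" "\<And>x. dist x 0 < r1 \<Longrightarrow> u x = eval_fps F (x $ i)"
    using u unfolding eventually_nhds_metric by blast
  obtain r2 :: real where r2: "r2 > 0" "ereal r2 < fps_conv_radius F"
    using ereal_dense2[OF F[unfolded zero_ereal_def]] by auto
  define r where "r = min r1 r2"
  have r: "r > 0" using r1 r2 by (simp add: r_def)
  define \<phi> :: "nat \<Rightarrow> 'a \<Rightarrow> nat" where "\<phi> k = (\<lambda>_. 0)(i := k)" for k
  have inj: "inj \<phi>" by (rule injI) (metis \<phi>_def fun_upd_same)
  define a where "a \<alpha> = (if \<alpha> \<in> range \<phi> then fps_nth F (\<alpha> i) else 0)" for \<alpha>
  have mono: "a (\<phi> k) * monomial (\<phi> k) x = fps_nth F k * (x $ i) ^ k" for k x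
  proof -
    have "monomial (\<phi> k) x = (x $ i) ^ k" by (simp add: monomial_def \<phi>_def prod.remove[of UNIV i])
    moreover have "a (\<phi> k) = fps_nth F k" by (auto simp: a_def) (simp add: \<phi>_def)
    ultimately show ?thesis by simp
  qed
  have "((\<lambda>\<alpha>. a \<alpha> * monomial \<alpha> x) has_sum u x) UNIV" if x: "x \<in> ball 0 r" for x :: "real ^ 'a"
  proof -
    have "norm (x $ i) < r2" using x component_le_norm_cart[of x i] by (simp add: r_def)
    then have rad: "ereal (norm (x $ i)) < fps_conv_radius F"
      using r2 by (meson ereal_less_eq(3) le_less_trans less_imp_le)
    have "u x = eval_fps F (x $ i)" using r1(2)[of x] x by (simp add: r_def)
    then have "(\<lambda>k. fps_nth F k * (x $ i) ^ k) sums u x" using sums_eval_fps[of "x $ i" F] rad by simp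
    moreover have "summable (\<lambda>k. norm (fps_nth F k * (x $ i) ^ k))" using norm_summable_fps[OF rad] .
    ultimately have "((\<lambda>k. fps_nth F k * (x $ i) ^ k) has_sum u x) UNIV"
      by (metis norm_summable_imp_has_sum)
    then have "((\<lambda>\<alpha>. a \<alpha> * monomial \<alpha> x) \<circ> \<phi> has_sum u x) UNIV" by (simp add: o_def mono)
    then have "((\<lambda>\<alpha>. a \<alpha> * monomial \<alpha> x) has_sum u x) (range \<phi>)"
      using has_sum_reindex[OF inj] by blast
    then show ?thesis
      by (rule has_sum_cong_neutral[THEN iffD1, rotated -1]) (auto simp: a_def)
  qed
  then show ?thesis
    using r unfolding real_analytic_at_0_iff has_monomial_series_def by blast
qed

section \<open>Infinitesimal isomorphisms\<close>

lemma has_gradient_compose: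
  assumes "has_gradient u g x" "(h has_real_derivative c) (at (u x))"
  shows "has_gradient (\<lambda>x. h (u x)) (\<lambda>j. c * g j) x"
proof -
  have "(h \<circ> u has_derivative (*) c \<circ> (\<lambda>k. \<Sum>i\<in>UNIV. k $ i * g i)) (at x)"
    using assms unfolding has_gradient_def has_field_derivative_def by (intro diff_chain_at)
  moreover have "(*) c \<circ> (\<lambda>k. \<Sum>i\<in>UNIV. k $ i * g i) = (\<lambda>k. \<Sum>i\<in>UNIV. k $ i * (c * g i))"
    by (auto simp: fun_eq_iff sum_distrib_left mult_ac)
  ultimately show ?thesis by (simp add: has_gradient_def o_def)
qed

lemma eventually_nhds_component:
  assumes "\<forall>\<^sub>F s in nhds 0. A s"
  shows "\<forall>\<^sub>F x in nhds (0 :: real ^ 'n). A (x $ i)"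
  by (rule isCont_imp_eventually_nhds[OF linear_continuous_at[OF bounded_linear_vec_nth]])
    (use assms in simp)

lemma eventually_nhds_axis:
  assumes "\<forall>\<^sub>F x in nhds (0 :: real ^ 'n). A x"
  shows "\<forall>\<^sub>F s in nhds 0. A (axis i s)"
proof (rule isCont_imp_eventually_nhds[where g = "axis i" and a = 0])
  show "isCont (axis i :: real \<Rightarrow> real ^ 'n) 0"
    using has_vector_derivative_axis by (rule has_vector_derivative_continuous)
  have "axis i (0::real) = (0 :: real ^ 'n)" by (simp add: axis_def vec_eq_iff)
  then show "\<forall>\<^sub>F x in nhds (axis i 0). A x" using assms by metis
qed

lemma eval_fps_eventually:
  fixes X Y :: "real fps"
  assumes "fps_conv_radius X > 0" "fps_conv_radius Y > 0"
  shows eval_fps_add_eventually: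
      "\<forall>\<^sub>F s in nhds 0. eval_fps (X + Y) s = eval_fps X s + eval_fps Y s"
    and eval_fps_scale_eventually:
      "\<forall>\<^sub>F s in nhds 0. eval_fps (fps_const c * X) s = c * eval_fps X s"
    and eval_fps_bracket_eventually:
      "\<forall>\<^sub>F s in nhds 0. eval_fps (bracket X Y) s =
        eval_fps X s * eval_fps (fps_deriv Y) s - eval_fps Y s * eval_fps (fps_deriv X) s"
    and fps_conv_radius_add_pos: "fps_conv_radius (X + Y) > 0"
    and fps_conv_radius_scale_pos: "fps_conv_radius (fps_const c * X) > 0"
    and fps_conv_radius_bracket_pos: "fps_conv_radius (bracket X Y) > 0"
proof -
  have "fps_conv_radius (fps_deriv X) > 0" "fps_conv_radius (fps_deriv Y) > 0"
    using assms fps_conv_radius_deriv[of X] fps_conv_radius_deriv[of Y] by (auto intro: less_le_trans)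
  then have e: "eval_fps X has_fps_expansion X" "eval_fps Y has_fps_expansion Y"
    "eval_fps (fps_deriv X) has_fps_expansion fps_deriv X"
    "eval_fps (fps_deriv Y) has_fps_expansion fps_deriv Y"
    using assms by (auto intro: eval_fps_has_fps_expansion)
  show "\<forall>\<^sub>F s in nhds 0. eval_fps (X + Y) s = eval_fps X s + eval_fps Y s"
    "fps_conv_radius (X + Y) > 0"
    using has_fps_expansion_add[OF e(1,2)] by (auto simp: has_fps_expansion_def)
  show "\<forall>\<^sub>F s in nhds 0. eval_fps (fps_const c * X) s = c * eval_fps X s"
    "fps_conv_radius (fps_const c * X) > 0"
    using has_fps_expansion_cmult_left[OF e(1), of c] by (auto simp: has_fps_expansion_def)
  show "\<forall>\<^sub>F s in nhds 0. eval_fps (bracket X Y) s =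
        eval_fps X s * eval_fps (fps_deriv Y) s - eval_fps Y s * eval_fps (fps_deriv X) s"
    "fps_conv_radius (bracket X Y) > 0"
    using has_fps_expansion_diff[OF has_fps_expansion_mult[OF e(1,4)] has_fps_expansion_mult[OF e(2,3)]]
    by (auto simp: has_fps_expansion_def bracket_def)
qed

definition series_field :: "('n \<Rightarrow> real fps) \<Rightarrow> real ^ 'n \<Rightarrow> real ^ 'n" where
  "series_field X x = (\<chi> i. eval_fps (X i) (x $ i))"

locale web_function =
  fixes f :: "real ^ 'n \<Rightarrow> real" and r :: real and P :: "'n \<Rightarrow> real ^ 'n \<Rightarrow> real"
    and Q :: "'n \<Rightarrow> 'n \<Rightarrow> real ^ 'n \<Rightarrow> real"
  assumes r: "r > 0"
    and grad_f: "x \<in> ball 0 r \<Longrightarrow> has_gradient f (\<lambda>i. P i x) x"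
    and grad_P: "x \<in> ball 0 r \<Longrightarrow> has_gradient (P i) (\<lambda>j. Q i j x) x"
    and Q_sym: "x \<in> ball 0 r \<Longrightarrow> Q i j x = Q j i x"
    and Q_cont: "x \<in> ball 0 r \<Longrightarrow> isCont (Q i j) x"
    and P_nonzero: "x \<in> ball 0 r \<Longrightarrow> P i x \<noteq> 0"
begin

text \<open>This is X f, the derivative of f along the field with components X, and
  \<open>along_grad\<close> is its gradient by the product rule.\<close>

definition along :: "('n \<Rightarrow> real fps) \<Rightarrow> real ^ 'n \<Rightarrow> real" where
  "along X x = (\<Sum>i\<in>UNIV. eval_fps (X i) (x $ i) * P i x)"

definition along_grad :: "('n \<Rightarrow> real fps) \<Rightarrow> 'n \<Rightarrow> real ^ 'n \<Rightarrow> real" where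
  "along_grad X j x = eval_fps (fps_deriv (X j)) (x $ j) * P j x +
    (\<Sum>i\<in>UNIV. eval_fps (X i) (x $ i) * Q i j x)"

text \<open>No regularity of h is demanded, which is the form that flows provide;
  \<open>iso_series_factor\<close> recovers it.\<close>

definition iso_series :: "('n \<Rightarrow> real fps) \<Rightarrow> bool" where
  "iso_series X \<longleftrightarrow> (\<forall>i. fps_conv_radius (X i) > 0) \<and> (\<exists>h. \<forall>\<^sub>F x in nhds 0. along X x = h (f x))"

lemma common_radius:
  fixes X :: "'n \<Rightarrow> real fps"
  assumes "\<And>i. fps_conv_radius (X i) > 0"
  obtains \<rho> where "0 < \<rho>" "\<rho> \<le> r" "\<And>i. ereal \<rho> < fps_conv_radius (X i)"
proof -
  have "\<forall>i. \<exists>\<rho>>0. ereal \<rho> < fps_conv_radius (X i)"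
    using assms ereal_dense2[of 0] by (metis ereal_less(2) zero_ereal_def)
  then obtain \<rho> where \<rho>: "\<And>i. \<rho> i > 0" "\<And>i. ereal (\<rho> i) < fps_conv_radius (X i)" by metis
  have fin: "finite (insert r (range \<rho>))" by simp
  show thesis
  proof (rule that[of "Min (insert r (range \<rho>))"])
    show "0 < Min (insert r (range \<rho>))" using r \<rho> by (subst Min_gr_iff[OF fin]) auto
    show "Min (insert r (range \<rho>)) \<le> r" by (rule Min_le[OF fin]) auto
    show "ereal (Min (insert r (range \<rho>))) < fps_conv_radius (X i)" for i
    proof (rule le_less_trans[OF _ \<rho>(2)])
      show "ereal (Min (insert r (range \<rho>))) \<le> ereal (\<rho> i)" 
        unfolding ereal_less_eq(3) by (rule Min_le[OF fin]) auto
    qed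
  qed
qed

lemma component_radius:
  assumes "ereal \<rho> < fps_conv_radius F" "x \<in> cball 0 \<rho>"
  shows "ereal (norm ((x :: real ^ 'n) $ i)) < fps_conv_radius F"
proof -
  have "norm (x $ i) \<le> \<rho>" using assms(2) component_le_norm_cart[of x i] by simp
  then show ?thesis using assms(1) by (meson ereal_less_eq(3) le_less_trans)
qed

lemma grad_along:
  assumes \<rho>: "\<rho> \<le> r" "\<And>i. ereal \<rho> < fps_conv_radius (X i)" and x: "x \<in> ball 0 \<rho>"
  shows "has_gradient (along X) (\<lambda>j. along_grad X j x) x"
    and "isCont (along_grad X j) x"
proof -
  have xr: "x \<in> ball 0 r" using \<rho> x by auto
  have xX: "ereal (norm (x $ i)) < fps_conv_radius (X i)" for i
    by (rule component_radius[OF \<rho>(2)]) (use x in auto)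
  have der: "((\<lambda>x. eval_fps (X i) (x $ i)) has_derivative
    (\<lambda>h. eval_fps (fps_deriv (X i)) (x $ i) * (h $ i))) (at x)" for i
  proof -
    have "(eval_fps (X i) has_derivative (*) (eval_fps (fps_deriv (X i)) (x $ i))) (at (x $ i))"
      using has_field_derivative_eval_fps[of "x $ i" "X i" UNIV] xX by (simp add: has_field_derivative_def)
    then show ?thesis
      using diff_chain_at[OF bounded_linear_imp_has_derivative[OF bounded_linear_vec_nth]]
      by (simp add: o_def)
  qed
  have "((\<lambda>x. \<Sum>i\<in>UNIV. eval_fps (X i) (x $ i) * P i x) has_derivative
    (\<lambda>h. \<Sum>i\<in>UNIV. eval_fps (X i) (x $ i) * (\<Sum>j\<in>UNIV. h $ j * Q i j x) +
      eval_fps (fps_deriv (X i)) (x $ i) * (h $ i) * P i x)) (at x)"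
    by (intro has_derivative_sum has_derivative_mult der grad_P[OF xr, unfolded has_gradient_def])
  moreover have "(\<Sum>i\<in>UNIV. eval_fps (X i) (x $ i) * (\<Sum>j\<in>UNIV. h $ j * Q i j x) +
      eval_fps (fps_deriv (X i)) (x $ i) * (h $ i) * P i x) = (\<Sum>j\<in>UNIV. h $ j * along_grad X j x)" for h
  proof -
    have "(\<Sum>i\<in>UNIV. eval_fps (X i) (x $ i) * (\<Sum>j\<in>UNIV. h $ j * Q i j x))
      = (\<Sum>j\<in>UNIV. h $ j * (\<Sum>i\<in>UNIV. eval_fps (X i) (x $ i) * Q i j x))"
      unfolding sum_distrib_left by (subst sum.swap) (simp add: mult_ac)
    then show ?thesis
      by (simp add: along_grad_def sum.distrib ring_distribs mult_ac)
  qed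
  ultimately show "has_gradient (along X) (\<lambda>j. along_grad X j x) x"
    by (simp add: has_gradient_def along_def[abs_def])
  have "isCont (\<lambda>x. eval_fps (X i) (x $ i)) x" for i
    using der by (rule has_derivative_continuous)
  moreover have "isCont (\<lambda>x. eval_fps (fps_deriv (X j)) (x $ j)) x"
  proof (rule isCont_o2[where g = "eval_fps (fps_deriv (X j))"])
    show "isCont (\<lambda>x. x $ j) x" by (rule linear_continuous_at[OF bounded_linear_vec_nth])
    show "isCont (eval_fps (fps_deriv (X j))) (x $ j)"
      using xX[of j] fps_conv_radius_deriv[of "X j"] by (intro continuous_eval_fps) (auto intro: less_le_trans)
  qed
  moreover have "isCont (P j) x" using grad_P[OF xr] by (rule has_gradient_imp_isCont)
  ultimately show "isCont (along_grad X j) x"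
    unfolding along_grad_def[abs_def] by (intro continuous_intros Q_cont xr)
qed

text \<open>Factoring X f through f by inverting f on an axis gives a differentiable h. Comparing
  the gradients of X f and h (f) then yields the derivative identity needed for brackets.\<close>

lemma iso_series_factor:
  assumes "iso_series X"
  obtains d h h' where "d > 0" "\<And>y. y \<in> ball (f 0) d \<Longrightarrow> (h has_real_derivative h' y) (at y)"
    "continuous_on (ball (f 0) d) h'" "\<forall>\<^sub>F x in nhds 0. along X x = h (f x)"
    "\<forall>\<^sub>F x in nhds 0. \<forall>j. along_grad X j x = h' (f x) * P j x"
proof -
  obtain \<rho> where \<rho>: "0 < \<rho>" "\<rho> \<le> r" "\<And>i. ereal \<rho> < fps_conv_radius (X i)"
    using assms common_radius by (auto simp: iso_series_def)
  obtain h0 where "\<forall>\<^sub>F x in nhds 0. along X x = h0 (f x)" using assms by (auto simp: iso_series_def)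
  then obtain U where U: "open U" "0 \<in> U" "\<And>x. x \<in> U \<Longrightarrow> along X x = h0 (f x)"
    by (auto simp: eventually_nhds)
  have "\<exists>d h h'. d > 0 \<and> (\<forall>y\<in>ball (f 0) d. (h has_real_derivative h' y) (at y)) \<and>
    continuous_on (ball (f 0) d) h' \<and> (\<forall>\<^sub>F x in nhds 0. along X x = h (f x))"
  \<comment> \<open>Any axis will do, since no partial derivative of f vanishes;
    \<open>undefined\<close> just names some index.\<close>
  proof (rule factor_through[where f = f and W = "along X" and P = P and R = "along_grad X" and U = U
        and r = \<rho> and i = undefined])
    fix x :: "real ^ 'n" assume "x \<in> ball 0 \<rho>"
    moreover from this have "x \<in> ball 0 r" using \<rho> by simp
    ultimately show "has_gradient f (\<lambda>i. P i x) x" "has_gradient (along X) (\<lambda>i. along_grad X i x) x"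
      "isCont (P undefined) x" "P undefined x \<noteq> 0" "isCont (along_grad X undefined) x"
      using grad_f grad_along[OF \<rho>(2,3)] has_gradient_imp_isCont[OF grad_P] P_nonzero by auto
  next
    show "along X x = along X y" if "x \<in> U" "y \<in> U" "f x = f y" for x y using U(3) that by simp
  next
    fix d h h' assume "d > 0" "\<And>y. y \<in> ball (f 0) d \<Longrightarrow> (h has_real_derivative h' y) (at y)"
      "continuous_on (ball (f 0) d) h'" "\<forall>\<^sub>F x in nhds 0. along X x = h (f x)"
    then show "\<exists>d h h'. d > 0 \<and> (\<forall>y\<in>ball (f 0) d. (h has_real_derivative h' y) (at y)) \<and>
      continuous_on (ball (f 0) d) h' \<and> (\<forall>\<^sub>F x in nhds 0. along X x = h (f x))"
      by (intro exI[of _ d] exI[of _ h] exI[of _ h']) auto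
  qed (use \<rho> U in auto)
  then obtain d h h' where d: "d > 0"
    and h: "\<And>y. y \<in> ball (f 0) d \<Longrightarrow> (h has_real_derivative h' y) (at y)"
    and h': "continuous_on (ball (f 0) d) h'" and ev: "\<forall>\<^sub>F x in nhds 0. along X x = h (f x)"
    by blast
  have "\<forall>\<^sub>F x in nhds 0. \<forall>j. along_grad X j x = h' (f x) * P j x"
  proof -
    obtain U where U: "open U" "0 \<in> U" "\<And>x. x \<in> U \<Longrightarrow> along X x = h (f x)"
      using ev by (auto simp: eventually_nhds)
    have "isCont f 0" using has_gradient_imp_isCont[OF grad_f] r by simp
    then have "\<forall>\<^sub>F x in nhds 0. f x \<in> ball (f 0) d"
      by (rule isCont_imp_eventually_nhds[OF _ eventually_nhds_in_open]) (use d(1) in auto)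
    moreover have "\<forall>\<^sub>F x in nhds 0. x \<in> U" "\<forall>\<^sub>F x in nhds 0. x \<in> ball (0 :: real ^ 'n) \<rho>"
      using U \<rho> by (intro eventually_nhds_in_open; auto)+
    ultimately show ?thesis
    proof eventually_elim
      case (elim x)
      have "x \<in> ball 0 r" using elim \<rho> by simp
      then have "has_gradient (\<lambda>x. h (f x)) (\<lambda>j. h' (f x) * P j x) x"
        using elim by (intro has_gradient_compose grad_f h)
      then have "has_gradient (along X) (\<lambda>j. h' (f x) * P j x) x"
        unfolding has_gradient_def
        by (rule has_derivative_transform_within_open[OF _ U(1)]) (use elim U in auto)
      from has_gradient_unique[OF grad_along(1)[OF \<rho>(2,3)] this] elim show ?case by blast
    qed
  qed
  with d h' ev show thesis by (intro that[of d h h'] h)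
qed

section \<open>Stability under the Lie algebra operations\<close>

lemma iso_series_zero: "iso_series (\<lambda>i. 0)"
  unfolding iso_series_def by (intro conjI allI exI[of _ "\<lambda>_. 0"]) (auto simp: along_def)

lemma iso_series_add:
  assumes "iso_series X" "iso_series Y"
  shows "iso_series (\<lambda>i. X i + Y i)"
proof -
  have rad: "fps_conv_radius (X i) > 0" "fps_conv_radius (Y i) > 0" for i
    using assms by (auto simp: iso_series_def)
  obtain h k where "\<forall>\<^sub>F x in nhds 0. along X x = h (f x)" "\<forall>\<^sub>F x in nhds 0. along Y x = k (f x)"
    using assms by (auto simp: iso_series_def)
  moreover have "\<forall>\<^sub>F x in nhds 0. \<forall>i. eval_fps (X i + Y i) (x $ i) = eval_fps (X i) (x $ i) + eval_fps (Y i) (x $ i)"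
    by (intro eventually_all_finite eventually_nhds_component eval_fps_add_eventually rad)
  ultimately have "\<forall>\<^sub>F x in nhds 0. along (\<lambda>i. X i + Y i) x = (\<lambda>y. h y + k y) (f x)"
    by eventually_elim (simp add: along_def ring_distribs sum.distrib)
  then show ?thesis unfolding iso_series_def
    by (intro conjI allI exI[of _ "\<lambda>y. h y + k y"] fps_conv_radius_add_pos rad)
qed

lemma iso_series_scale:
  assumes "iso_series X"
  shows "iso_series (\<lambda>i. fps_const c * X i)"
proof -
  have rad: "fps_conv_radius (X i) > 0" for i
    using assms by (auto simp: iso_series_def)
  obtain h where "\<forall>\<^sub>F x in nhds 0. along X x = h (f x)"
    using assms by (auto simp: iso_series_def)
  moreover have "\<forall>\<^sub>F x in nhds 0. \<forall>i. eval_fps (fps_const c * X i) (x $ i) = c * eval_fps (X i) (x $ i)"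
    by (intro eventually_all_finite eventually_nhds_component eval_fps_scale_eventually[OF rad rad])
  ultimately have "\<forall>\<^sub>F x in nhds 0. along (\<lambda>i. fps_const c * X i) x = (\<lambda>y. c * h y) (f x)"
    by eventually_elim (simp add: along_def mult.assoc sum_distrib_left[symmetric])
  then show ?thesis unfolding iso_series_def
    by (intro conjI allI exI[of _ "\<lambda>y. c * h y"] fps_conv_radius_scale_pos[OF rad rad])
qed

text \<open>If X f = h (f) and Y f = k (f), then X (Y f) - Y (X f) = k' (f) h (f) - h' (f) k (f). In
  coordinates the second derivatives of f cancel by symmetry, which leaves the bracket applied to
  f.\<close>

lemma iso_series_bracket:
  assumes "iso_series X" "iso_series Y"
  shows "iso_series (\<lambda>i. bracket (X i) (Y i))"
proof -
  have rad: "fps_conv_radius (X i) > 0" "fps_conv_radius (Y i) > 0" for i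
    using assms by (auto simp: iso_series_def)
  obtain h h' where h: "\<forall>\<^sub>F x in nhds 0. along X x = h (f x)"
    "\<forall>\<^sub>F x in nhds 0. \<forall>j. along_grad X j x = h' (f x) * P j x"
    by (rule iso_series_factor[OF assms(1)]) (rule that)
  obtain k k' where k: "\<forall>\<^sub>F x in nhds 0. along Y x = k (f x)"
    "\<forall>\<^sub>F x in nhds 0. \<forall>j. along_grad Y j x = k' (f x) * P j x"
    by (rule iso_series_factor[OF assms(2)]) (rule that)
  have "\<forall>\<^sub>F x in nhds 0. \<forall>i. eval_fps (bracket (X i) (Y i)) (x $ i) =
    eval_fps (X i) (x $ i) * eval_fps (fps_deriv (Y i)) (x $ i) -
    eval_fps (Y i) (x $ i) * eval_fps (fps_deriv (X i)) (x $ i)"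
    by (intro eventually_all_finite eventually_nhds_component eval_fps_bracket_eventually rad)
  moreover have "\<forall>\<^sub>F x in nhds 0. x \<in> ball (0 :: real ^ 'n) r"
    using r by (intro eventually_nhds_in_open) auto
  ultimately have "\<forall>\<^sub>F x in nhds 0. along (\<lambda>i. bracket (X i) (Y i)) x = (\<lambda>y. k' y * h y - h' y * k y) (f x)"
    using h k
  proof eventually_elim
    case (elim x)
    define a b where "a i = eval_fps (X i) (x $ i)" and "b i = eval_fps (Y i) (x $ i)" for i
    define a' b' where "a' i = eval_fps (fps_deriv (X i)) (x $ i)" and "b' i = eval_fps (fps_deriv (Y i)) (x $ i)" for i
    have swap: "(\<Sum>j\<in>UNIV. \<Sum>i\<in>UNIV. a j * (b i * Q i j x)) = (\<Sum>j\<in>UNIV. \<Sum>i\<in>UNIV. b j * (a i * Q i j x))"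
      by (subst sum.swap) (simp add: Q_sym[OF elim(2)] mult_ac)
    have "along (\<lambda>i. bracket (X i) (Y i)) x = (\<Sum>j\<in>UNIV. (a j * b' j - b j * a' j) * P j x)"
      using elim(1) by (simp add: along_def a_def b_def a'_def b'_def)
    also have "\<dots> = (\<Sum>j\<in>UNIV. a j * (b' j * P j x + (\<Sum>i\<in>UNIV. b i * Q i j x)))
      - (\<Sum>j\<in>UNIV. b j * (a' j * P j x + (\<Sum>i\<in>UNIV. a i * Q i j x)))"
      unfolding distrib_left sum.distrib sum_distrib_left swap
      by (simp add: algebra_simps sum_subtractf)
    also have "\<dots> = (\<Sum>j\<in>UNIV. a j * along_grad Y j x) - (\<Sum>j\<in>UNIV. b j * along_grad X j x)"
      by (simp add: along_grad_def a_def b_def a'_def b'_def)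
    also have "\<dots> = k' (f x) * along X x - h' (f x) * along Y x"
      unfolding along_def sum_distrib_left using elim(4,6) by (simp add: a_def b_def mult_ac)
    finally show ?case using elim by simp
  qed
  then show ?thesis unfolding iso_series_def
    by (intro conjI allI exI[of _ "\<lambda>y. k' y * h y - h' y * k y"] fps_conv_radius_bracket_pos rad)
qed

text \<open>Invariance is differentiated at time 0. For the coordinate foliations it says that the
  i-th component of V depends on the i-th coordinate only, so it can be read off on the axis; for f
  it says that V f is constant on level sets.\<close>

lemma series_of_inf_iso:
  assumes "V \<in> inf_isos f"
  obtains X where "iso_series X" "\<forall>\<^sub>F x in nhds 0. V x = series_field X x"
proof -
  obtain \<epsilon> U \<Phi> where flow: "local_flow V \<epsilon> U \<Phi>"
    and pres: "\<And>u. u \<in> first_integrals f \<Longrightarrow> preserves_foliation \<epsilon> U \<Phi> u"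
    and an: "\<And>i. real_analytic_at (\<lambda>x. V x $ i) 0"
    using assms by (auto simp: inf_isos_def analytic_field_def)
  have U: "open U" "0 \<in> U" "\<epsilon> > 0" using flow by (auto simp: local_flow_def)
  have \<Phi>: "\<Phi> 0 x = x" "((\<lambda>s. \<Phi> s x) has_vector_derivative V x) (at 0)" if "x \<in> U" for x
  proof -
    show "\<Phi> 0 x = x" using flow that by (simp add: local_flow_def)
    moreover have "\<forall>t. \<bar>t\<bar> < \<epsilon> \<longrightarrow> ((\<lambda>s. \<Phi> s x) has_vector_derivative V (\<Phi> t x)) (at t)"
      using flow that unfolding local_flow_def by blast
    from this[THEN spec, of 0] have "((\<lambda>s. \<Phi> s x) has_vector_derivative V (\<Phi> 0 x)) (at 0)"
      using U(3) by simp
    ultimately show "((\<lambda>s. \<Phi> s x) has_vector_derivative V x) (at 0)" by simp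
  qed
  have uniq: "a = b" if "(p has_real_derivative a) (at 0)" "(q has_real_derivative b) (at 0)"
    "\<And>t. \<bar>t\<bar> < \<epsilon> \<Longrightarrow> p t = q t" for p q a b
  proof -
    have "(q has_real_derivative a) (at 0)"
      by (rule has_field_derivative_transform_within_open[OF that(1), of "ball 0 \<epsilon>"]) (use U that(3) in auto)
    then show ?thesis using that(2) by (rule DERIV_unique)
  qed
  have der: "((\<lambda>s. \<Phi> s x $ i) has_real_derivative V x $ i) (at 0)" if "x \<in> U" for x i
    unfolding has_real_derivative_iff_has_vector_derivative
    by (rule bounded_linear.has_vector_derivative[OF bounded_linear_vec_nth \<Phi>(2)[OF that]])
  have comp: "V x $ i = V y $ i" if xy: "x \<in> U" "y \<in> U" "x $ i = y $ i" for x y i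
  proof (rule uniq[OF der[OF xy(1)] der[OF xy(2)]])
    show "\<Phi> t x $ i = \<Phi> t y $ i" if "\<bar>t\<bar> < \<epsilon>" for t
      using pres[of "\<lambda>x. x $ i"] that xy unfolding first_integrals_def preserves_foliation_def by blast
  qed
  have fder: "((\<lambda>s. f (\<Phi> s x)) has_real_derivative (\<Sum>i\<in>UNIV. V x $ i * P i x)) (at 0)"
    if "x \<in> U" "x \<in> ball 0 r" for x
  proof (rule has_gradient_along[OF _ \<Phi>(2)[OF that(1)]])
    show "has_gradient f (\<lambda>i. P i x) (\<Phi> 0 x)" using grad_f[OF that(2)] \<Phi>(1)[OF that(1)] by simp
  qed
  have fcomp: "(\<Sum>i\<in>UNIV. V x $ i * P i x) = (\<Sum>i\<in>UNIV. V y $ i * P i y)"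
    if xy: "x \<in> U" "y \<in> U" "x \<in> ball 0 r" "y \<in> ball 0 r" "f x = f y" for x y
  proof (rule uniq[OF fder[OF xy(1,3)] fder[OF xy(2,4)]])
    show "f (\<Phi> t x) = f (\<Phi> t y)" if "\<bar>t\<bar> < \<epsilon>" for t
      using pres[of f] that xy unfolding first_integrals_def preserves_foliation_def by blast
  qed
  have "\<forall>i. \<exists>F. (\<lambda>s. V (axis i s) $ i) has_fps_expansion F"
    using real_analytic_axis[OF an] by metis
  then obtain X where X: "\<And>i. (\<lambda>s. V (axis i s) $ i) has_fps_expansion X i" by metis
  have evU: "\<forall>\<^sub>F x in nhds 0. x \<in> U" using U by (intro eventually_nhds_in_open)
  have "\<forall>\<^sub>F x in nhds 0. V x $ i = eval_fps (X i) (x $ i)" for i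
  proof -
    have "\<forall>\<^sub>F x in nhds 0. axis i (x $ i) \<in> U"
      by (rule eventually_nhds_component[OF eventually_nhds_axis[OF evU]])
    moreover have "\<forall>\<^sub>F x in nhds (0 :: real ^ 'n). eval_fps (X i) (x $ i) = V (axis i (x $ i)) $ i"
      using X[of i] by (intro eventually_nhds_component) (simp add: has_fps_expansion_def)
    ultimately show ?thesis using evU
    proof eventually_elim
      case (elim x)
      then show ?case using comp[of x "axis i (x $ i)" i] by simp
    qed
  qed
  then have ev: "\<forall>\<^sub>F x in nhds 0. \<forall>i. V x $ i = eval_fps (X i) (x $ i)"
    by (rule eventually_all_finite)
  then have "\<forall>\<^sub>F x in nhds 0. x \<in> U \<and> x \<in> ball 0 r \<and> (\<forall>i. V x $ i = eval_fps (X i) (x $ i))"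
    using r U by (intro eventually_conj eventually_nhds_in_open) auto
  then obtain U' where U': "open U'" "0 \<in> U'"
    "\<And>x. x \<in> U' \<Longrightarrow> x \<in> U \<and> x \<in> ball 0 r \<and> (\<forall>i. V x $ i = eval_fps (X i) (x $ i))"
    unfolding eventually_nhds by blast
  \<comment> \<open>X f is evaluated at a chosen point of the level set inside \<open>U'\<close>; by
    \<open>fcomp\<close> the choice does not matter.\<close>
  define h where "h y = along X (SOME x. x \<in> U' \<and> f x = y)" for y
  have "along X x = h (f x)" if "x \<in> U'" for x
  proof -
    define z where "z = (SOME z. z \<in> U' \<and> f z = f x)"
    have "z \<in> U' \<and> f z = f x" unfolding z_def by (rule someI[of _ x]) (use that in auto)
    then have "along X x = along X z"
      using fcomp[of x z] U'(3)[of x] U'(3)[of z] that by (simp add: along_def)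
    then show ?thesis by (simp add: h_def z_def)
  qed
  then have "\<forall>\<^sub>F x in nhds 0. along X x = h (f x)"
    unfolding eventually_nhds using U'(1,2) by blast
  moreover have "fps_conv_radius (X i) > 0" for i using X[of i] by (simp add: has_fps_expansion_def)
  ultimately have "iso_series X" by (auto simp: iso_series_def)
  moreover have "\<forall>\<^sub>F x in nhds 0. V x = series_field X x"
    using ev by eventually_elim (simp add: series_field_def vec_eq_iff)
  ultimately show thesis by (rule that)
qed

text \<open>Along a trajectory each first integral u solves a scalar autonomous equation, with
  right-hand side h for f and the i-th series for the i-th coordinate. These are Lipschitz, so equal
  initial values stay equal, which is invariance of the foliation.\<close>

lemma inf_iso_of_series:
  assumes X: "iso_series X" and V: "\<forall>\<^sub>F x in nhds 0. V x = series_field X x"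
  shows "V \<in> inf_isos f"
proof -
  have rad: "fps_conv_radius (X i) > 0" for i using X by (simp add: iso_series_def)
  have "analytic_field V" unfolding analytic_field_def
  proof
    show "real_analytic_at (\<lambda>x. V x $ i) 0" for i
      by (rule real_analytic_eval_fps[OF rad[of i], where i = i])
        (use V in \<open>auto elim!: eventually_mono simp: series_field_def\<close>)
  qed
  obtain \<rho>1 where \<rho>1: "0 < \<rho>1" "\<rho>1 \<le> r" "\<And>i. ereal \<rho>1 < fps_conv_radius (X i)"
    by (rule common_radius[OF rad]) (rule that)
  obtain d h h' where d: "d > 0" and h: "\<And>y. y \<in> ball (f 0) d \<Longrightarrow> (h has_real_derivative h' y) (at y)"
    and h': "continuous_on (ball (f 0) d) h'" and ev: "\<forall>\<^sub>F x in nhds 0. along X x = h (f x)"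
    by (rule iso_series_factor[OF X]) (rule that)
  obtain L where L: "L-lipschitz_on (cball (f 0) (d / 2)) h"
  proof (rule C1_imp_lipschitz_on)
    have sub: "cball (f 0) (d / 2) \<subseteq> ball (f 0) d" using d by auto
    then show "(h has_real_derivative h' y) (at y)" if "y \<in> cball (f 0) (d / 2)" for y
      using h that by blast
    show "continuous_on (cball (f 0) (d / 2)) h'" using h' sub by (rule continuous_on_subset)
  qed
  have "isCont f 0" using has_gradient_imp_isCont[OF grad_f] r by simp
  then have "\<forall>\<^sub>F x in nhds 0. f x \<in> ball (f 0) (d / 2)"
    by (rule isCont_imp_eventually_nhds[OF _ eventually_nhds_in_open]) (use d in auto)
  with V ev have "\<forall>\<^sub>F x in nhds 0. V x = series_field X x \<and> along X x = h (f x) \<and> f x \<in> ball (f 0) (d / 2)"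
    by eventually_elim auto
  then obtain \<rho>2 where \<rho>2: "\<rho>2 > 0" "\<And>x. dist x 0 < \<rho>2 \<Longrightarrow>
    V x = series_field X x \<and> along X x = h (f x) \<and> f x \<in> ball (f 0) (d / 2)"
    unfolding eventually_nhds_metric by blast
  \<comment> \<open>Halving puts the closed ball inside the open balls where the series converge and
    the local identities hold.\<close>
  define \<rho> where "\<rho> = min \<rho>1 \<rho>2 / 2"
  have \<rho>: "\<rho> > 0" "\<rho> < \<rho>1" "\<rho> < \<rho>2" "\<rho> < r" using \<rho>1 \<rho>2 by (auto simp: \<rho>_def min_def)
  have \<rho>X: "ereal \<rho> < fps_conv_radius (X i)" for i
    using \<rho>1(3)[of i] \<rho>(2) by (meson ereal_less_eq(3) le_less_trans less_imp_le)
  have in_\<rho>: "V x = series_field X x" "along X x = h (f x)" "f x \<in> cball (f 0) (d / 2)" "x \<in> ball 0 r"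
    if "x \<in> cball 0 \<rho>" for x
    using \<rho>2(2)[of x] that \<rho> by auto
  have "\<exists>L. L-lipschitz_on (cball 0 \<rho>) (eval_fps (X i))" for i
  proof -
    have rd: "ereal (norm y) < fps_conv_radius (X i)" if "y \<in> cball 0 \<rho>" for y :: real
      using that \<rho>X[of i] by (auto intro: le_less_trans[of _ "ereal \<rho>"])
    obtain L where "L-lipschitz_on (cball 0 \<rho>) (eval_fps (X i))"
    proof (rule C1_imp_lipschitz_on)
      show "(eval_fps (X i) has_real_derivative eval_fps (fps_deriv (X i)) y) (at y)" if "y \<in> cball 0 \<rho>" for y
        using has_field_derivative_eval_fps[OF rd[OF that]] .
      have "isCont (eval_fps (fps_deriv (X i))) y" if "y \<in> cball 0 \<rho>" for y
        using rd[OF that] fps_conv_radius_deriv[of "X i"]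
        by (intro continuous_eval_fps) (auto intro: less_le_trans)
      then show "continuous_on (cball 0 \<rho>) (eval_fps (fps_deriv (X i)))"
        by (intro continuous_at_imp_continuous_on) auto
    qed
    then show ?thesis by blast
  qed
  then obtain K where K: "\<And>i. (K i)-lipschitz_on (cball 0 \<rho>) (eval_fps (X i))" by metis
  have comp: "x $ i \<in> cball 0 \<rho>" if "x \<in> cball 0 \<rho>" for x :: "real ^ 'n" and i
    using that component_le_norm_cart[of x i] by simp
  have "(\<Sum>i\<in>UNIV. K i)-lipschitz_on (cball 0 \<rho>) V"
  proof (rule lipschitz_onI)
    show "0 \<le> (\<Sum>i\<in>UNIV. K i)" using K by (intro sum_nonneg) (auto simp: lipschitz_on_def)
    fix x y :: "real ^ 'n" assume xy: "x \<in> cball 0 \<rho>" "y \<in> cball 0 \<rho>"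
    have "dist (V x) (V y) \<le> (\<Sum>i\<in>UNIV. \<bar>(V x - V y) $ i\<bar>)"
      unfolding dist_norm by (rule norm_le_l1_cart)
    also have "\<dots> \<le> (\<Sum>i\<in>UNIV. K i * dist x y)"
    proof (rule sum_mono)
      fix i
      have "\<bar>(V x - V y) $ i\<bar> = dist (eval_fps (X i) (x $ i)) (eval_fps (X i) (y $ i))"
        using in_\<rho>(1) xy by (simp add: series_field_def dist_real_def)
      also have "\<dots> \<le> K i * dist (x $ i) (y $ i)"
        by (rule lipschitz_onD[OF K]) (use comp xy in auto)
      also have "\<dots> \<le> K i * dist x y"
        using K[of i] by (intro mult_left_mono dist_vec_nth_le) (auto simp: lipschitz_on_def)
      finally show "\<bar>(V x - V y) $ i\<bar> \<le> K i * dist x y" .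
    qed
    finally show "dist (V x) (V y) \<le> (\<Sum>i\<in>UNIV. K i) * dist x y" by (simp add: sum_distrib_right)
  qed
  then obtain e \<Phi> where e: "0 < e" and \<Phi>0: "\<And>x. x \<in> ball 0 (\<rho> / 2) \<Longrightarrow> \<Phi> 0 x = x"
    and \<Phi>: "\<And>x t. x \<in> ball 0 (\<rho> / 2) \<Longrightarrow> \<bar>t\<bar> < e \<Longrightarrow>
      \<Phi> t x \<in> cball 0 \<rho> \<and> ((\<lambda>s. \<Phi> s x) has_vector_derivative V (\<Phi> t x)) (at t)"
    by (rule picard_lindeloef[OF \<rho>(1)]) (rule that)
  have "local_flow V e (ball 0 (\<rho> / 2)) \<Phi>"
    using e \<rho> \<Phi>0 \<Phi> by (auto simp: local_flow_def)
  moreover have "preserves_foliation e (ball 0 (\<rho> / 2)) \<Phi> u" if u: "u \<in> first_integrals f" for u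
  proof -
    have "u = f \<or> (\<exists>i. u = (\<lambda>x. x $ i))" using u by (auto simp: first_integrals_def)
    then obtain S Lu hu where lip: "Lu-lipschitz_on S hu" and
      ode: "\<And>x t. x \<in> ball 0 (\<rho> / 2) \<Longrightarrow> \<bar>t\<bar> < e \<Longrightarrow>
        u (\<Phi> t x) \<in> S \<and> ((\<lambda>s. u (\<Phi> s x)) has_real_derivative hu (u (\<Phi> t x))) (at t)"
    proof (elim disjE exE)
      assume u: "u = f"
      show thesis
      proof (rule that[OF L])
        fix x :: "real ^ 'n" and t :: real assume "x \<in> ball 0 (\<rho> / 2)" "\<bar>t\<bar> < e"
        note xt = \<Phi>[OF this]
        have "((\<lambda>s. f (\<Phi> s x)) has_real_derivative (\<Sum>i\<in>UNIV. V (\<Phi> t x) $ i * P i (\<Phi> t x))) (at t)"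
          by (rule has_gradient_along[OF grad_f[OF in_\<rho>(4)[OF conjunct1[OF xt]]] conjunct2[OF xt]])
        moreover have "(\<Sum>i\<in>UNIV. V (\<Phi> t x) $ i * P i (\<Phi> t x)) = h (f (\<Phi> t x))"
          using in_\<rho>(1,2)[of "\<Phi> t x"] xt by (simp add: along_def series_field_def)
        ultimately show "u (\<Phi> t x) \<in> cball (f 0) (d / 2) \<and>
          ((\<lambda>s. u (\<Phi> s x)) has_real_derivative h (u (\<Phi> t x))) (at t)"
          using in_\<rho>(3)[of "\<Phi> t x"] xt u by simp
      qed
    next
      fix i assume u: "u = (\<lambda>x. x $ i)"
      show thesis
      proof (rule that[OF K[of i]])
        fix x :: "real ^ 'n" and t :: real assume "x \<in> ball 0 (\<rho> / 2)" "\<bar>t\<bar> < e"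
        note xt = \<Phi>[OF this]
        have "((\<lambda>s. \<Phi> s x $ i) has_real_derivative V (\<Phi> t x) $ i) (at t)"
          unfolding has_real_derivative_iff_has_vector_derivative
          by (rule bounded_linear.has_vector_derivative[OF bounded_linear_vec_nth conjunct2[OF xt]])
        moreover have "V (\<Phi> t x) $ i = eval_fps (X i) (\<Phi> t x $ i)"
          using in_\<rho>(1)[of "\<Phi> t x"] xt by (simp add: series_field_def)
        ultimately show "u (\<Phi> t x) \<in> cball 0 \<rho> \<and>
          ((\<lambda>s. u (\<Phi> s x)) has_real_derivative eval_fps (X i) (u (\<Phi> t x))) (at t)"
          using comp[of "\<Phi> t x" i] xt u by simp
      qed
    qed
    show ?thesis unfolding preserves_foliation_def
    proof (intro allI impI ballI)
      fix t :: real and x y :: "real ^ 'n" assume t: "\<bar>t\<bar> < e" and xy: "x \<in> ball 0 (\<rho> / 2)" "y \<in> ball 0 (\<rho> / 2)" "u x = u y"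
      show "u (\<Phi> t x) = u (\<Phi> t y)"
        by (rule ode_unique[OF lip t, where u = "\<lambda>s. u (\<Phi> s x)" and v = "\<lambda>s. u (\<Phi> s y)"])
          (use ode xy \<Phi>0 in auto)
    qed
  qed
  ultimately show ?thesis using \<open>analytic_field V\<close> unfolding inf_isos_def by blast
qed

end

lemma local_web_imp_web_function:
  fixes f :: "real ^ 'n \<Rightarrow> real"
  assumes "local_web f"
  obtains r P Q where "web_function f r P Q"
proof -
  obtain r P Q where r: "r > 0"
    and P: "\<And>x. x \<in> ball 0 r \<Longrightarrow> has_gradient f (\<lambda>i. P i x) x"
    and Q: "\<And>i x. x \<in> ball 0 r \<Longrightarrow> has_gradient (P i) (\<lambda>j. Q i j x) x"
    "\<And>i j x. x \<in> ball 0 r \<Longrightarrow> Q i j x = Q j i x"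
    "\<And>i j x. x \<in> ball 0 r \<Longrightarrow> isCont (Q i j) x"
    by (rule real_analytic_at_0_C2[of f]) (use assms local_web_def in blast, rule that)
  obtain d where d: "d > 0" "\<And>x i. dist x 0 < d \<Longrightarrow> frechet_derivative f (at x) (axis i 1) \<noteq> 0"
    using assms unfolding local_web_def eventually_nhds_metric by blast
  have "web_function f (min r d) P Q"
  proof
    fix x :: "real ^ 'n" and i j assume "x \<in> ball 0 (min r d)"
    then have x: "x \<in> ball 0 r" "dist x 0 < d" by auto
    show "has_gradient f (\<lambda>i. P i x) x" "has_gradient (P i) (\<lambda>j. Q i j x) x"
      "Q i j x = Q j i x" "isCont (Q i j) x"
      by (rule P Q; fact x)+
    have "frechet_derivative f (at x) = (\<lambda>h. \<Sum>i\<in>UNIV. h $ i * P i x)"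
      using frechet_derivative_at[OF P[OF x(1), unfolded has_gradient_def]] by simp
    then have "frechet_derivative f (at x) (axis i 1) = P i x"
      by (simp add: axis_def if_distrib[of "\<lambda>x. x * _"] cong: if_cong)
    then show "P i x \<noteq> 0" using d(2)[OF x(2), of i] by simp
  qed (use r d in auto)
  then show thesis by (rule that)
qed

section \<open>Bases of the algebra as families of tuples of series\<close>

lemma series_field_unique:
  assumes X: "\<And>i. fps_conv_radius (X i) > 0" and Y: "\<And>i. fps_conv_radius (Y i) > 0"
    and eq: "\<forall>\<^sub>F x in nhds 0. series_field X x = series_field Y x"
  shows "X i = Y i"
proof (rule has_fps_expansion_unique_real)
  show "eval_fps (X i) has_fps_expansion X i" using X by (rule eval_fps_has_fps_expansion)
  have "\<forall>\<^sub>F s in nhds 0. eval_fps (Y i) s = eval_fps (X i) s"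
    using eventually_nhds_axis[OF eq, of i]
    by eventually_elim (simp add: series_field_def vec_eq_iff, metis axis_nth)
  then show "eval_fps (X i) has_fps_expansion Y i" using Y by (simp add: has_fps_expansion_def)
qed

definition lincomb :: "nat \<Rightarrow> (nat \<Rightarrow> real) \<Rightarrow> (nat \<Rightarrow> 'n \<Rightarrow> real fps) \<Rightarrow> 'n \<Rightarrow> real fps" where
  "lincomb m c b i = (\<Sum>j<m. fps_const (c j) * b j i)"

lemma lincomb_field:
  assumes "\<And>j i. j < m \<Longrightarrow> fps_conv_radius (b j i) > 0"
  shows "fps_conv_radius (lincomb m c b i) > 0"
    and "\<forall>\<^sub>F x in nhds 0. series_field (lincomb m c b) x = (\<Sum>j<m. c j *\<^sub>R series_field (b j) x)"
proof -
  have e: "(\<lambda>s. \<Sum>j<m. c j * eval_fps (b j i) s) has_fps_expansion lincomb m c b i" for i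
    unfolding lincomb_def using assms
    by (intro has_fps_expansion_sum has_fps_expansion_cmult_left eval_fps_has_fps_expansion) auto
  then show "fps_conv_radius (lincomb m c b i) > 0" by (simp add: has_fps_expansion_def)
  have "\<forall>\<^sub>F x in nhds 0. \<forall>i. eval_fps (lincomb m c b i) (x $ i) = (\<Sum>j<m. c j * eval_fps (b j i) (x $ i))"
    by (intro eventually_all_finite eventually_nhds_component) (use e in \<open>simp add: has_fps_expansion_def\<close>)
  then show "\<forall>\<^sub>F x in nhds 0. series_field (lincomb m c b) x = (\<Sum>j<m. c j *\<^sub>R series_field (b j) x)"
    by eventually_elim (simp add: series_field_def vec_eq_iff)
qed

context web_function
begin

text \<open>A germ determines its tuple of series, so linear relations can be stated as plain
  equalities, without neighbourhoods.\<close>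

definition series_basis :: "nat \<Rightarrow> (nat \<Rightarrow> 'n \<Rightarrow> real fps) \<Rightarrow> bool" where
  "series_basis m b \<longleftrightarrow> (\<forall>j<m. iso_series (b j)) \<and>
    (\<forall>c. lincomb m c b = (\<lambda>i. 0) \<longrightarrow> (\<forall>j<m. c j = 0)) \<and>
    (\<forall>X. iso_series X \<longrightarrow> (\<exists>c. X = lincomb m c b))"

lemma iso_series_radius: "iso_series X \<Longrightarrow> fps_conv_radius (X i) > 0"
  by (simp add: iso_series_def)

lemma iso_series_lincomb: "(\<And>j. j < m \<Longrightarrow> iso_series (b j)) \<Longrightarrow> iso_series (lincomb m c b)"
proof (induction m)
  case 0
  then show ?case using iso_series_zero by (simp add: lincomb_def[abs_def])
next
  case (Suc m)
  have "iso_series (\<lambda>i. lincomb m c b i + fps_const (c m) * b m i)"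
    by (intro iso_series_add iso_series_scale Suc) auto
  then show ?case by (simp add: lincomb_def[abs_def])
qed

lemma basis_fields:
  assumes b: "\<And>j. j < m \<Longrightarrow> iso_series (b j)"
    and B: "\<And>j. j < m \<Longrightarrow> \<forall>\<^sub>F x in nhds 0. B j x = series_field (b j) x"
  shows "\<forall>\<^sub>F x in nhds 0. (\<Sum>j<m. c j *\<^sub>R B j x) = series_field (lincomb m c b) x"
proof -
  have "\<forall>\<^sub>F x in nhds 0. \<forall>j\<in>{..<m}. B j x = series_field (b j) x"
    using B by (intro eventually_ball_finite) auto
  moreover have "\<forall>\<^sub>F x in nhds 0. series_field (lincomb m c b) x = (\<Sum>j<m. c j *\<^sub>R series_field (b j) x)"
    by (rule lincomb_field(2)) (rule iso_series_radius[OF b])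
  ultimately show ?thesis by eventually_elim simp
qed

lemma series_basis_of_basis:
  assumes "is_basis f m B"
  obtains b where "series_basis m b" "\<And>j. j < m \<Longrightarrow> \<forall>\<^sub>F x in nhds 0. B j x = series_field (b j) x"
proof -
  have "\<forall>j. \<exists>X. j < m \<longrightarrow> iso_series X \<and> (\<forall>\<^sub>F x in nhds 0. B j x = series_field X x)"
  proof
    fix j
    show "\<exists>X. j < m \<longrightarrow> iso_series X \<and> (\<forall>\<^sub>F x in nhds 0. B j x = series_field X x)"
    proof (cases "j < m")
      case True
      then have "B j \<in> inf_isos f" using assms by (simp add: is_basis_def)
      then show ?thesis by (rule series_of_inf_iso) blast
    qed simp
  qed
  then obtain b where b: "\<And>j. j < m \<Longrightarrow> iso_series (b j)"
    and B: "\<And>j. j < m \<Longrightarrow> \<forall>\<^sub>F x in nhds 0. B j x = series_field (b j) x"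
    unfolding choice_iff by blast
  have comb: "\<forall>\<^sub>F x in nhds 0. (\<Sum>j<m. c j *\<^sub>R B j x) = series_field (lincomb m c b) x" for c
    by (rule basis_fields[OF b B])
  have "series_basis m b" unfolding series_basis_def
  proof (intro conjI allI impI)
    show "iso_series (b j)" if "j < m" for j using b that .
    show "c j = 0" if "lincomb m c b = (\<lambda>i. 0)" "j < m" for c j
    proof -
      have "series_field (lincomb m c b) x = 0" for x
        by (simp add: that(1) series_field_def vec_eq_iff)
      then have "\<forall>\<^sub>F x in nhds 0. (\<Sum>j<m. c j *\<^sub>R B j x) = 0" using comb[of c] by simp
      then show ?thesis using assms that(2) unfolding is_basis_def by blast
    qed
    show "\<exists>c. X = lincomb m c b" if X: "iso_series X" for X
    proof -
      have "series_field X \<in> inf_isos f" by (rule inf_iso_of_series[OF X]) simp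
      then obtain c where c: "\<forall>\<^sub>F x in nhds 0. series_field X x = (\<Sum>j<m. c j *\<^sub>R B j x)"
        using assms unfolding is_basis_def by blast
      have ev: "\<forall>\<^sub>F x in nhds 0. series_field X x = series_field (lincomb m c b) x"
        using c comb[of c] by eventually_elim simp
      have "X = lincomb m c b"
        by (rule ext, rule series_field_unique[OF _ _ ev])
          (auto intro: iso_series_radius X iso_series_lincomb b)
      then show ?thesis by blast
    qed
  qed
  then show thesis using B by (rule that)
qed

lemma basis_of_series_basis:
  assumes "series_basis m b"
  shows "is_basis f m (\<lambda>j. series_field (b j))"
proof -
  have b: "\<And>j. j < m \<Longrightarrow> iso_series (b j)" using assms by (simp add: series_basis_def)
  have comb: "\<forall>\<^sub>F x in nhds 0. (\<Sum>j<m. c j *\<^sub>R series_field (b j) x) = series_field (lincomb m c b) x" for c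
    by (rule basis_fields[OF b]) auto
  show ?thesis unfolding is_basis_def
  proof (intro conjI allI impI ballI)
    show "series_field (b j) \<in> inf_isos f" if "j < m" for j
      by (rule inf_iso_of_series[OF b[OF that]]) simp
    show "c j = 0" if c: "\<forall>\<^sub>F x in nhds 0. (\<Sum>j<m. c j *\<^sub>R series_field (b j) x) = 0" and "j < m" for c j
    proof -
      have ev: "\<forall>\<^sub>F x in nhds 0. series_field (lincomb m c b) x = series_field (\<lambda>i. 0) x"
        using c comb[of c] by eventually_elim (simp add: series_field_def vec_eq_iff)
      have "lincomb m c b = (\<lambda>i. 0)"
        by (rule ext, rule series_field_unique[OF _ _ ev]) (auto intro: iso_series_radius iso_series_lincomb b)
      then show ?thesis using assms \<open>j < m\<close> unfolding series_basis_def by blast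
    qed
    show "\<exists>c. \<forall>\<^sub>F x in nhds 0. V x = (\<Sum>j<m. c j *\<^sub>R series_field (b j) x)" if V: "V \<in> inf_isos f" for V
    proof -
      obtain X where X: "iso_series X" "\<forall>\<^sub>F x in nhds 0. V x = series_field X x"
        by (rule series_of_inf_iso[OF V])
      obtain c where c: "X = lincomb m c b" using assms X unfolding series_basis_def by blast
      have "\<forall>\<^sub>F x in nhds 0. V x = (\<Sum>j<m. c j *\<^sub>R series_field (b j) x)"
        using X(2) comb[of c] by eventually_elim (simp add: c)
      then show ?thesis by blast
    qed
  qed
qed

lemma series_basis_exchange:
  assumes b: "series_basis m b" and k: "k < m" "c k \<noteq> 0"
  shows "series_basis m (b(k := lincomb m c b))"
proof -
  let ?b = "b(k := lincomb m c b)"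
  \<comment> \<open>The coefficients with respect to the old basis of the combination
    \<open>d\<close> of the new one. This map is invertible because \<open>c k\<close> is
    non-zero.\<close>
  define e where "e d j = (if j = k then d k * c k else d j + d k * c j)" for d j
  have iso: "\<And>j. j < m \<Longrightarrow> iso_series (b j)" using b by (simp add: series_basis_def)
  have comb: "lincomb m d ?b = lincomb m (e d) b" for d
  proof
    fix i
    have fin: "finite {..<m}" "k \<in> {..<m}" using k by auto
    show "lincomb m d ?b i = lincomb m (e d) b i"
      unfolding lincomb_def e_def sum.remove[OF fin] fun_upd_same if_True
      by (simp add: lincomb_def sum.remove[OF fin] sum_distrib_left sum.distrib ring_distribs mult.assoc
          flip: fps_const_add fps_const_mult)
  qed
  show ?thesis unfolding series_basis_def
  proof (intro conjI allI impI)
    show "iso_series (?b j)" if "j < m" for j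
      using that by (auto intro: iso_series_lincomb iso)
    show "d j = 0" if z: "lincomb m d ?b = (\<lambda>i. 0)" and j: "j < m" for d j
    proof -
      have e0: "\<And>j. j < m \<Longrightarrow> e d j = 0" using b z comb unfolding series_basis_def by metis
      have "d k = 0" using e0[OF k(1)] k(2) by (simp add: e_def)
      then show ?thesis using e0[OF j] by (auto simp: e_def split: if_splits)
    qed
    show "\<exists>d. X = lincomb m d ?b" if X: "iso_series X" for X
    proof -
      obtain a where a: "X = lincomb m a b" using b X unfolding series_basis_def by blast
      define d where "d j = (if j = k then a k / c k else a j - a k / c k * c j)" for j
      have "e d = a" using k(2) by (auto simp: e_def d_def fun_eq_iff)
      then have "X = lincomb m d ?b" using a comb[of d] by simp
      then show ?thesis by blast
    qed
  qed
qed

text \<open>The bound on orders comes from the finite basis. The dichotomy at i is the condition on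
  the origin for the foliation of the i-th coordinate, along which V differentiates to its i-th
  component.\<close>

lemma product_fields_iso_series:
  assumes dim: "series_basis m b" and orig: "suitable_origin f"
  shows "product_fields (Collect iso_series)"
proof
  show "(\<lambda>i. 0) \<in> Collect iso_series" using iso_series_zero by simp
  fix X Y :: "'n \<Rightarrow> real fps" and c :: real assume "X \<in> Collect iso_series" "Y \<in> Collect iso_series"
  then show "(\<lambda>i. X i + Y i) \<in> Collect iso_series" "(\<lambda>i. fps_const c * X i) \<in> Collect iso_series"
    "(\<lambda>i. bracket (X i) (Y i)) \<in> Collect iso_series"
    using iso_series_add iso_series_scale iso_series_bracket by auto
next
  fix i
  obtain N where N: "\<And>c. \<forall>k<N. fps_nth (lincomb m c b i) k = 0 \<Longrightarrow> lincomb m c b i = 0"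
    using span_bounded_order[where m = m and b = "\<lambda>j. b j i"] unfolding lincomb_def by blast
  have "\<forall>X\<in>Collect iso_series. (\<forall>k<N. fps_nth (X i) k = 0) \<longrightarrow> X i = 0"
  proof (intro ballI impI)
    fix X assume "X \<in> Collect iso_series" "\<forall>k<N. fps_nth (X i) k = 0"
    moreover from this obtain c where "X = lincomb m c b" using dim by (auto simp: series_basis_def)
    ultimately show "X i = 0" using N[of c] by simp
  qed
  then show "\<exists>N. \<forall>X\<in>Collect iso_series. (\<forall>k<N. fps_nth (X i) k = 0) \<longrightarrow> X i = 0" by blast
  have along_i: "deriv_along V (\<lambda>x. x $ i) x = V x $ i" for V :: "real ^ 'n \<Rightarrow> real ^ 'n" and x
    unfolding deriv_along_def
    using frechet_derivative_at[OF bounded_linear_imp_has_derivative[OF bounded_linear_vec_nth[of i]]] by metis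
  have "(\<lambda>x. x $ i) \<in> first_integrals f" by (simp add: first_integrals_def)
  then consider V where "V \<in> inf_isos f" "\<forall>\<^sub>F x in nhds 0. V x $ i \<noteq> 0"
    | "\<And>V. V \<in> inf_isos f \<Longrightarrow> \<forall>\<^sub>F x in nhds 0. V x $ i = 0"
    using orig unfolding suitable_origin_def along_i[symmetric] by blast
  then show "(\<exists>X\<in>Collect iso_series. fps_nth (X i) 0 \<noteq> 0) \<or> (\<forall>X\<in>Collect iso_series. X i = 0)"
  proof cases
    case (1 V)
    obtain X where X: "iso_series X" "\<forall>\<^sub>F x in nhds 0. V x = series_field X x"
      by (rule series_of_inf_iso[OF 1(1)])
    have "V 0 $ i \<noteq> 0" "V 0 = series_field X 0"
      using eventually_nhds_x_imp_x[OF 1(2)] eventually_nhds_x_imp_x[OF X(2)] by auto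
    then have "fps_nth (X i) 0 \<noteq> 0" by (simp add: series_field_def eval_fps_at_0)
    then show ?thesis using X by auto
  next
    case 2
    have "X i = 0" if X: "iso_series X" for X
    proof (rule has_fps_expansion_zero_imp_zero)
      have "series_field X \<in> inf_isos f" by (rule inf_iso_of_series[OF X]) simp
      from eventually_nhds_axis[OF 2[OF this], of i]
      have "\<forall>\<^sub>F s in nhds 0. eval_fps (X i) s = 0"
        by eventually_elim (simp add: series_field_def)
      then show "(\<lambda>_. 0) has_fps_expansion X i"
        using iso_series_radius[OF X] by (simp add: has_fps_expansion_def)
    qed
    then show ?thesis by auto
  qed
qed

text \<open>The two special fields are inserted by exchange. The second exchange must not remove U,
  and this is possible unless V is a multiple of U; in that case U is parabolic wherever V is. A
  zero field cannot be inserted, but it is parabolic nowhere. At indices where neither is parabolic,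
  a basis element with non-zero component is so itself.\<close>

lemma parabolic_basis:
  assumes b0: "series_basis m b0" and orig: "suitable_origin f"
  obtains b where "series_basis m b"
    "\<And>X i. iso_series X \<Longrightarrow> X i \<noteq> 0 \<Longrightarrow>
      \<exists>j<m. product_fields.parabolic (Collect iso_series) (b j) i"
proof -
  interpret product_fields "Collect iso_series" by (rule product_fields_iso_series[OF assms])
  obtain U V where UV: "iso_series U" "iso_series V"
    and par: "\<And>W i. iso_series W \<Longrightarrow> W i \<noteq> 0 \<Longrightarrow> parabolic W i \<or> parabolic U i \<or> parabolic V i"
    using parabolic_pair by (metis mem_Collect_eq)
  have nonzero: "W i \<noteq> 0" if "parabolic W i" for W i using that by (auto simp: parabolic_def)
  have span: "\<exists>c. X = lincomb m c b" if "series_basis m b" "iso_series X" for b X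
    using that by (auto simp: series_basis_def)
  have insert: "\<exists>k<m. series_basis m (b(k := W))" if b: "series_basis m b" and W: "iso_series W" "W i \<noteq> 0" for b W i
  proof -
    obtain c where c: "W = lincomb m c b" using span[OF b W(1)] by blast
    have "\<exists>k<m. c k \<noteq> 0"
    proof (rule ccontr)
      assume "\<not> ?thesis"
      then have "W i = 0" unfolding c lincomb_def by (intro sum.neutral) auto
      then show False using W by simp
    qed
    then show ?thesis using series_basis_exchange[OF b] c by metis
  qed
  have "\<exists>b. series_basis m b \<and> (\<forall>i. parabolic U i \<or> parabolic V i \<longrightarrow> (\<exists>j<m. parabolic (b j) i))"
  proof (cases "\<exists>i. U i \<noteq> 0")
    case False
    then have Un: "\<not> parabolic U i" for i using nonzero by blast
    show ?thesis
    proof (cases "\<exists>i. V i \<noteq> 0")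
      case False
      then show ?thesis using Un nonzero b0 by blast
    next
      case True
      then obtain k where "k < m" "series_basis m (b0(k := V))" using insert[OF b0 UV(2)] by blast
      then show ?thesis using Un by (intro exI[of _ "b0(k := V)"]) (auto intro!: exI[of _ k])
    qed
  next
    case True
    then obtain k where k: "k < m" "series_basis m (b0(k := U))" using insert[OF b0 UV(1)] by blast
    let ?b = "b0(k := U)"
    obtain c where c: "V = lincomb m c ?b" using span[OF k(2) UV(2)] by blast
    show ?thesis
    proof (cases "\<exists>l<m. l \<noteq> k \<and> c l \<noteq> 0")
      case True
      then obtain l where l: "l < m" "l \<noteq> k" "c l \<noteq> 0" by blast
      have "series_basis m (?b(l := V))" unfolding c by (rule series_basis_exchange[where c = c, OF k(2) l(1,3)])
      then show ?thesis using k l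
        by (intro exI[of _ "?b(l := V)"] conjI allI impI) (auto intro: exI[of _ k] exI[of _ l])
    next
      case False
      have Vi: "V i = fps_const (c k) * U i" for i
      proof -
        have "V i = (\<Sum>j<m. if j = k then fps_const (c k) * U i else 0)"
          unfolding c lincomb_def using False by (intro sum.cong) auto
        then show ?thesis using k by simp
      qed
      have "parabolic U i" if "parabolic V i" for i
      proof -
        have ck: "c k \<noteq> 0" using nonzero[OF that] Vi[of i] by auto
        show ?thesis using that ck unfolding parabolic_def Vi bracket_linear by auto
      qed
      then show ?thesis using k by (intro exI[of _ ?b]) (auto intro!: exI[of _ k])
    qed
  qed
  then obtain b where b: "series_basis m b"
    and hit: "\<And>i. parabolic U i \<or> parabolic V i \<Longrightarrow> \<exists>j<m. parabolic (b j) i" by blast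
  show thesis
  proof (rule that[OF b])
    fix X i assume X: "iso_series X" "X i \<noteq> 0"
    obtain c where c: "X = lincomb m c b" using span[OF b X(1)] by blast
    have "\<exists>j<m. b j i \<noteq> 0"
    proof (rule ccontr)
      assume "\<not> ?thesis"
      then have "X i = 0" unfolding c lincomb_def by (intro sum.neutral) auto
      then show False using X by simp
    qed
    then obtain j where "j < m" "b j i \<noteq> 0" by blast
    moreover have "iso_series (b j)" using b \<open>j < m\<close> by (simp add: series_basis_def)
    ultimately show "\<exists>j<m. parabolic (b j) i" using par[of "b j" i] hit by blast
  qed
qed

end

text \<open>The variables are fixed by one parabolic basis element per non-zero column. Parabolicity
  concerns the whole algebra, so the quadratic form holds in every basis; the entries 1 belong to
  the basis from which the variables were built.\<close>

theorem proposition4p3: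
  fixes f :: "real ^ 'n \<Rightarrow> real" and m :: nat
  assumes "local_web f"
    and "\<not> parallelizable f"
    and "has_dimension f m"
    and "suitable_origin f"
  shows "\<exists>g :: 'n \<Rightarrow> real \<Rightarrow> real.
    (\<forall>i. change_of_variable (g i)) \<and>
    (\<forall>B. is_basis f m B \<longrightarrow>
      (\<forall>j<m. \<forall>i. \<exists>p :: real poly. degree p \<le> 2 \<and>
        becomes (g i) (comp_matrix B j i) (poly p))) \<and>
    (\<exists>B. is_basis f m B \<and>
      (\<forall>i. \<not> zero_column m (comp_matrix B) i \<longrightarrow>
        (\<exists>j<m. becomes (g i) (comp_matrix B j i) (\<lambda>_. 1))))"
proof -
  obtain r P Q where "web_function f r P Q" by (rule local_web_imp_web_function[OF assms(1)])
  then interpret web_function f r P Q .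
  obtain B0 where "is_basis f m B0" using assms(3) by (auto simp: has_dimension_def)
  then obtain b0 where b0: "series_basis m b0" by (rule series_basis_of_basis)
  interpret product_fields "Collect iso_series" by (rule product_fields_iso_series[OF b0 assms(4)])
  obtain b where b: "series_basis m b"
    and par: "\<And>X i. iso_series X \<Longrightarrow> X i \<noteq> 0 \<Longrightarrow> \<exists>j<m. parabolic (b j) i"
    by (rule parabolic_basis[OF b0 assms(4)]) (rule that)
  define nz where "nz i \<longleftrightarrow> (\<exists>j<m. parabolic (b j) i)" for i
  define J where "J i = (SOME j. j < m \<and> parabolic (b j) i)" for i
  have J: "J i < m" "parabolic (b (J i)) i" if "nz i" for i
    using someI_ex[of "\<lambda>j. j < m \<and> parabolic (b j) i"] that unfolding J_def nz_def by blast+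
  define E where "E i = b (J i) i" for i
  have E: "fps_nth (E i) 0 \<noteq> 0" "fps_conv_radius (E i) > 0" if "nz i" for i
    using J[OF that] b iso_series_radius by (auto simp: E_def parabolic_def series_basis_def)
  \<comment> \<open>Where no basis element is parabolic, the column is zero and the variable is
    kept.\<close>
  define g where "g i = (if nz i then eval_fps (fps_integral0 (inverse (E i))) else (\<lambda>s. s))" for i
  have expansion: "comp_matrix B j i has_fps_expansion X i"
    if "iso_series X" "\<forall>\<^sub>F x in nhds 0. B j x = series_field X x" for B :: "nat \<Rightarrow> real ^ 'n \<Rightarrow> real ^ 'n" and X j i
  proof -
    have "\<forall>\<^sub>F s in nhds 0. eval_fps (X i) s = comp_matrix B j i s"
      using eventually_nhds_axis[OF that(2), of i]
      by eventually_elim (simp add: comp_matrix_def series_field_def)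
    then show ?thesis using iso_series_radius[OF that(1)] by (simp add: has_fps_expansion_def)
  qed
  have "change_of_variable (g i)" for i
  proof (cases "nz i")
    case True
    then show ?thesis using change_of_variable_integral(1)[OF E] by (simp add: g_def)
  next
    case False
    have "real_analytic1_at (\<lambda>s. s) 0" unfolding real_analytic1_at_def
    proof (intro exI[of _ 1] conjI exI[of _ "\<lambda>k. if k = 1 then 1 else 0"] ballI)
      show "(\<lambda>k. (if k = 1 then 1 else 0) * (x - 0) ^ k) sums x" for x :: real
        using sums_single[of 1 "\<lambda>k. x ^ k"] by (simp add: if_distrib[of "\<lambda>t. t * _"] cong: if_cong)
    qed simp
    then show ?thesis using False by (simp add: g_def change_of_variable_def)
  qed
  moreover have "\<exists>p. degree p \<le> 2 \<and> becomes (g i) (comp_matrix B j i) (poly p)"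
    if B: "is_basis f m B" and j: "j < m" for B j i
  proof -
    have "B j \<in> inf_isos f" using B j by (simp add: is_basis_def)
    then obtain X where X: "iso_series X" "\<forall>\<^sub>F x in nhds 0. B j x = series_field X x"
      by (rule series_of_inf_iso)
    note XF = expansion[where B = B and j = j, OF X]
    show ?thesis
    proof (cases "nz i")
      case True
      have "bracket (E i) (bracket (E i) (bracket (E i) (X i))) = 0"
        using J(2)[OF True] X(1) by (simp add: parabolic_def E_def)
      from quotient_quadratic[OF E(1)[OF True] this] obtain a d c where
        "X i * inverse (E i) = fps_const a + fps_const d * fps_integral0 (inverse (E i)) +
          fps_const c * (fps_integral0 (inverse (E i)) * fps_integral0 (inverse (E i)))" by blast
      from change_of_variable_integral(2)[OF E[OF True] XF this]
      have "becomes (g i) (comp_matrix B j i) (poly [:a, d, c:])" using True by (simp add: g_def)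
      moreover have "degree [:a, d, c:] \<le> 2" by simp
      ultimately show ?thesis by blast
    next
      case False
      then have "X i = 0" using par[OF X(1)] by (auto simp: nz_def)
      then have "\<forall>\<^sub>F s in nhds 0. comp_matrix B j i s = 0"
        using XF[of i] by (auto simp: has_fps_expansion_def elim!: eventually_mono)
      then have "becomes (g i) (comp_matrix B j i) (poly 0)"
        unfolding becomes_def by eventually_elim simp
      then show ?thesis by (intro exI[of _ 0]) auto
    qed
  qed
  moreover have "\<exists>B. is_basis f m B \<and> (\<forall>i. \<not> zero_column m (comp_matrix B) i \<longrightarrow>
        (\<exists>j<m. becomes (g i) (comp_matrix B j i) (\<lambda>_. 1)))"
  proof (intro exI[of _ "\<lambda>j. series_field (b j)"] conjI allI impI)
    show "is_basis f m (\<lambda>j. series_field (b j))" by (rule basis_of_series_basis[OF b])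
    have XF: "comp_matrix (\<lambda>j. series_field (b j)) j i has_fps_expansion b j i" if "j < m" for j i
      by (rule expansion) (use b that in \<open>auto simp: series_basis_def\<close>)
    fix i assume "\<not> zero_column m (comp_matrix (\<lambda>j. series_field (b j))) i"
    then obtain j where j: "j < m" "\<not> (\<forall>\<^sub>F s in nhds 0. comp_matrix (\<lambda>j. series_field (b j)) j i s = 0)"
      by (auto simp: zero_column_def)
    have "b j i \<noteq> 0"
    proof
      assume "b j i = 0"
      then have "\<forall>\<^sub>F s in nhds 0. comp_matrix (\<lambda>j. series_field (b j)) j i s = 0"
        using XF[OF j(1), of i] by (auto simp: has_fps_expansion_def elim!: eventually_mono)
      then show False using j(2) by blast
    qed
    moreover have "iso_series (b j)" using b j(1) by (simp add: series_basis_def)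
    ultimately have nz: "nz i" using par unfolding nz_def by blast
    \<comment> \<open>The straightening field has quotient 1 by itself, the constant case of the
      quadratic expansion.\<close>
    have "E i * inverse (E i) = fps_const 1 + fps_const 0 * fps_integral0 (inverse (E i)) +
      fps_const 0 * (fps_integral0 (inverse (E i)) * fps_integral0 (inverse (E i)))"
      using inverse_mult_eq_1[OF E(1)[OF nz]] by (simp add: mult.commute)
    from change_of_variable_integral(2)[OF E[OF nz] XF[OF J(1)[OF nz], of i, folded E_def] this]
    have "becomes (g i) (comp_matrix (\<lambda>j. series_field (b j)) (J i) i) (poly [:1, 0, 0:])"
      using nz by (simp add: g_def)
    moreover have "poly [:1, 0, 0:] = (\<lambda>_. 1 :: real)" by auto
    ultimately show "\<exists>j<m. becomes (g i) (comp_matrix (\<lambda>j. series_field (b j)) j i) (\<lambda>_. 1)"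
      using J(1)[OF nz] by auto
  qed
  ultimately show ?thesis by blast
qed

end
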